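(* Let $\mathcal{H}$ be the Heisenberg Lie algebra over $\mathbb{Z}$, and let $R_{\mathcal{H}}$, $R_{\mathcal{H}_p}$ (for each prime $p$), $\widehat{R}_{\mathcal{H}}$, $\iota_p:R_{\mathcal{H}_p}\to\widehat{R}_{\mathcal{H}}$ and $\eta^*_{\mathcal{H}}:\widehat{R}_{\mathcal{H}}\to R_{\mathcal{H}}$ be as in the context. Then: (1) for each prime $p$, the composite $\eta^*_{\mathcal{H}}\circ\iota_p: R_{\mathcal{H}_p}\to R_{\mathcal{H}}$ is an injective ring homomorphism (so $R_{\mathcal{H}_p}$ embeds into $R_{\mathcal{H}}$); (2) for distinct primes $p\neq q$, every element of $\eta^*_{\mathcal{H}}\iota_p(R_{\mathcal{H}_p})$ commutes with every element of $\eta^*_{\mathcal{H}}\iota_q(R_{\mathcal{H}_q})$ in $R_{\mathcal{H}}$; (3) $R_{\mathcal{H}}$ is not generated as a ring by the subrings $\eta^*_{\mathcal{H}}\iota_p(R_{\mathcal{H}_p})$, $p$ prime.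
   Context: Hecke rings: let $G$ be a group, $\Gamma\subset G$ a subgroup and $\Delta$ a submonoid with $\Gamma\subset\Delta\subset G$ such that every double coset $\Gamma\alpha\Gamma$ ($\alpha\in\Delta$) is a finite union of right cosets $\Gamma\beta$. The Hecke ring with respect to $(\Gamma,\Delta)$ is the free abelian group on the double cosets $\Gamma\alpha\Gamma$, $\alpha\in\Delta$, with multiplication $(\Gamma\alpha\Gamma)(\Gamma\beta\Gamma)=\sum_{\Gamma\xi\Gamma}m(\xi)\,\Gamma\xi\Gamma$, where $m(\xi)$ is the number of cosets $\Gamma\gamma\subset\Gamma\beta\Gamma$ with $\xi\gamma^{-1}\in\Gamma\alpha\Gamma$. The Heisenberg Lie algebra $\mathcal{H}$ is the quotient of the free Lie algebra $L_2$ over $\mathbb{Z}$ on two generators by the ideal $[L_2,[L_2,L_2]]$. Put $G_{\mathcal H}=\mathrm{Aut}^{alg}_{\mathbb Q}(\mathcal H\otimes\mathbb Q)$, $\Delta_{\mathcal H}=\mathrm{End}^{alg}_{\mathbb Z}(\mathcal H)\cap G_{\mathcal H}$, $\Gamma_{\mathcal H}=\mathrm{Aut}^{alg}_{\mathbb Z}(\mathcal H)$, and for each prime $p$, $G_{\mathcal H_p}=\mathrm{Aut}^{alg}_{\mathbb Q_p}(\mathcal H\otimes\mathbb Q_p)$, $\Delta_{\mathcal H_p}=\mathrm{End}^{alg}_{\mathbb Z_p}(\mathcal H\otimes\mathbb Z_p)\cap G_{\mathcal H_p}$, $\Gamma_{\mathcal H_p}=\mathrm{Aut}^{alg}_{\mathbb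 Z_p}(\mathcal H\otimes\mathbb Z_p)$. Concretely, $G_{\mathcal H}$ is identified with the set $GL_2(\mathbb Q)\times\mathbb Q^2$ with product $(A,\mathbf a)(B,\mathbf b)=(AB,A\mathbf b+\det(B)\mathbf a)$ (column vectors), with $\Delta_{\mathcal H}=(M_2(\mathbb Z)\cap GL_2(\mathbb Q))\times\mathbb Z^2$ and $\Gamma_{\mathcal H}=GL_2(\mathbb Z)\times\mathbb Z^2$; likewise $G_{\mathcal H_p}=GL_2(\mathbb Q_p)\times\mathbb Q_p^2$, $\Delta_{\mathcal H_p}=(M_2(\mathbb Z_p)\cap GL_2(\mathbb Q_p))\times\mathbb Z_p^2$, $\Gamma_{\mathcal H_p}=GL_2(\mathbb Z_p)\times\mathbb Z_p^2$. $R_{\mathcal H}$ and $R_{\mathcal H_p}$ are the Hecke rings with respect to $(\Gamma_{\mathcal H},\Delta_{\mathcal H})$ and $(\Gamma_{\mathcal H_p},\Delta_{\mathcal H_p})$. Let $\widehat G_{\mathcal H}$ be the set of $(\alpha_p)_p\in\prod_p G_{\mathcal H_p}$ with $\alpha_p\in\Gamma_{\mathcal H_p}$ for almost all $p$, $\widehat\Delta_{\mathcal H}=(\prod_p\Delta_{\mathcal H_p})\cap\widehat G_{\mathcal H}$, $\widehat\Gamma_{\mathcal H}=\prod_p\Gamma_{\mathcal H_p}$, and $\widehat R_{\mathcal H}$ the Hecke ring with respect to $(\widehat\Gamma_{\mathcal H},\widehat\Delta_{\mathcal H})$. Each $\Delta_{\mathcal H_p}$ is regarded as a subset of $\widehat\Delta_{\mathcal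 H}$ (identity in the other components), and $\iota_p:R_{\mathcal H_p}\to\widehat R_{\mathcal H}$ is the map $\Gamma_{\mathcal H_p}\alpha\Gamma_{\mathcal H_p}\mapsto\widehat\Gamma_{\mathcal H}\alpha\widehat\Gamma_{\mathcal H}$. Let $\eta_{\mathcal H}:\Delta_{\mathcal H}\to\widehat\Delta_{\mathcal H}$ be the diagonal embedding, and $\eta^*_{\mathcal H}:\widehat R_{\mathcal H}\to R_{\mathcal H}$ the additive map $\widehat\Gamma_{\mathcal H}\widehat\alpha\widehat\Gamma_{\mathcal H}\mapsto\sum\Gamma_{\mathcal H}\beta\Gamma_{\mathcal H}$, the sum over $\Gamma_{\mathcal H}\backslash\eta_{\mathcal H}^{-1}(\widehat\Gamma_{\mathcal H}\widehat\alpha\widehat\Gamma_{\mathcal H})/\Gamma_{\mathcal H}$. *)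

theory Defs
  imports
    "HOL-Algebra.Free_Abelian_Groups"
    "HOL-Algebra.Generated_Rings"
    "HOL-Algebra.QuotRing"
    "HOL-Algebra.Algebraic_Closure_Type"
    "HOL-Computational_Algebra.Primes"
    Complex_Main
begin

hide_const (open) Divisibility.prime

subsection \<open>Hecke rings\<close>

definition double_coset :: "('a, 'm) monoid_scheme \<Rightarrow> 'a set \<Rightarrow> 'a \<Rightarrow> 'a set" where
  "double_coset G \<Gamma> \<alpha> = (\<Gamma> #>\<^bsub>G\<^esub> \<alpha>) <#>\<^bsub>G\<^esub> \<Gamma>"

definition double_cosets :: "('a, 'm) monoid_scheme \<Rightarrow> 'a set \<Rightarrow> 'a set \<Rightarrow> 'a set set" where
  "double_cosets G \<Gamma> \<Delta> = double_coset G \<Gamma> ` \<Delta>"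

definition coset_rep :: "'a set \<Rightarrow> 'a" where
  "coset_rep D = (SOME \<alpha>. \<alpha> \<in> D)"

definition hecke_count ::
    "('a, 'm) monoid_scheme \<Rightarrow> 'a set \<Rightarrow> 'a set \<Rightarrow> 'a set \<Rightarrow> 'a \<Rightarrow> nat" where
  "hecke_count G \<Gamma> A B \<xi> =
     card {\<Gamma> #>\<^bsub>G\<^esub> \<gamma> | \<gamma>. \<gamma> \<in> carrier G \<and> \<Gamma> #>\<^bsub>G\<^esub> \<gamma> \<subseteq> B \<and> \<xi> \<otimes>\<^bsub>G\<^esub> inv\<^bsub>G\<^esub> \<gamma> \<in> A}"

text \<open>The product of two double cosets. The coefficient \<open>m(\<xi>)\<close> depends only on the double
  coset of \<open>\<xi>\<close>, and only finitely many double cosets have a nonzero coefficient.\<close>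

definition hecke_mult ::
    "('a, 'm) monoid_scheme \<Rightarrow> 'a set \<Rightarrow> 'a set \<Rightarrow> 'a set \<Rightarrow> 'a set \<Rightarrow> 'a set \<Rightarrow>\<^sub>0 int" where
  "hecke_mult G \<Gamma> \<Delta> A B =
     (\<Sum>D \<in> {D \<in> double_cosets G \<Gamma> \<Delta>. hecke_count G \<Gamma> A B (coset_rep D) \<noteq> 0}.
        frag_cmul (int (hecke_count G \<Gamma> A B (coset_rep D))) (frag_of D))"

definition hecke_ring ::
    "('a, 'm) monoid_scheme \<Rightarrow> 'a set \<Rightarrow> 'a set \<Rightarrow> ('a set \<Rightarrow>\<^sub>0 int) ring" where
  "hecke_ring G \<Gamma> \<Delta> =
     \<lparr>carrier = carrier (free_Abelian_group (double_cosets G \<Gamma> \<Delta>)),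
      monoid.mult = (\<lambda>x y. frag_extend (\<lambda>A. frag_extend (\<lambda>B. hecke_mult G \<Gamma> \<Delta> A B) y) x),
      one = frag_of (double_coset G \<Gamma> \<one>\<^bsub>G\<^esub>),
      ring.zero = 0,
      add = (+)\<rparr>"

subsection \<open>The p-adic numbers\<close>

definition padic_abs :: "nat \<Rightarrow> rat \<Rightarrow> real" where
  "padic_abs p x = (if x = 0 then 0 else
     real p powi (int (multiplicity (int p) (snd (quotient_of x)))
                  - int (multiplicity (int p) (fst (quotient_of x)))))"

definition padic_cauchy :: "nat \<Rightarrow> (nat \<Rightarrow> rat) \<Rightarrow> bool" where
  "padic_cauchy p x \<longleftrightarrow> (\<forall>e>0. \<exists>N. \<forall>m\<ge>N. \<forall>n\<ge>N. padic_abs p (x m - x n) < e)"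

definition padic_cauchy_ring :: "nat \<Rightarrow> (nat \<Rightarrow> rat) ring" where
  "padic_cauchy_ring p =
     \<lparr>carrier = {x. padic_cauchy p x},
      monoid.mult = (\<lambda>x y n. x n * y n), one = (\<lambda>n. 1),
      ring.zero = (\<lambda>n. 0), add = (\<lambda>x y n. x n + y n)\<rparr>"

definition padic_null :: "nat \<Rightarrow> (nat \<Rightarrow> rat) set" where
  "padic_null p = {x. (\<lambda>n. padic_abs p (x n)) \<longlonglongrightarrow> 0}"

text \<open>A single type holds the elements of the field of p-adic numbers for all primes p at once.\<close>

type_synonym padic = "(nat \<Rightarrow> rat) set"

definition Qp :: "nat \<Rightarrow> padic ring" where
  "Qp p = padic_cauchy_ring p Quot padic_null p"

definition padic_of_seq :: "nat \<Rightarrow> (nat \<Rightarrow> rat) \<Rightarrow> padic" where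
  "padic_of_seq p x = padic_null p +>\<^bsub>padic_cauchy_ring p\<^esub> x"

definition padic_of_rat :: "nat \<Rightarrow> rat \<Rightarrow> padic" where
  "padic_of_rat p r = padic_of_seq p (\<lambda>n. r)"

text \<open>The closed unit ball: the absolute value of a Cauchy sequence is eventually constant or
  tends to 0, so a p-adic number of absolute value at most 1 has a representing sequence all of
  whose terms have absolute value at most 1.\<close>

definition Zp :: "nat \<Rightarrow> padic set" where
  "Zp p = {padic_of_seq p x | x. padic_cauchy p x \<and> (\<forall>n. padic_abs p (x n) \<le> 1)}"

subsection \<open>Automorphisms of the Heisenberg Lie algebra\<close>

text \<open>The element \<open>((a, b, c, d), (u, v))\<close> is the pair of the matrix with rows
  \<open>(a, b)\<close> and \<open>(c, d)\<close> and the column vector with entries \<open>u\<close> and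
  \<open>v\<close>. With \<open>e\<^sub>1\<close>, \<open>e\<^sub>2\<close> the generators and \<open>z = [e\<^sub>1, e\<^sub>2]\<close>, it is
  the automorphism \<open>e\<^sub>1 \<mapsto> a e\<^sub>1 + b e\<^sub>2 + u z\<close>, \<open>e\<^sub>2 \<mapsto> c e\<^sub>1 + d e\<^sub>2 + v z\<close>,
  \<open>z \<mapsto> (a d - b c) z\<close>, automorphisms acting from the right.\<close>

type_synonym 'a heis = "('a \<times> 'a \<times> 'a \<times> 'a) \<times> ('a \<times> 'a)"

fun heis_det :: "('a, 'm) ring_scheme \<Rightarrow> 'a heis \<Rightarrow> 'a" where
  "heis_det R ((a, b, c, d), (u, v)) = (a \<otimes>\<^bsub>R\<^esub> d) \<ominus>\<^bsub>R\<^esub> (b \<otimes>\<^bsub>R\<^esub> c)"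

fun heis_entries :: "'a heis \<Rightarrow> 'a set" where
  "heis_entries ((a, b, c, d), (u, v)) = {a, b, c, d, u, v}"

fun heis_map :: "('a \<Rightarrow> 'b) \<Rightarrow> 'a heis \<Rightarrow> 'b heis" where
  "heis_map f ((a, b, c, d), (u, v)) = ((f a, f b, f c, f d), (f u, f v))"

text \<open>The product \<open>(A, x) (B, y) = (A B, A y + det B x)\<close>.\<close>

fun heis_mult :: "('a, 'm) ring_scheme \<Rightarrow> 'a heis \<Rightarrow> 'a heis \<Rightarrow> 'a heis" where
  "heis_mult R ((a, b, c, d), (u, v)) ((a', b', c', d'), (u', v')) =
     (let \<delta> = heis_det R ((a', b', c', d'), (u', v')) in
      ((a \<otimes>\<^bsub>R\<^esub> a' \<oplus>\<^bsub>R\<^esub> b \<otimes>\<^bsub>R\<^esub> c', a \<otimes>\<^bsub>R\<^esub> b' \<oplus>\<^bsub>R\<^esub> b \<otimes>\<^bsub>R\<^esub> d',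
        c \<otimes>\<^bsub>R\<^esub> a' \<oplus>\<^bsub>R\<^esub> d \<otimes>\<^bsub>R\<^esub> c', c \<otimes>\<^bsub>R\<^esub> b' \<oplus>\<^bsub>R\<^esub> d \<otimes>\<^bsub>R\<^esub> d'),
       ((a \<otimes>\<^bsub>R\<^esub> u' \<oplus>\<^bsub>R\<^esub> b \<otimes>\<^bsub>R\<^esub> v') \<oplus>\<^bsub>R\<^esub> \<delta> \<otimes>\<^bsub>R\<^esub> u,
        (c \<otimes>\<^bsub>R\<^esub> u' \<oplus>\<^bsub>R\<^esub> d \<otimes>\<^bsub>R\<^esub> v') \<oplus>\<^bsub>R\<^esub> \<delta> \<otimes>\<^bsub>R\<^esub> v)))"

definition heis_group :: "('a, 'm) ring_scheme \<Rightarrow> 'a heis monoid" where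
  "heis_group R =
     \<lparr>carrier = {\<alpha>. heis_entries \<alpha> \<subseteq> carrier R \<and> heis_det R \<alpha> \<in> Units R},
      monoid.mult = heis_mult R,
      one = ((\<one>\<^bsub>R\<^esub>, \<zero>\<^bsub>R\<^esub>, \<zero>\<^bsub>R\<^esub>, \<one>\<^bsub>R\<^esub>), (\<zero>\<^bsub>R\<^esub>, \<zero>\<^bsub>R\<^esub>))\<rparr>"

text \<open>For a subring with underlying set S of a field K: the integral endomorphisms that are
  invertible over K, and the automorphisms over S.\<close>

definition heis_Delta :: "('a, 'm) ring_scheme \<Rightarrow> 'a set \<Rightarrow> 'a heis set" where
  "heis_Delta K S = {\<alpha> \<in> carrier (heis_group K). heis_entries \<alpha> \<subseteq> S}"

definition heis_Gamma :: "('a, 'm) ring_scheme \<Rightarrow> 'a set \<Rightarrow> 'a heis set" where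
  "heis_Gamma K S = carrier (heis_group (K\<lparr>carrier := S\<rparr>))"

subsection \<open>The global, local and adelic Hecke rings\<close>

definition G_H :: "rat heis monoid" where
  "G_H = heis_group ring_of_type_algebra"

definition Delta_H :: "rat heis set" where
  "Delta_H = heis_Delta ring_of_type_algebra \<int>"

definition Gamma_H :: "rat heis set" where
  "Gamma_H = heis_Gamma ring_of_type_algebra \<int>"

definition R_H :: "(rat heis set \<Rightarrow>\<^sub>0 int) ring" where
  "R_H = hecke_ring G_H Gamma_H Delta_H"

definition G_Hp :: "nat \<Rightarrow> padic heis monoid" where
  "G_Hp p = heis_group (Qp p)"

definition Delta_Hp :: "nat \<Rightarrow> padic heis set" where
  "Delta_Hp p = heis_Delta (Qp p) (Zp p)"

definition Gamma_Hp :: "nat \<Rightarrow> padic heis set" where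
  "Gamma_Hp p = heis_Gamma (Qp p) (Zp p)"

definition R_Hp :: "nat \<Rightarrow> (padic heis set \<Rightarrow>\<^sub>0 int) ring" where
  "R_Hp p = hecke_ring (G_Hp p) (Gamma_Hp p) (Delta_Hp p)"

abbreviation primes :: "nat set" where
  "primes \<equiv> {p. prime p}"

definition G_hat :: "(nat \<Rightarrow> padic heis) monoid" where
  "G_hat = (product_group primes G_Hp)
     \<lparr>carrier := {\<alpha> \<in> carrier (product_group primes G_Hp).
                    finite {p \<in> primes. \<alpha> p \<notin> Gamma_Hp p}}\<rparr>"

definition Delta_hat :: "(nat \<Rightarrow> padic heis) set" where
  "Delta_hat = (\<Pi>\<^sub>E p\<in>primes. Delta_Hp p) \<inter> carrier G_hat"

definition Gamma_hat :: "(nat \<Rightarrow> padic heis) set" where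
  "Gamma_hat = (\<Pi>\<^sub>E p\<in>primes. Gamma_Hp p)"

definition R_hat :: "((nat \<Rightarrow> padic heis) set \<Rightarrow>\<^sub>0 int) ring" where
  "R_hat = hecke_ring G_hat Gamma_hat Delta_hat"

definition local_embed :: "nat \<Rightarrow> padic heis \<Rightarrow> (nat \<Rightarrow> padic heis)" where
  "local_embed p \<alpha> = (\<lambda>q\<in>primes. if q = p then \<alpha> else \<one>\<^bsub>G_Hp q\<^esub>)"

definition iota :: "nat \<Rightarrow> (padic heis set \<Rightarrow>\<^sub>0 int) \<Rightarrow> ((nat \<Rightarrow> padic heis) set \<Rightarrow>\<^sub>0 int)" where
  "iota p = frag_extend
     (\<lambda>D. frag_of (double_coset G_hat Gamma_hat (local_embed p (coset_rep D))))"

definition eta :: "rat heis \<Rightarrow> (nat \<Rightarrow> padic heis)" where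
  "eta \<alpha> = (\<lambda>p\<in>primes. heis_map (padic_of_rat p) \<alpha>)"

definition eta_star :: "((nat \<Rightarrow> padic heis) set \<Rightarrow>\<^sub>0 int) \<Rightarrow> (rat heis set \<Rightarrow>\<^sub>0 int)" where
  "eta_star = frag_extend
     (\<lambda>D. \<Sum>E \<in> double_cosets G_H Gamma_H {\<beta> \<in> Delta_H. eta \<beta> \<in> D}. frag_of E)"

end

theory Submission
  imports Defs
begin

text \<open>
  An element of a Hecke ring is a biinvariant function on \<open>\<Delta>\<close> supported on finitely many double
  cosets, and the product is the convolution \<open>(F * H)(\<xi>) = \<Sum> F(\<xi> \<gamma>\<^sup>-\<^sup>1) H(\<gamma>)\<close> over the right cosets
  \<open>\<Gamma>\<gamma>\<close>. Let \<open>G0 p\<close> be the group of rational elements that are integral automorphisms at every prime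
  other than \<open>p\<close>. Hermite normal forms show that every right coset of the local group in its monoid
  contains an element of \<open>G0 p\<close>, which is unique up to \<open>\<Gamma>\<close>. So \<open>\<eta>\<^sup>* \<circ> \<iota>\<^sub>p\<close>, which pulls functions back to
  \<open>G0 p\<close> and extends them by zero, preserves convolution and is injective. For \<open>p \<noteq> q\<close> the
  convolution of functions \<open>x\<close> and \<open>y\<close> pulled back from \<open>p\<close> and \<open>q\<close> has at most one nonzero term and takes
  the value \<open>x(\<xi>\<^sub>p) y(\<xi>\<^sub>q)\<close>, which is symmetric.

  Restricted to \<open>G0 p\<close>, every element of the ring generated by the local images is pulled back from \<open>p\<close>,
  hence constant on local double cosets. But such a double coset can split globally: the classes of
  \<open>(A, a)\<close> with \<open>A\<close> fixed are the orbits of \<open>a\<close> modulo \<open>A \<int>\<^sup>2\<close> under \<open>a \<mapsto> det(B)\<^sup>-\<^sup>1 B a\<close> for those \<open>B\<close>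
  with \<open>A\<^sup>-\<^sup>1 B A\<close> integral. For \<open>A = diag(5, 125)\<close> and \<open>a = (1, 5)\<close> the stabiliser of \<open>a\<close> only has
  determinants congruent to 1 modulo 5, so moving \<open>a\<close> by a matrix whose determinant is a 5-adic unit not
  congruent to 1 or -1 modulo 5 gives a new global class.
\<close>

section \<open>Hecke rings as convolution rings\<close>

text \<open>The obstruction in the third claim is a determinant. The product twists the vector part
  by a determinant; determinants in \<open>Gamma_H\<close> are 1 or -1, those in
  \<open>Gamma_Hp p\<close> are arbitrary p-adic units. The least prime with a unit residue other
  than 1 and -1 is 5. For diag(5, 125), integrality of the conjugate makes the lower left entry of B
  divisible by 25, and the entry 5 of the vector removes the upper right entry modulo 5. The two
  coordinates then fix both diagonal entries modulo 5, hence the determinant. Coefficients of a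
  Hecke product are read off at chosen representatives, and a sum over an infinite set is 0 in HOL,
  so invariance and finiteness must be settled before anything else. Local finiteness of cosets
  rests on a determinant bound for Hermite forms; global finiteness follows from it at the primes
  dividing the determinant. \<open>Qp p\<close> is handled as a commutative ring only: writing each
  nonzero element of \<open>Zp p\<close> as a power of p times a unit of \<open>Zp p\<close> takes
  the place of division.\<close>

lemma mem_double_coset_iff:
  "y \<in> double_coset G \<Gamma> a \<longleftrightarrow> (\<exists>g\<in>\<Gamma>. \<exists>h\<in>\<Gamma>. y = g \<otimes>\<^bsub>G\<^esub> a \<otimes>\<^bsub>G\<^esub> h)"
  by (auto simp: double_coset_def r_coset_def set_mult_def)

text \<open>On S the map f factors through F. This bounds a set of global cosets by the finite set
  of their local images.\<close>

lemma finite_image_factor: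
  assumes "finite (F ` S)" "\<And>a b. \<lbrakk>a \<in> S; b \<in> S; F a = F b\<rbrakk> \<Longrightarrow> f a = f b"
  shows "finite (f ` S)"
proof -
  have "f ` S \<subseteq> (\<lambda>t. f (inv_into S F t)) ` (F ` S)"
  proof
    fix y assume "y \<in> f ` S"
    then obtain a where a: "a \<in> S" "y = f a" by blast
    then have "y = f (inv_into S F (F a))"
      using assms(2)[OF a(1) inv_into_into[of "F a"]] f_inv_into_f[of "F a" F S] by simp
    then show "y \<in> (\<lambda>t. f (inv_into S F t)) ` (F ` S)" using a by blast
  qed
  then show ?thesis using assms(1) finite_subset by blast
qed

text \<open>The identity lies in \<Delta> because \<Gamma> does. A double coset is the union of the
  right cosets of its elements, so \<open>finite_cosets\<close> says that this union is
  finite.\<close>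

locale hecke_pair = group G for G :: "('a, 'm) monoid_scheme" (structure) +
  fixes \<Gamma> \<Delta> :: "'a set"
  assumes subgroup_Gamma: "subgroup \<Gamma> G"
    and Gamma_le_Delta: "\<Gamma> \<subseteq> \<Delta>"
    and Delta_le: "\<Delta> \<subseteq> carrier G"
    and Delta_mult: "\<lbrakk>a \<in> \<Delta>; b \<in> \<Delta>\<rbrakk> \<Longrightarrow> a \<otimes> b \<in> \<Delta>"
    and finite_cosets: "\<alpha> \<in> \<Delta> \<Longrightarrow> finite ((#>) \<Gamma> ` double_coset G \<Gamma> \<alpha>)"
begin

abbreviation dc where "dc \<equiv> double_coset G \<Gamma>"

abbreviation R where "R \<equiv> hecke_ring G \<Gamma> \<Delta>"

lemma Gamma_le: "\<Gamma> \<subseteq> carrier G"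
  using subgroup_Gamma subgroup.subset by blast

lemma Gamma_closed [simp]: "g \<in> \<Gamma> \<Longrightarrow> g \<in> carrier G"
  using Gamma_le by blast

lemma Delta_closed [simp]: "g \<in> \<Delta> \<Longrightarrow> g \<in> carrier G"
  using Delta_le by blast

lemma Gamma_one [simp]: "\<one> \<in> \<Gamma>"
  by (simp add: subgroup.one_closed subgroup_Gamma)

lemma Gamma_mult [simp]: "\<lbrakk>a \<in> \<Gamma>; b \<in> \<Gamma>\<rbrakk> \<Longrightarrow> a \<otimes> b \<in> \<Gamma>"
  by (simp add: subgroup.m_closed subgroup_Gamma)

lemma Gamma_inv [simp]: "a \<in> \<Gamma> \<Longrightarrow> inv a \<in> \<Gamma>"
  by (simp add: subgroup.m_inv_closed subgroup_Gamma)

lemma mem_dc_iff: "\<xi> \<in> dc \<alpha> \<longleftrightarrow> (\<exists>g\<in>\<Gamma>. \<exists>h\<in>\<Gamma>. \<xi> = g \<otimes> \<alpha> \<otimes> h)"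
  by (rule mem_double_coset_iff)

lemma dc_closed: "\<lbrakk>\<alpha> \<in> carrier G; \<xi> \<in> dc \<alpha>\<rbrakk> \<Longrightarrow> \<xi> \<in> carrier G"
  by (auto simp: mem_dc_iff)

lemma dc_self: "\<alpha> \<in> carrier G \<Longrightarrow> \<alpha> \<in> dc \<alpha>"
  unfolding mem_dc_iff by (metis Gamma_one l_one r_one)

lemma dc_sub: assumes "\<alpha> \<in> carrier G" "\<xi> \<in> dc \<alpha>" shows "dc \<xi> \<subseteq> dc \<alpha>"
proof
  fix x assume "x \<in> dc \<xi>"
  then obtain g h where "g \<in> \<Gamma>" "h \<in> \<Gamma>" "x = g \<otimes> \<xi> \<otimes> h" by (auto simp: mem_dc_iff)
  moreover obtain g' h' where "g' \<in> \<Gamma>" "h' \<in> \<Gamma>" "\<xi> = g' \<otimes> \<alpha> \<otimes> h'"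
    using assms by (auto simp: mem_dc_iff)
  ultimately have "x = (g \<otimes> g') \<otimes> \<alpha> \<otimes> (h' \<otimes> h)" "g \<otimes> g' \<in> \<Gamma>" "h' \<otimes> h \<in> \<Gamma>"
    using assms by (auto simp: m_assoc)
  then show "x \<in> dc \<alpha>" unfolding mem_dc_iff by blast
qed

lemma dc_sym: assumes "\<alpha> \<in> carrier G" "\<xi> \<in> dc \<alpha>" shows "\<alpha> \<in> dc \<xi>"
proof -
  obtain g h where gh: "g \<in> \<Gamma>" "h \<in> \<Gamma>" "\<xi> = g \<otimes> \<alpha> \<otimes> h"
    using assms by (auto simp: mem_dc_iff)
  then have "\<alpha> = inv g \<otimes> \<xi> \<otimes> inv h"
    using assms(1) by (simp add: m_assoc) (simp add: m_assoc[symmetric])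
  then show ?thesis using gh unfolding mem_dc_iff by (metis Gamma_inv)
qed

lemma dc_eq_iff:
  assumes "\<alpha> \<in> carrier G" "\<xi> \<in> carrier G"
  shows "dc \<xi> = dc \<alpha> \<longleftrightarrow> \<xi> \<in> dc \<alpha>"
  using assms dc_sub dc_sym dc_self dc_closed by (metis subset_antisym)

lemma dc_mult_left [simp]:
  assumes "\<alpha> \<in> carrier G" "g \<in> \<Gamma>" shows "dc (g \<otimes> \<alpha>) = dc \<alpha>"
proof -
  have "g \<otimes> \<alpha> = g \<otimes> \<alpha> \<otimes> \<one>" using assms by simp
  then have "g \<otimes> \<alpha> \<in> dc \<alpha>" unfolding mem_dc_iff using assms Gamma_one by blast
  then show ?thesis using assms by (simp add: dc_eq_iff)
qed

lemma dc_mult_right [simp]: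
  assumes "\<alpha> \<in> carrier G" "g \<in> \<Gamma>" shows "dc (\<alpha> \<otimes> g) = dc \<alpha>"
proof -
  have "\<alpha> \<otimes> g = \<one> \<otimes> \<alpha> \<otimes> g" using assms by simp
  then have "\<alpha> \<otimes> g \<in> dc \<alpha>" unfolding mem_dc_iff using assms Gamma_one by blast
  then show ?thesis using assms by (simp add: dc_eq_iff)
qed

lemma dc_sub_Delta: assumes "\<alpha> \<in> \<Delta>" shows "dc \<alpha> \<subseteq> \<Delta>"
  using assms Gamma_le_Delta by (auto simp: mem_dc_iff intro!: Delta_mult)

lemma dc_mem_double_cosets_iff:
  assumes "\<xi> \<in> carrier G"
  shows "dc \<xi> \<in> double_cosets G \<Gamma> \<Delta> \<longleftrightarrow> \<xi> \<in> \<Delta>"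
  using assms dc_sub_Delta dc_self unfolding double_cosets_def by blast

lemma dc_one: "dc \<one> = \<Gamma>"
proof -
  have "x \<in> \<Gamma> \<Longrightarrow> x \<in> dc \<one>" for x
    using dc_mult_left[of \<one> x] dc_self[of x] by simp
  then show ?thesis by (auto simp: mem_dc_iff)
qed

lemma double_cosetE:
  assumes "D \<in> double_cosets G \<Gamma> \<Delta>"
  obtains \<alpha> where "\<alpha> \<in> \<Delta>" "D = dc \<alpha>"
  using assms unfolding double_cosets_def by blast

lemma coset_rep_double_coset:
  assumes "D \<in> double_cosets G \<Gamma> \<Delta>"
  shows "coset_rep D \<in> D" "coset_rep D \<in> \<Delta>" "dc (coset_rep D) = D"
proof -
  obtain \<alpha> where a: "\<alpha> \<in> \<Delta>" "D = dc \<alpha>" using assms by (rule double_cosetE)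
  show 1: "coset_rep D \<in> D"
    unfolding coset_rep_def using a dc_self[of \<alpha>] by (metis Delta_closed someI_ex)
  show 2: "coset_rep D \<in> \<Delta>" using 1 a dc_sub_Delta by blast
  show "dc (coset_rep D) = D" using 1 2 a by (simp add: dc_eq_iff)
qed

section \<open>Right cosets and their chosen representatives\<close>

lemma rcos_eq_iff:
  assumes "a \<in> carrier G" "b \<in> carrier G"
  shows "\<Gamma> #> a = \<Gamma> #> b \<longleftrightarrow> a \<otimes> inv b \<in> \<Gamma>"
proof
  assume "\<Gamma> #> a = \<Gamma> #> b"
  then have "a \<in> \<Gamma> #> b" using assms rcos_self subgroup_Gamma by blast
  then obtain g where "g \<in> \<Gamma>" "a = g \<otimes> b" by (auto simp: r_coset_def)
  then show "a \<otimes> inv b \<in> \<Gamma>" using assms by (simp add: m_assoc)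
next
  assume "a \<otimes> inv b \<in> \<Gamma>"
  then have "a \<in> \<Gamma> #> b"
    using assms unfolding r_coset_def
    by (auto intro!: bexI[of _ "a \<otimes> inv b"] simp: m_assoc)
  then show "\<Gamma> #> a = \<Gamma> #> b" using assms repr_independence subgroup_Gamma by metis
qed

lemma rcos_mult_left [simp]:
  assumes "a \<in> carrier G" "g \<in> \<Gamma>"
  shows "\<Gamma> #> (g \<otimes> a) = \<Gamma> #> a"
  using assms by (simp add: rcos_eq_iff m_assoc)

lemma coset_rep_rcoset:
  assumes "C \<in> rcosets \<Gamma>"
  shows "coset_rep C \<in> C" "coset_rep C \<in> carrier G" "\<Gamma> #> coset_rep C = C"
proof -
  obtain a where a: "a \<in> carrier G" "C = \<Gamma> #> a" using assms by (auto simp: RCOSETS_def)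
  show 1: "coset_rep C \<in> C"
    unfolding coset_rep_def using a rcos_self[OF a(1) subgroup_Gamma] by (metis someI_ex)
  show "coset_rep C \<in> carrier G" using 1 a r_coset_subset_G Gamma_le by blast
  show "\<Gamma> #> coset_rep C = C" using 1 a repr_independence subgroup_Gamma by metis
qed

lemma coset_rep_r_coset:
  assumes "a \<in> carrier G"
  shows "\<exists>g\<in>\<Gamma>. coset_rep (\<Gamma> #> a) = g \<otimes> a"
proof -
  have "\<Gamma> #> a \<in> rcosets \<Gamma>" using assms by (simp add: rcosetsI Gamma_le)
  then have "coset_rep (\<Gamma> #> a) \<in> \<Gamma> #> a" by (rule coset_rep_rcoset)
  then show ?thesis by (auto simp: r_coset_def)
qed

section \<open>Invariant functions, sums over right cosets, and convolution\<close>

definition left_invariant :: "('a \<Rightarrow> int) \<Rightarrow> bool" where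
  "left_invariant f \<longleftrightarrow> (\<forall>a\<in>carrier G. \<forall>g\<in>\<Gamma>. f (g \<otimes> a) = f a)"

definition right_invariant :: "('a \<Rightarrow> int) \<Rightarrow> bool" where
  "right_invariant f \<longleftrightarrow> (\<forall>a\<in>carrier G. \<forall>g\<in>\<Gamma>. f (a \<otimes> g) = f a)"

definition supp :: "('a \<Rightarrow> int) \<Rightarrow> 'a set set" where
  "supp f = {C \<in> rcosets \<Gamma>. f (coset_rep C) \<noteq> 0}"

text \<open>For left invariant f the choice of representatives is immaterial. Summing over
  \<open>supp f\<close> only makes the sum meaningful when finitely many cosets contribute; an
  infinite support yields the default value 0.\<close>

definition coset_sum :: "('a \<Rightarrow> int) \<Rightarrow> int" where
  "coset_sum f = (\<Sum>C\<in>supp f. f (coset_rep C))"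

definition conv :: "('a \<Rightarrow> int) \<Rightarrow> ('a \<Rightarrow> int) \<Rightarrow> 'a \<Rightarrow> int" where
  "conv F H \<xi> = coset_sum (\<lambda>\<gamma>. F (\<xi> \<otimes> inv \<gamma>) * H \<gamma>)"

lemma left_invariant_coset_rep:
  assumes "left_invariant f" "a \<in> carrier G"
  shows "f (coset_rep (\<Gamma> #> a)) = f a"
  using assms coset_rep_r_coset[OF assms(2)] by (auto simp: left_invariant_def)

lemma coset_sum_cong:
  assumes "\<And>a. a \<in> carrier G \<Longrightarrow> f a = g a"
  shows "coset_sum f = coset_sum g"
proof -
  have "f (coset_rep C) = g (coset_rep C)" if "C \<in> rcosets \<Gamma>" for C
    using assms coset_rep_rcoset(2)[OF that] by blast
  then show ?thesis unfolding coset_sum_def supp_def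
    by (intro sum.cong) auto
qed

lemma coset_sum_superset:
  assumes "finite P" "P \<subseteq> rcosets \<Gamma>" "supp f \<subseteq> P"
  shows "coset_sum f = (\<Sum>C\<in>P. f (coset_rep C))"
  unfolding coset_sum_def using assms
  by (intro sum.mono_neutral_left) (auto simp: supp_def)

lemma coset_sum_sum:
  assumes "finite I" "\<And>i. i \<in> I \<Longrightarrow> finite (supp (f i))"
  shows "coset_sum (\<lambda>a. \<Sum>i\<in>I. f i a) = (\<Sum>i\<in>I. coset_sum (f i))"
proof -
  let ?P = "\<Union>i\<in>I. supp (f i)"
  have P: "finite ?P" "?P \<subseteq> rcosets \<Gamma>" using assms by (auto simp: supp_def)
  have "supp (\<lambda>a. \<Sum>i\<in>I. f i a) \<subseteq> ?P"
    unfolding supp_def using sum.not_neutral_contains_not_neutral by fastforce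
  then have "coset_sum (\<lambda>a. \<Sum>i\<in>I. f i a) = (\<Sum>C\<in>?P. \<Sum>i\<in>I. f i (coset_rep C))"
    by (intro coset_sum_superset P)
  also have "\<dots> = (\<Sum>i\<in>I. \<Sum>C\<in>?P. f i (coset_rep C))" by (rule sum.swap)
  also have "\<dots> = (\<Sum>i\<in>I. coset_sum (f i))"
    by (intro sum.cong refl coset_sum_superset[symmetric] P) auto
  finally show ?thesis .
qed

lemma coset_sum_cmul: "coset_sum (\<lambda>a. f a * c) = coset_sum f * c"
proof (cases "c = 0")
  case True then show ?thesis by (simp add: coset_sum_def)
next
  case False
  then have "supp (\<lambda>a. f a * c) = supp f" by (simp add: supp_def)
  then show ?thesis by (simp add: coset_sum_def sum_distrib_right)
qed

text \<open>Right translation by h permutes the right cosets. It need not carry chosen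
  representatives to chosen representatives; left invariance of f absorbs the difference.\<close>

lemma supp_shift:
  assumes "left_invariant f" "h \<in> carrier G"
  shows "bij_betw (\<lambda>C. C #> h) (supp (\<lambda>a. f (a \<otimes> h))) (supp f)"
proof (rule bij_betw_byWitness[where f' = "\<lambda>C. C #> inv h"])
  have sub: "C \<subseteq> carrier G" if "C \<in> rcosets \<Gamma>" for C
    using that subgroup_Gamma subgroup.rcosets_carrier group_axioms by metis
  show "\<forall>C\<in>supp (\<lambda>a. f (a \<otimes> h)). C #> h #> inv h = C"
    using assms by (auto simp: supp_def coset_mult_assoc sub)
  show "\<forall>C\<in>supp f. C #> inv h #> h = C"
    using assms by (auto simp: supp_def coset_mult_assoc sub)
  have cos: "C #> k = \<Gamma> #> (coset_rep C \<otimes> k)" if "C \<in> rcosets \<Gamma>" "k \<in> carrier G" for C k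
    using coset_rep_rcoset[OF that(1)] that Gamma_le coset_mult_assoc by metis
  have "f (coset_rep (C #> h)) = f (coset_rep C \<otimes> h)" if "C \<in> rcosets \<Gamma>" for C
    using assms that by (simp add: cos left_invariant_coset_rep coset_rep_rcoset(2))
  then show "(\<lambda>C. C #> h) ` supp (\<lambda>a. f (a \<otimes> h)) \<subseteq> supp f"
    using assms Gamma_le by (auto simp: supp_def cos coset_rep_rcoset(2) intro!: rcosetsI)
  have "f (coset_rep (C #> inv h) \<otimes> h) = f (coset_rep C)" if C: "C \<in> rcosets \<Gamma>" for C
  proof -
    obtain g where g: "g \<in> \<Gamma>" "coset_rep (\<Gamma> #> (coset_rep C \<otimes> inv h)) = g \<otimes> (coset_rep C \<otimes> inv h)"
      using coset_rep_r_coset[of "coset_rep C \<otimes> inv h"] coset_rep_rcoset(2)[OF C] assms by auto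
    then show ?thesis using assms C
      by (simp add: cos m_assoc coset_rep_rcoset(2) left_invariant_def)
  qed
  then show "(\<lambda>C. C #> inv h) ` supp f \<subseteq> supp (\<lambda>a. f (a \<otimes> h))"
    using assms Gamma_le by (auto simp: supp_def cos coset_rep_rcoset(2) intro!: rcosetsI)
qed

lemma coset_sum_shift:
  assumes "left_invariant f" "h \<in> carrier G"
  shows "coset_sum (\<lambda>a. f (a \<otimes> h)) = coset_sum f"
proof -
  have "f (coset_rep (C #> h)) = f (coset_rep C \<otimes> h)" if "C \<in> supp (\<lambda>a. f (a \<otimes> h))" for C
  proof -
    have C: "C \<in> rcosets \<Gamma>" using that by (simp add: supp_def)
    have "C #> h = \<Gamma> #> (coset_rep C \<otimes> h)"
      using coset_rep_rcoset[OF C] assms Gamma_le coset_mult_assoc by metis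
    then show ?thesis using assms C by (simp add: left_invariant_coset_rep coset_rep_rcoset(2))
  qed
  then show ?thesis unfolding coset_sum_def
    using sum.reindex_bij_betw[OF supp_shift[OF assms], of "\<lambda>C. f (coset_rep C)"]
    by (metis (no_types, lifting) sum.cong)
qed

text \<open>Replacing \<gamma> by g \<gamma> multiplies the argument of F on the right by the
  inverse of g. Right invariance of F and left invariance of H together make the terms of a
  convolution depend on the right coset alone.\<close>

lemma conv_integrand_left_invariant:
  assumes "right_invariant F" "left_invariant H" "\<xi> \<in> carrier G"
  shows "left_invariant (\<lambda>\<gamma>. F (\<xi> \<otimes> inv \<gamma>) * H \<gamma>)"
  using assms unfolding left_invariant_def right_invariant_def
  by (auto simp: inv_mult_group m_assoc[symmetric])

lemma supp_conv_integrand: "supp (\<lambda>\<gamma>. F \<gamma> * H \<gamma>) \<subseteq> supp H"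
  by (auto simp: supp_def)

text \<open>Both sides become a finite sum over \<open>supp K\<close>. For each representative c
  occurring there, the remaining sums agree by a right translation by the inverse of c. Finite
  supports of H and K justify exchanging the sums.\<close>

lemma conv_assoc:
  assumes F: "right_invariant F" and H: "right_invariant H" "left_invariant H" "finite (supp H)"
    and K: "left_invariant K" "finite (supp K)" and \<xi>: "\<xi> \<in> carrier G"
  shows "conv (conv F H) K \<xi> = conv F (conv H K) \<xi>"
proof -
  let ?P = "supp K"
  have P: "?P \<subseteq> rcosets \<Gamma>" by (auto simp: supp_def)
  have cK: "conv E K \<epsilon> = (\<Sum>C\<in>?P. E (\<epsilon> \<otimes> inv (coset_rep C)) * K (coset_rep C))" for E \<epsilon>
    unfolding conv_def by (intro coset_sum_superset K P supp_conv_integrand)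
  have Pc: "coset_rep C \<in> carrier G" if "C \<in> ?P" for C
    using that P coset_rep_rcoset(2) by blast
  have "conv F (conv H K) \<xi>
      = coset_sum (\<lambda>\<epsilon>. \<Sum>C\<in>?P. (F (\<xi> \<otimes> inv \<epsilon>) * H (\<epsilon> \<otimes> inv (coset_rep C))) * K (coset_rep C))"
    unfolding conv_def[of F] cK by (simp add: sum_distrib_left mult.assoc)
  also have "\<dots> = (\<Sum>C\<in>?P. coset_sum (\<lambda>\<epsilon>. (F (\<xi> \<otimes> inv \<epsilon>) * H (\<epsilon> \<otimes> inv (coset_rep C))) * K (coset_rep C)))"
  proof (rule coset_sum_sum[OF K(2)])
    fix C assume C: "C \<in> ?P"
    have "finite (supp (\<lambda>a. H (a \<otimes> inv (coset_rep C))))"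
      using bij_betw_finite[OF supp_shift[OF H(2), of "inv (coset_rep C)"]] Pc[OF C] H(3) by simp
    moreover have "supp (\<lambda>\<epsilon>. (F (\<xi> \<otimes> inv \<epsilon>) * H (\<epsilon> \<otimes> inv (coset_rep C))) * K (coset_rep C))
        \<subseteq> supp (\<lambda>a. H (a \<otimes> inv (coset_rep C)))" by (auto simp: supp_def)
    ultimately show "finite (supp (\<lambda>\<epsilon>. (F (\<xi> \<otimes> inv \<epsilon>) * H (\<epsilon> \<otimes> inv (coset_rep C))) * K (coset_rep C)))"
      by (rule rev_finite_subset)
  qed
  also have "\<dots> = (\<Sum>C\<in>?P. conv F H (\<xi> \<otimes> inv (coset_rep C)) * K (coset_rep C))"
  proof (rule sum.cong[OF refl])
    fix C assume "C \<in> ?P"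
    then have c: "coset_rep C \<in> carrier G" by (rule Pc)
    \<comment> \<open>With c the representative of C, the new variable \<delta> is \<epsilon> times
      the inverse of c; then \<xi> \<epsilon>^-1 = \<xi> c^-1 \<delta>^-1.\<close>
    let ?f = "\<lambda>\<delta>. F (\<xi> \<otimes> inv (coset_rep C) \<otimes> inv \<delta>) * H \<delta>"
    have "coset_sum (\<lambda>\<epsilon>. F (\<xi> \<otimes> inv \<epsilon>) * H (\<epsilon> \<otimes> inv (coset_rep C)))
        = coset_sum (\<lambda>\<epsilon>. ?f (\<epsilon> \<otimes> inv (coset_rep C)))"
    proof (rule coset_sum_cong)
      fix \<epsilon> assume e: "\<epsilon> \<in> carrier G"
      have "inv (coset_rep C) \<otimes> (coset_rep C \<otimes> inv \<epsilon>) = inv \<epsilon>"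
        using c e by (simp add: m_assoc[symmetric])
      then show "F (\<xi> \<otimes> inv \<epsilon>) * H (\<epsilon> \<otimes> inv (coset_rep C)) = ?f (\<epsilon> \<otimes> inv (coset_rep C))"
        using c e \<xi> by (simp add: inv_mult_group m_assoc)
    qed
    also have "\<dots> = coset_sum ?f"
      by (intro coset_sum_shift conv_integrand_left_invariant F H) (use c \<xi> in auto)
    finally show "coset_sum (\<lambda>\<epsilon>. (F (\<xi> \<otimes> inv \<epsilon>) * H (\<epsilon> \<otimes> inv (coset_rep C))) * K (coset_rep C))
        = conv F H (\<xi> \<otimes> inv (coset_rep C)) * K (coset_rep C)"
      by (simp add: coset_sum_cmul conv_def)
  qed
  finally show ?thesis unfolding cK by simp
qed

lemma coset_sum_single:
  assumes "left_invariant f" "\<gamma> \<in> carrier G"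
    and "\<And>a. \<lbrakk>a \<in> carrier G; f a \<noteq> 0\<rbrakk> \<Longrightarrow> a \<otimes> inv \<gamma> \<in> \<Gamma>"
  shows "coset_sum f = f \<gamma>"
proof -
  have "supp f \<subseteq> {\<Gamma> #> \<gamma>}"
  proof
    fix C assume C: "C \<in> supp f"
    then have "C \<in> rcosets \<Gamma>" by (simp add: supp_def)
    note r = coset_rep_rcoset[OF this]
    have "coset_rep C \<otimes> inv \<gamma> \<in> \<Gamma>" using C assms(3) r by (simp add: supp_def)
    then show "C \<in> {\<Gamma> #> \<gamma>}" using r assms(2) rcos_eq_iff by auto
  qed
  then have "coset_sum f = (\<Sum>C\<in>{\<Gamma> #> \<gamma>}. f (coset_rep C))"
    using assms(2) Gamma_le by (intro coset_sum_superset) (auto intro!: rcosetsI)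
  then show ?thesis using assms by (simp add: left_invariant_coset_rep)
qed

section \<open>Elements of the Hecke ring as biinvariant functions\<close>

definition hfun :: "('a set \<Rightarrow>\<^sub>0 int) \<Rightarrow> 'a \<Rightarrow> int" where
  "hfun x \<xi> = poly_mapping.lookup x (dc \<xi>)"

lemma hfun_inv: "right_invariant (hfun x)" "left_invariant (hfun x)"
  by (auto simp: hfun_def left_invariant_def right_invariant_def)

lemma carrier_R: "x \<in> carrier R \<longleftrightarrow> Poly_Mapping.keys x \<subseteq> double_cosets G \<Gamma> \<Delta>"
  by (simp add: hecke_ring_def)

lemma hfun_outside:
  assumes "x \<in> carrier R" "\<xi> \<in> carrier G" "\<xi> \<notin> \<Delta>"
  shows "hfun x \<xi> = 0"
  using assms dc_mem_double_cosets_iff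
  by (auto simp: hfun_def carrier_R in_keys_iff subset_iff)

lemma hfun_eqI:
  assumes "x \<in> carrier R" "y \<in> carrier R" "\<And>\<xi>. \<xi> \<in> \<Delta> \<Longrightarrow> hfun x \<xi> = hfun y \<xi>"
  shows "x = y"
proof (rule poly_mapping_eqI)
  fix D
  show "poly_mapping.lookup x D = poly_mapping.lookup y D"
  proof (cases "D \<in> double_cosets G \<Gamma> \<Delta>")
    case True
    then show ?thesis using assms(3) by (auto simp: double_cosets_def hfun_def)
  next
    case False
    then show ?thesis using assms(1,2) unfolding carrier_R by (metis in_keys_iff subsetD)
  qed
qed

lemma finite_cosets_dc:
  assumes "D \<in> double_cosets G \<Gamma> \<Delta>"
  shows "finite ((#>) \<Gamma> ` D)"
  using assms finite_cosets by (auto simp: double_cosets_def)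

lemma supp_hfun: "supp (hfun x) \<subseteq> (\<Union>D\<in>Poly_Mapping.keys x. (#>) \<Gamma> ` D)"
proof
  fix C assume C: "C \<in> supp (hfun x)"
  then have r: "C \<in> rcosets \<Gamma>" by (simp add: supp_def)
  have "dc (coset_rep C) \<in> Poly_Mapping.keys x"
    using C by (simp add: supp_def hfun_def in_keys_iff)
  moreover have "C \<in> (#>) \<Gamma> ` dc (coset_rep C)"
    using coset_rep_rcoset[OF r] dc_self by (metis image_eqI)
  ultimately show "C \<in> (\<Union>D\<in>Poly_Mapping.keys x. (#>) \<Gamma> ` D)" by blast
qed

lemma finite_supp_hfun: assumes "x \<in> carrier R" shows "finite (supp (hfun x))"
  by (rule finite_subset[OF supp_hfun]) (use assms finite_cosets_dc carrier_R in auto)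

text \<open>On the basis elements A and B the integrand is the 0-1 indicator of the counted
  condition, so its support is exactly the set of counted cosets. Here a right coset lies in B as
  soon as one of its elements does, because B is left invariant.\<close>

lemma hecke_count_eq_coset_sum:
  assumes A: "A \<in> double_cosets G \<Gamma> \<Delta>" and B: "B \<in> double_cosets G \<Gamma> \<Delta>" and \<xi>: "\<xi> \<in> carrier G"
  shows "int (hecke_count G \<Gamma> A B \<xi>) = conv (hfun (frag_of A)) (hfun (frag_of B)) \<xi>"
proof -
  obtain \<alpha> where \<alpha>: "\<alpha> \<in> \<Delta>" "A = dc \<alpha>" using A by (rule double_cosetE)
  obtain \<beta> where \<beta>: "\<beta> \<in> \<Delta>" "B = dc \<beta>" using B by (rule double_cosetE)
  let ?f = "\<lambda>\<gamma>. hfun (frag_of A) (\<xi> \<otimes> inv \<gamma>) * hfun (frag_of B) \<gamma>"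
  have linv: "left_invariant ?f" using \<xi> by (intro conv_integrand_left_invariant hfun_inv)
  have f: "?f \<gamma> = (if \<xi> \<otimes> inv \<gamma> \<in> A \<and> \<gamma> \<in> B then 1 else 0)" if "\<gamma> \<in> carrier G" for \<gamma>
    using that \<xi> \<alpha> \<beta> dc_eq_iff[of \<alpha> "\<xi> \<otimes> inv \<gamma>"] dc_eq_iff[of \<beta> \<gamma>]
    by (auto simp: hfun_def)
  have sub: "\<Gamma> #> \<gamma> \<subseteq> B \<longleftrightarrow> \<gamma> \<in> B" if "\<gamma> \<in> carrier G" for \<gamma>
  proof
    assume "\<Gamma> #> \<gamma> \<subseteq> B" then show "\<gamma> \<in> B" using rcos_self[OF that subgroup_Gamma] by blast
  next
    assume "\<gamma> \<in> B"
    then have "g \<otimes> \<gamma> \<in> B" if "g \<in> \<Gamma>" for g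
      using that \<open>\<gamma> \<in> carrier G\<close> \<beta> dc_eq_iff[of \<beta> "g \<otimes> \<gamma>"] dc_eq_iff[of \<beta> \<gamma>] by simp
    then show "\<Gamma> #> \<gamma> \<subseteq> B" by (auto simp: r_coset_def)
  qed
  have "{\<Gamma> #> \<gamma> | \<gamma>. \<gamma> \<in> carrier G \<and> \<Gamma> #> \<gamma> \<subseteq> B \<and> \<xi> \<otimes> inv \<gamma> \<in> A} = supp ?f" (is "?L = _")
  proof (intro equalityI subsetI)
    fix C assume "C \<in> ?L"
    then obtain \<gamma> where g: "\<gamma> \<in> carrier G" "\<Gamma> #> \<gamma> \<subseteq> B" "\<xi> \<otimes> inv \<gamma> \<in> A" "C = \<Gamma> #> \<gamma>" by blast
    then have "?f (coset_rep C) = 1"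
      using left_invariant_coset_rep[OF linv g(1)] f[OF g(1)] sub[OF g(1)] by simp
    then have "?f (coset_rep C) \<noteq> 0" by (metis zero_neq_one)
    then show "C \<in> supp ?f" unfolding supp_def using g Gamma_le rcosetsI by blast
  next
    fix C assume C: "C \<in> supp ?f"
    then have "C \<in> rcosets \<Gamma>" by (simp add: supp_def)
    note r = coset_rep_rcoset[OF this]
    have "?f (coset_rep C) \<noteq> 0" using C by (simp add: supp_def)
    then have "\<xi> \<otimes> inv (coset_rep C) \<in> A \<and> coset_rep C \<in> B"
      using f[OF r(2)] by (auto split: if_splits)
    then show "C \<in> ?L" using r sub[OF r(2)] by (auto intro!: exI[of _ "coset_rep C"])
  qed
  then have "int (hecke_count G \<Gamma> A B \<xi>) = (\<Sum>C\<in>supp ?f. 1)"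
    by (simp add: hecke_count_def)
  also have "\<dots> = coset_sum ?f" unfolding coset_sum_def
  proof (rule sum.cong[OF refl])
    fix C assume C: "C \<in> supp ?f"
    then have "?f (coset_rep C) \<noteq> 0" "coset_rep C \<in> carrier G"
      using coset_rep_rcoset(2) by (auto simp: supp_def)
    then show "1 = ?f (coset_rep C)" using f by (metis (mono_tags, lifting))
  qed
  finally show ?thesis by (simp add: conv_def)
qed

text \<open>The left factor g of \<xi>' is absorbed by F; the right factor h moves to \<gamma> by a
  translation and is absorbed by H. Hence the coefficient m(\<xi>) does not depend on the
  representative at which it is read off.\<close>

lemma conv_dc_cong:
  assumes "left_invariant F" "right_invariant F" "left_invariant H" "right_invariant H" "\<xi> \<in> carrier G" "\<xi>' \<in> dc \<xi>"
  shows "conv F H \<xi>' = conv F H \<xi>"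
proof -
  obtain g h where gh: "g \<in> \<Gamma>" "h \<in> \<Gamma>" "\<xi>' = g \<otimes> \<xi> \<otimes> h"
    using assms(6) by (auto simp: mem_dc_iff)
  let ?f = "\<lambda>\<gamma>. F (\<xi> \<otimes> inv \<gamma>) * H \<gamma>"
  have "conv F H \<xi>' = coset_sum (\<lambda>\<gamma>. ?f (\<gamma> \<otimes> inv h))" unfolding conv_def
  proof (rule coset_sum_cong)
    fix \<gamma> assume c: "\<gamma> \<in> carrier G"
    have "F (\<xi>' \<otimes> inv \<gamma>) = F (g \<otimes> (\<xi> \<otimes> (h \<otimes> inv \<gamma>)))"
      using gh c assms(5) by (simp add: m_assoc)
    also have "\<dots> = F (\<xi> \<otimes> (h \<otimes> inv \<gamma>))"
      using gh c assms by (simp add: left_invariant_def)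
    finally have "F (\<xi>' \<otimes> inv \<gamma>) = F (\<xi> \<otimes> inv (\<gamma> \<otimes> inv h))"
      using gh c by (simp add: inv_mult_group)
    moreover have "H (\<gamma> \<otimes> inv h) = H \<gamma>" using gh c assms(4) by (simp add: right_invariant_def)
    ultimately show "F (\<xi>' \<otimes> inv \<gamma>) * H \<gamma> = ?f (\<gamma> \<otimes> inv h)" by simp
  qed
  also have "\<dots> = coset_sum ?f"
    using gh assms by (intro coset_sum_shift conv_integrand_left_invariant) auto
  finally show ?thesis by (simp add: conv_def)
qed

text \<open>A nonzero coefficient at \<xi> factors \<xi> as (\<xi> \<gamma>^-1) \<gamma> with
  factors in A and B, so the double coset of \<xi> is determined by a pair of right cosets, one in A
  and one in B. Finiteness is essential: otherwise the sum in \<open>hecke_mult\<close> would be 0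
  by default.\<close>

lemma finite_mult_support:
  assumes A: "A \<in> double_cosets G \<Gamma> \<Delta>" and B: "B \<in> double_cosets G \<Gamma> \<Delta>"
  shows "finite {D \<in> double_cosets G \<Gamma> \<Delta>. hecke_count G \<Gamma> A B (coset_rep D) \<noteq> 0}"
proof -
  let ?cA = "(#>) \<Gamma> ` A" and ?cB = "(#>) \<Gamma> ` B"
  have fin: "finite ?cA" "finite ?cB" using assms by (auto intro: finite_cosets_dc)
  have "{D \<in> double_cosets G \<Gamma> \<Delta>. hecke_count G \<Gamma> A B (coset_rep D) \<noteq> 0}
     \<subseteq> (\<lambda>(C, C'). dc (coset_rep C \<otimes> coset_rep C')) ` (?cA \<times> ?cB)"
  proof
    fix D assume "D \<in> {D \<in> double_cosets G \<Gamma> \<Delta>. hecke_count G \<Gamma> A B (coset_rep D) \<noteq> 0}"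
    then have D: "D \<in> double_cosets G \<Gamma> \<Delta>" and n: "hecke_count G \<Gamma> A B (coset_rep D) \<noteq> 0" by auto
    let ?\<xi> = "coset_rep D"
    have x: "?\<xi> \<in> carrier G" "dc ?\<xi> = D" using coset_rep_double_coset[OF D] by auto
    have "{\<Gamma> #> \<gamma> | \<gamma>. \<gamma> \<in> carrier G \<and> \<Gamma> #> \<gamma> \<subseteq> B \<and> ?\<xi> \<otimes> inv \<gamma> \<in> A} \<noteq> {}"
      using n unfolding hecke_count_def by (metis (no_types, lifting) card.empty)
    then obtain \<gamma> where g: "\<gamma> \<in> carrier G" "\<Gamma> #> \<gamma> \<subseteq> B" "?\<xi> \<otimes> inv \<gamma> \<in> A" by blast
    let ?C' = "\<Gamma> #> \<gamma>"
    have gB: "\<gamma> \<in> B" using g rcos_self[OF g(1) subgroup_Gamma] by blast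
    obtain h where h: "h \<in> \<Gamma>" "coset_rep ?C' = h \<otimes> \<gamma>" using coset_rep_r_coset[OF g(1)] by blast
    \<comment> \<open>The chosen representative of the coset of \<gamma> is h \<gamma>, so the left
      factor is adjusted by the inverse of h, which keeps it in A. Now the two representatives
      multiply to \<xi> up to a left factor from \<Gamma>.\<close>
    have A': "?\<xi> \<otimes> inv (h \<otimes> \<gamma>) \<in> A"
    proof -
      obtain \<alpha> where \<alpha>: "\<alpha> \<in> \<Delta>" "A = dc \<alpha>" using A by (rule double_cosetE)
      have "dc (?\<xi> \<otimes> inv (h \<otimes> \<gamma>)) = dc (?\<xi> \<otimes> inv \<gamma> \<otimes> inv h)"
        using h g x by (simp add: inv_mult_group m_assoc)
      also have "\<dots> = A" using g(3) h g(1) x \<alpha> dc_eq_iff[of \<alpha> "?\<xi> \<otimes> inv \<gamma>"] by simp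
      finally show ?thesis using \<alpha> x h g dc_self[of "?\<xi> \<otimes> inv (h \<otimes> \<gamma>)"] by simp
    qed
    let ?a = "?\<xi> \<otimes> inv (h \<otimes> \<gamma>)"
    have aG: "?a \<in> carrier G" using x h g by simp
    obtain k where k: "k \<in> \<Gamma>" "coset_rep (\<Gamma> #> ?a) = k \<otimes> ?a"
      using coset_rep_r_coset[OF aG] by blast
    have "coset_rep (\<Gamma> #> ?a) \<otimes> coset_rep ?C' = k \<otimes> ?\<xi>"
      using k h g x by (simp add: m_assoc)
    then have "dc (coset_rep (\<Gamma> #> ?a) \<otimes> coset_rep ?C') = D" using k x by simp
    then show "D \<in> (\<lambda>(C, C'). dc (coset_rep C \<otimes> coset_rep C')) ` (?cA \<times> ?cB)"
      using A' gB by (auto intro!: image_eqI[of _ _ "(\<Gamma> #> ?a, ?C')"])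
  qed
  then show ?thesis using fin finite_subset by blast
qed

lemma hfun_hecke_mult:
  assumes A: "A \<in> double_cosets G \<Gamma> \<Delta>" and B: "B \<in> double_cosets G \<Gamma> \<Delta>" and \<xi>: "\<xi> \<in> carrier G"
  shows "hfun (hecke_mult G \<Gamma> \<Delta> A B) \<xi> = conv (hfun (frag_of A)) (hfun (frag_of B)) \<xi>"
proof -
  let ?S = "{D \<in> double_cosets G \<Gamma> \<Delta>. hecke_count G \<Gamma> A B (coset_rep D) \<noteq> 0}"
  have carr: "frag_of A \<in> carrier R" "frag_of B \<in> carrier R"
    using A B by (auto simp: carrier_R)
  have "hfun (hecke_mult G \<Gamma> \<Delta> A B) \<xi>
      = (\<Sum>D\<in>?S. int (hecke_count G \<Gamma> A B (coset_rep D)) * (if dc \<xi> = D then 1 else 0))"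
    unfolding hfun_def hecke_mult_def lookup_sum
    by (intro sum.cong refl) (simp add: lookup_single when_def)
  also have "\<dots> = (\<Sum>D\<in>?S. if D = dc \<xi> then int (hecke_count G \<Gamma> A B (coset_rep D)) else 0)"
    by (intro sum.cong) auto
  also have "\<dots> = (if dc \<xi> \<in> ?S then int (hecke_count G \<Gamma> A B (coset_rep (dc \<xi>))) else 0)"
    using finite_mult_support[OF A B] by (simp add: sum.delta)
  finally have 1: "hfun (hecke_mult G \<Gamma> \<Delta> A B) \<xi>
    = (if \<xi> \<in> \<Delta> then int (hecke_count G \<Gamma> A B (coset_rep (dc \<xi>))) else 0)"
    using dc_mem_double_cosets_iff[OF \<xi>] by auto
  show ?thesis
  proof (cases "\<xi> \<in> \<Delta>")
    case True
    have D: "dc \<xi> \<in> double_cosets G \<Gamma> \<Delta>" using True by (simp add: double_cosets_def)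
    show ?thesis using 1 True coset_rep_double_coset[OF D]
        conv_dc_cong[OF hfun_inv(2,1) hfun_inv(2,1) \<xi>]
      by (simp add: hecke_count_eq_coset_sum[OF A B])
  next
    case False
    \<comment> \<open>Outside \<Delta> the product has coefficient 0 by definition; the convolution
      vanishes there because two factors in \<Delta> have their product in \<Delta>.\<close>
    have "hfun (frag_of A) (\<xi> \<otimes> inv \<gamma>) * hfun (frag_of B) \<gamma> = 0" if "\<gamma> \<in> carrier G" for \<gamma>
    proof (rule ccontr)
      assume "\<not> ?thesis"
      then have "\<xi> \<otimes> inv \<gamma> \<in> \<Delta>" "\<gamma> \<in> \<Delta>"
        using hfun_outside[OF carr(1), of "\<xi> \<otimes> inv \<gamma>"] hfun_outside[OF carr(2), of \<gamma>] that \<xi> by auto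
      then have "\<xi> \<otimes> inv \<gamma> \<otimes> \<gamma> \<in> \<Delta>" by (rule Delta_mult)
      then show False using False that \<xi> by (simp add: m_assoc)
    qed
    then have "conv (hfun (frag_of A)) (hfun (frag_of B)) \<xi> = coset_sum (\<lambda>_. 0)"
      unfolding conv_def by (intro coset_sum_cong)
    then show ?thesis using 1 False by (simp add: coset_sum_def)
  qed
qed

section \<open>Bilinear extension and the ring axioms\<close>

lemma R_mult: "x \<otimes>\<^bsub>R\<^esub> y = frag_extend (\<lambda>A. frag_extend (\<lambda>B. hecke_mult G \<Gamma> \<Delta> A B) y) x"
  by (simp add: hecke_ring_def)

lemma hecke_mult_carrier:
  assumes "A \<in> double_cosets G \<Gamma> \<Delta>" and "B \<in> double_cosets G \<Gamma> \<Delta>"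
  shows "hecke_mult G \<Gamma> \<Delta> A B \<in> carrier R"
proof -
  have "Poly_Mapping.keys (hecke_mult G \<Gamma> \<Delta> A B) \<subseteq> double_cosets G \<Gamma> \<Delta>"
    unfolding hecke_mult_def by (rule order.trans[OF keys_sum]) auto
  then show ?thesis by (simp add: carrier_R)
qed

lemma R_mult_closed:
  assumes "x \<in> carrier R" "y \<in> carrier R" shows "x \<otimes>\<^bsub>R\<^esub> y \<in> carrier R"
  unfolding carrier_R R_mult using assms hecke_mult_carrier unfolding carrier_R
  by (intro order.trans[OF keys_frag_extend] UN_least) (meson subsetD)

lemma hfun_frag_extend:
  "hfun (frag_extend b x) \<xi> = (\<Sum>i\<in>Poly_Mapping.keys x. poly_mapping.lookup x i * hfun (b i) \<xi>)"
  by (simp add: hfun_def frag_extend_def lookup_sum)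

lemma hfun_expand:
  "hfun x \<xi> = (\<Sum>A\<in>Poly_Mapping.keys x. poly_mapping.lookup x A * hfun (frag_of A) \<xi>)"
  by (subst frag_expansion) (simp only: hfun_frag_extend)

text \<open>Both sides are bilinear in x and y, which reduces the claim to two basis elements. The
  finitely many terms have finite supports, so summation over cosets commutes with the
  expansion.\<close>

lemma hfun_mult:
  assumes x: "x \<in> carrier R" and y: "y \<in> carrier R" and \<xi>: "\<xi> \<in> carrier G"
  shows "hfun (x \<otimes>\<^bsub>R\<^esub> y) \<xi> = conv (hfun x) (hfun y) \<xi>"
proof -
  let ?X = "Poly_Mapping.keys x" and ?Y = "Poly_Mapping.keys y"
  have XY: "?X \<subseteq> double_cosets G \<Gamma> \<Delta>" "?Y \<subseteq> double_cosets G \<Gamma> \<Delta>" using x y by (auto simp: carrier_R)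
  let ?h = "\<lambda>A B \<gamma>. hfun (frag_of A) (\<xi> \<otimes> inv \<gamma>) * hfun (frag_of B) \<gamma>"
  let ?c = "\<lambda>(A, B). poly_mapping.lookup x A * poly_mapping.lookup y B"
  have fin: "finite (supp (?h A B))" if "B \<in> ?Y" for A B
    using that XY by (intro finite_subset[OF supp_conv_integrand] finite_supp_hfun) (auto simp: carrier_R)
  have "hfun (x \<otimes>\<^bsub>R\<^esub> y) \<xi>
      = (\<Sum>A\<in>?X. poly_mapping.lookup x A * (\<Sum>B\<in>?Y. poly_mapping.lookup y B * hfun (hecke_mult G \<Gamma> \<Delta> A B) \<xi>))"
    by (simp add: R_mult hfun_frag_extend)
  also have "\<dots> = (\<Sum>A\<in>?X. \<Sum>B\<in>?Y. coset_sum (?h A B) * ?c (A, B))"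
    unfolding sum_distrib_left
    by (intro sum.cong refl) (use XY in \<open>auto simp: hfun_hecke_mult \<xi> conv_def subset_iff\<close>)
  also have "\<dots> = (\<Sum>(A,B)\<in>?X \<times> ?Y. coset_sum (\<lambda>\<gamma>. ?h A B \<gamma> * ?c (A, B)))"
    by (simp add: sum.cartesian_product coset_sum_cmul)
  also have "\<dots> = (\<Sum>i\<in>?X \<times> ?Y. coset_sum (\<lambda>\<gamma>. ?h (fst i) (snd i) \<gamma> * ?c i))"
    by (intro sum.cong) auto
  also have "\<dots> = coset_sum (\<lambda>\<gamma>. \<Sum>i\<in>?X \<times> ?Y. ?h (fst i) (snd i) \<gamma> * ?c i)"
  proof (rule coset_sum_sum[symmetric])
    show "finite (?X \<times> ?Y)" by simp
    fix i assume "i \<in> ?X \<times> ?Y"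
    then have "finite (supp (?h (fst i) (snd i)))" by (intro fin) auto
    then show "finite (supp (\<lambda>\<gamma>. ?h (fst i) (snd i) \<gamma> * ?c i))"
      by (rule rev_finite_subset) (auto simp: supp_def)
  qed
  also have "\<dots> = conv (hfun x) (hfun y) \<xi>"
    unfolding conv_def
  proof (rule coset_sum_cong)
    fix \<gamma>
    show "(\<Sum>i\<in>?X \<times> ?Y. ?h (fst i) (snd i) \<gamma> * ?c i) = hfun x (\<xi> \<otimes> inv \<gamma>) * hfun y \<gamma>"
      unfolding hfun_expand[of x] hfun_expand[of y] sum_product sum.cartesian_product
      by (intro sum.cong) (auto simp: mult_ac)
  qed
  finally show ?thesis .
qed

lemma hfun_add: "hfun (x + y) \<xi> = hfun x \<xi> + hfun y \<xi>"
  by (simp add: hfun_def lookup_add)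

lemma hfun_minus: "hfun (- x) \<xi> = - hfun x \<xi>"
  by (simp add: hfun_def)

lemma R_one: "\<one>\<^bsub>R\<^esub> = frag_of \<Gamma>"
  by (simp add: hecke_ring_def dc_one)

lemma R_one_closed: "\<one>\<^bsub>R\<^esub> \<in> carrier R"
proof -
  have "dc \<one> \<in> double_cosets G \<Gamma> \<Delta>" using Gamma_le_Delta Gamma_one
    unfolding double_cosets_def by blast
  then show ?thesis by (simp add: carrier_R R_one dc_one)
qed

lemma hfun_one: assumes "\<xi> \<in> carrier G" shows "hfun \<one>\<^bsub>R\<^esub> \<xi> = (if \<xi> \<in> \<Gamma> then 1 else 0)"
proof -
  have "dc \<xi> = \<Gamma> \<longleftrightarrow> \<xi> \<in> \<Gamma>" using dc_eq_iff[of \<one> \<xi>] assms by (simp add: dc_one)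
  then show ?thesis by (auto simp: hfun_def R_one)
qed

lemma R_add: "x \<oplus>\<^bsub>R\<^esub> y = x + y"
  by (simp add: hecke_ring_def)

lemma R_add_closed: "\<lbrakk>x \<in> carrier R; y \<in> carrier R\<rbrakk> \<Longrightarrow> x + y \<in> carrier R"
  unfolding carrier_R using Poly_Mapping.keys_add[of x y] by blast

text \<open>Associativity and the unit laws are transported from convolution through
  \<open>hfun_eqI\<close>; distributivity is the linearity of \<open>frag_extend\<close>.\<close>

sublocale hecke: ring R
proof (rule ringI)
  show "abelian_group R"
  proof (rule abelian_groupI)
    fix x assume "x \<in> carrier R"
    then show "\<exists>y\<in>carrier R. y \<oplus>\<^bsub>R\<^esub> x = \<zero>\<^bsub>R\<^esub>"
      by (intro bexI[of _ "- x"]) (auto simp: hecke_ring_def)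
  qed (auto simp: R_add R_add_closed add_ac, auto simp: hecke_ring_def)
  show "monoid R"
  proof (rule monoidI)
    fix x y z assume c: "x \<in> carrier R" "y \<in> carrier R" "z \<in> carrier R"
    have "conv (conv (hfun x) (hfun y)) (hfun z) \<xi> = conv (hfun x) (conv (hfun y) (hfun z)) \<xi>"
      if "\<xi> \<in> carrier G" for \<xi>
      using c that by (intro conv_assoc hfun_inv finite_supp_hfun)
    moreover have "conv (hfun (x \<otimes>\<^bsub>R\<^esub> y)) (hfun z) \<xi> = conv (conv (hfun x) (hfun y)) (hfun z) \<xi>"
      if "\<xi> \<in> carrier G" for \<xi>
      unfolding conv_def[of _ "hfun z"] using c that by (intro coset_sum_cong) (simp add: hfun_mult)
    moreover have "conv (hfun x) (hfun (y \<otimes>\<^bsub>R\<^esub> z)) \<xi> = conv (hfun x) (conv (hfun y) (hfun z)) \<xi>" for \<xi>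
      unfolding conv_def[of "hfun x"] using c by (intro coset_sum_cong) (simp add: hfun_mult)
    ultimately show "x \<otimes>\<^bsub>R\<^esub> y \<otimes>\<^bsub>R\<^esub> z = x \<otimes>\<^bsub>R\<^esub> (y \<otimes>\<^bsub>R\<^esub> z)"
      using c by (intro hfun_eqI R_mult_closed) (auto simp: hfun_mult R_mult_closed)
  next
    fix x assume x: "x \<in> carrier R"
    show "\<one>\<^bsub>R\<^esub> \<otimes>\<^bsub>R\<^esub> x = x"
    proof (rule hfun_eqI)
      fix \<xi> assume "\<xi> \<in> \<Delta>"
      then have \<xi>: "\<xi> \<in> carrier G" by simp
      let ?f = "\<lambda>\<gamma>. hfun \<one>\<^bsub>R\<^esub> (\<xi> \<otimes> inv \<gamma>) * hfun x \<gamma>"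
      \<comment> \<open>The function of the unit element is the indicator of \<Gamma>, so only the
        coset of \<xi> contributes.\<close>
      have "coset_sum ?f = ?f \<xi>"
      proof (rule coset_sum_single)
        show "left_invariant ?f" using \<xi> by (intro conv_integrand_left_invariant hfun_inv)
        fix a assume a: "a \<in> carrier G" "?f a \<noteq> 0"
        then have "\<xi> \<otimes> inv a \<in> \<Gamma>" using \<xi> hfun_one[of "\<xi> \<otimes> inv a"] by (auto split: if_splits)
        then have "inv (\<xi> \<otimes> inv a) \<in> \<Gamma>" by (rule Gamma_inv)
        then show "a \<otimes> inv \<xi> \<in> \<Gamma>" using a \<xi> by (simp add: inv_mult_group)
      qed (rule \<xi>)
      then show "hfun (\<one>\<^bsub>R\<^esub> \<otimes>\<^bsub>R\<^esub> x) \<xi> = hfun x \<xi>"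
        using \<xi> x by (simp add: hfun_mult R_one_closed conv_def hfun_one)
    qed (use x in \<open>auto intro: R_mult_closed R_one_closed\<close>)
    show "x \<otimes>\<^bsub>R\<^esub> \<one>\<^bsub>R\<^esub> = x"
    proof (rule hfun_eqI)
      fix \<xi> assume "\<xi> \<in> \<Delta>"
      then have \<xi>: "\<xi> \<in> carrier G" by simp
      let ?f = "\<lambda>\<gamma>. hfun x (\<xi> \<otimes> inv \<gamma>) * hfun \<one>\<^bsub>R\<^esub> \<gamma>"
      have "coset_sum ?f = ?f \<one>"
      proof (rule coset_sum_single)
        show "left_invariant ?f" using \<xi> by (intro conv_integrand_left_invariant hfun_inv)
        fix a assume a: "a \<in> carrier G" "?f a \<noteq> 0"
        then show "a \<otimes> inv \<one> \<in> \<Gamma>" using hfun_one[of a] by (auto split: if_splits)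
      qed simp
      then show "hfun (x \<otimes>\<^bsub>R\<^esub> \<one>\<^bsub>R\<^esub>) \<xi> = hfun x \<xi>"
        using \<xi> x by (simp add: hfun_mult R_one_closed conv_def hfun_one)
    qed (use x in \<open>auto intro: R_mult_closed R_one_closed\<close>)
  qed (auto intro: R_mult_closed R_one_closed)
  fix x y z
  show "(x \<oplus>\<^bsub>R\<^esub> y) \<otimes>\<^bsub>R\<^esub> z = x \<otimes>\<^bsub>R\<^esub> z \<oplus>\<^bsub>R\<^esub> y \<otimes>\<^bsub>R\<^esub> z"
    by (simp add: R_add R_mult frag_extend_add)
  have "frag_extend (\<lambda>A. u A + v A) z = frag_extend u z + frag_extend v z"
    for u v :: "'a set \<Rightarrow> 'a set \<Rightarrow>\<^sub>0 int"
    by (simp add: frag_extend_def frag_cmul_distrib2 sum.distrib)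
  then show "z \<otimes>\<^bsub>R\<^esub> (x \<oplus>\<^bsub>R\<^esub> y) = z \<otimes>\<^bsub>R\<^esub> x \<oplus>\<^bsub>R\<^esub> z \<otimes>\<^bsub>R\<^esub> y"
    by (simp add: R_add R_mult frag_extend_add)
qed

lemma R_a_inv: assumes "x \<in> carrier R" shows "\<ominus>\<^bsub>R\<^esub> x = - x"
proof (rule hecke.minus_equality)
  show "- x \<in> carrier R" using assms by (simp add: carrier_R)
qed (use assms in \<open>auto simp: R_add hecke_ring_def\<close>)

end

section \<open>Pulling back from a locally dense subgroup\<close>

text \<open>An abstract global pair (G, \<Gamma>, \<Delta>) is compared with a local one through a
  localisation f defined on a subgroup. \<open>Gamma_eq\<close> makes right cosets of that subgroup
  inject into local ones, \<open>dense\<close> makes every local right coset in \<Delta>' arise, and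
  \<open>Delta_vimage\<close> keeps preimages of \<Delta>' inside \<Delta>.\<close>

locale hecke_transfer = A: hecke_pair G \<Gamma> \<Delta> + B: hecke_pair G' \<Gamma>' \<Delta>'
  for G :: "('a, 'm) monoid_scheme" (structure) and \<Gamma> \<Delta>
    and G' :: "('b, 'n) monoid_scheme" and \<Gamma>' \<Delta>' +
  fixes G\<^sub>0 :: "'a set" and f :: "'a \<Rightarrow> 'b"
  assumes subgroup_G0: "subgroup G\<^sub>0 G"
    and f_closed: "a \<in> G\<^sub>0 \<Longrightarrow> f a \<in> carrier G'"
    and f_mult: "\<lbrakk>a \<in> G\<^sub>0; b \<in> G\<^sub>0\<rbrakk> \<Longrightarrow> f (a \<otimes> b) = f a \<otimes>\<^bsub>G'\<^esub> f b"
    and Gamma_eq: "\<Gamma> = {a \<in> G\<^sub>0. f a \<in> \<Gamma>'}"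
    and Delta_vimage: "\<lbrakk>a \<in> G\<^sub>0; f a \<in> \<Delta>'\<rbrakk> \<Longrightarrow> a \<in> \<Delta>"
    and dense: "\<delta> \<in> \<Delta>' \<Longrightarrow> \<exists>a\<in>G\<^sub>0. \<exists>g\<in>\<Gamma>'. \<delta> = g \<otimes>\<^bsub>G'\<^esub> f a"
begin

lemma G0_closed [simp]: "a \<in> G\<^sub>0 \<Longrightarrow> a \<in> carrier G"
  using subgroup_G0 subgroup.subset by blast

lemma G0_mult [simp]: "\<lbrakk>a \<in> G\<^sub>0; b \<in> G\<^sub>0\<rbrakk> \<Longrightarrow> a \<otimes> b \<in> G\<^sub>0"
  by (simp add: subgroup.m_closed subgroup_G0)

lemma G0_inv [simp]: "a \<in> G\<^sub>0 \<Longrightarrow> inv a \<in> G\<^sub>0"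
  by (simp add: subgroup.m_inv_closed subgroup_G0)

lemma G0_one [simp]: "\<one> \<in> G\<^sub>0"
  by (simp add: subgroup.one_closed subgroup_G0)

lemma mem_Gamma_iff: "g \<in> \<Gamma> \<longleftrightarrow> g \<in> G\<^sub>0 \<and> f g \<in> \<Gamma>'"
  using Gamma_eq by auto

lemma Gamma_G0: "g \<in> \<Gamma> \<Longrightarrow> g \<in> G\<^sub>0" "g \<in> \<Gamma> \<Longrightarrow> f g \<in> \<Gamma>'"
  using Gamma_eq by auto

lemma f_one: "f \<one> = \<one>\<^bsub>G'\<^esub>"
proof -
  have "f \<one> \<otimes>\<^bsub>G'\<^esub> f \<one> = f \<one>" using f_mult[of \<one> \<one>] by simp
  then show ?thesis using f_closed[of \<one>] B.l_cancel_one by simp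
qed

lemma f_inv: assumes "a \<in> G\<^sub>0" shows "f (inv a) = inv\<^bsub>G'\<^esub> f a"
proof -
  have "f (inv a) \<otimes>\<^bsub>G'\<^esub> f a = \<one>\<^bsub>G'\<^esub>" using f_mult[of "inv a" a] f_one assms by simp
  then show ?thesis using B.inv_equality f_closed assms by simp
qed

lemma f_dc: assumes "a \<in> G\<^sub>0" "b \<in> A.dc a" shows "b \<in> G\<^sub>0" "B.dc (f b) = B.dc (f a)"
proof -
  obtain g h where gh: "g \<in> \<Gamma>" "h \<in> \<Gamma>" "b = g \<otimes> a \<otimes> h"
    using assms by (auto simp: A.mem_dc_iff)
  then show "b \<in> G\<^sub>0" using assms Gamma_G0 by simp
  show "B.dc (f b) = B.dc (f a)"
    using gh assms Gamma_G0 f_closed by (simp add: f_mult)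
qed

lemma mult_mem_G0_iff:
  assumes "a \<in> G\<^sub>0" "b \<in> carrier G" shows "a \<otimes> b \<in> G\<^sub>0 \<longleftrightarrow> b \<in> G\<^sub>0" "b \<otimes> a \<in> G\<^sub>0 \<longleftrightarrow> b \<in> G\<^sub>0"
proof -
  have "b = inv a \<otimes> (a \<otimes> b)" using assms by (simp add: A.m_assoc[symmetric])
  then show "a \<otimes> b \<in> G\<^sub>0 \<longleftrightarrow> b \<in> G\<^sub>0" using assms G0_mult G0_inv by metis
  have "b = (b \<otimes> a) \<otimes> inv a" using assms by (simp add: A.m_assoc)
  then show "b \<otimes> a \<in> G\<^sub>0 \<longleftrightarrow> b \<in> G\<^sub>0" using assms G0_mult G0_inv by metis
qed

lemma rcos_f_eq_iff:
  assumes "a \<in> G\<^sub>0" "b \<in> G\<^sub>0"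
  shows "\<Gamma>' #>\<^bsub>G'\<^esub> f a = \<Gamma>' #>\<^bsub>G'\<^esub> f b \<longleftrightarrow> \<Gamma> #> a = \<Gamma> #> b"
  using assms by (simp add: A.rcos_eq_iff B.rcos_eq_iff f_closed f_inv[symmetric] f_mult[symmetric])
    (simp add: mem_Gamma_iff)

text \<open>The local right coset of f b determines the global right coset of b, hence its double
  coset, and D contains finitely many local right cosets. The sum defining \<open>eta_star\<close>
  on D runs over such a set and needs it to be finite.\<close>

lemma finite_vimage_double_coset:
  assumes "D \<in> double_cosets G' \<Gamma>' \<Delta>'"
  shows "finite (A.dc ` {b \<in> G\<^sub>0. f b \<in> D})"
proof (rule finite_image_factor)
  have "(\<lambda>b. \<Gamma>' #>\<^bsub>G'\<^esub> f b) ` {b \<in> G\<^sub>0. f b \<in> D} \<subseteq> (#>\<^bsub>G'\<^esub>) \<Gamma>' ` D" by auto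
  then show "finite ((\<lambda>b. \<Gamma>' #>\<^bsub>G'\<^esub> f b) ` {b \<in> G\<^sub>0. f b \<in> D})"
    using B.finite_cosets_dc[OF assms] finite_subset by blast
  fix a b assume ab: "a \<in> {b \<in> G\<^sub>0. f b \<in> D}" "b \<in> {b \<in> G\<^sub>0. f b \<in> D}"
    and "\<Gamma>' #>\<^bsub>G'\<^esub> f a = \<Gamma>' #>\<^bsub>G'\<^esub> f b"
  then have "a \<otimes> inv b \<in> \<Gamma>" using rcos_f_eq_iff[of a b] A.rcos_eq_iff[of a b] by simp
  then have "A.dc (a \<otimes> inv b \<otimes> b) = A.dc b" using ab by (intro A.dc_mult_left) auto
  then show "A.dc a = A.dc b" using ab by (simp add: A.m_assoc)
qed

definition pullback :: "('b \<Rightarrow> int) \<Rightarrow> 'a \<Rightarrow> int" where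
  "pullback F \<xi> = (if \<xi> \<in> G\<^sub>0 then F (f \<xi>) else 0)"

lemma pullback_inv:
  assumes "B.left_invariant F" "B.right_invariant F"
  shows "A.left_invariant (pullback F)" "A.right_invariant (pullback F)"
  using assms Gamma_G0
  by (auto simp: A.left_invariant_def A.right_invariant_def B.left_invariant_def B.right_invariant_def pullback_def
        f_mult f_closed mult_mem_G0_iff)

text \<open>Sending the coset of a to the coset of f a is a bijection between contributing cosets:
  injective because \<Gamma> is the full preimage of \<Gamma>', surjective by density because H
  vanishes off \<Delta>'. For \<xi> outside the subgroup, \<gamma> and \<xi> \<gamma>^-1 cannot both
  lie in it, so every term is 0.\<close>

lemma conv_pullback:
  assumes F: "B.left_invariant F" "B.right_invariant F"
    and H: "B.left_invariant H" "B.right_invariant H" "\<And>a. \<lbrakk>a \<in> carrier G'; a \<notin> \<Delta>'\<rbrakk> \<Longrightarrow> H a = 0"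
    and \<xi>: "\<xi> \<in> carrier G"
  shows "A.conv (pullback F) (pullback H) \<xi> = pullback (B.conv F H) \<xi>"
proof (cases "\<xi> \<in> G\<^sub>0")
  case False
  have "pullback F (\<xi> \<otimes> inv \<gamma>) * pullback H \<gamma> = 0" if "\<gamma> \<in> carrier G" for \<gamma>
    using False \<xi> that mult_mem_G0_iff(2)[of "inv \<gamma>" \<xi>] by (auto simp: pullback_def)
  then have "A.conv (pullback F) (pullback H) \<xi> = A.coset_sum (\<lambda>_. 0)"
    unfolding A.conv_def by (intro A.coset_sum_cong)
  then show ?thesis using False by (simp add: A.coset_sum_def pullback_def)
next
  case True
  let ?g = "\<lambda>\<gamma>. pullback F (\<xi> \<otimes> inv \<gamma>) * pullback H \<gamma>"
  let ?h = "\<lambda>\<gamma>. F (f \<xi> \<otimes>\<^bsub>G'\<^esub> inv\<^bsub>G'\<^esub> \<gamma>) * H \<gamma>"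
  have lg: "A.left_invariant ?g" by (intro A.conv_integrand_left_invariant pullback_inv F H \<xi>)
  have lh: "B.left_invariant ?h" using True f_closed by (intro B.conv_integrand_left_invariant F H)
  have gh: "?g \<gamma> = ?h (f \<gamma>)" if "\<gamma> \<in> G\<^sub>0" for \<gamma>
    using that True by (simp add: pullback_def f_mult f_inv)
  let ?k = "\<lambda>C. \<Gamma>' #>\<^bsub>G'\<^esub> f (coset_rep C)"
  have inG0: "C \<in> rcosets \<Gamma> \<and> coset_rep C \<in> G\<^sub>0" if "C \<in> A.supp ?g" for C
    using that by (auto simp: A.supp_def pullback_def split: if_splits)
  have val: "?h (coset_rep (?k C)) = ?g (coset_rep C)" if "C \<in> A.supp ?g" for C
    using inG0[OF that] by (simp only: B.left_invariant_coset_rep[OF lh] f_closed gh)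
  have "bij_betw ?k (A.supp ?g) (B.supp ?h)"
  proof (rule bij_betwI')
    fix C C' assume CC: "C \<in> A.supp ?g" "C' \<in> A.supp ?g"
    show "?k C = ?k C' \<longleftrightarrow> C = C'"
      using inG0[OF CC(1)] inG0[OF CC(2)] rcos_f_eq_iff A.coset_rep_rcoset(3) by metis
  next
    fix C assume C: "C \<in> A.supp ?g"
    have "?h (coset_rep (?k C)) \<noteq> 0" using C val[OF C] unfolding A.supp_def by simp
    then show "?k C \<in> B.supp ?h"
      unfolding B.supp_def using inG0[OF C] f_closed B.rcosetsI B.Gamma_le by blast
  next
    fix C' assume C': "C' \<in> B.supp ?h"
    then have r: "C' \<in> rcosets\<^bsub>G'\<^esub> \<Gamma>'" and nz: "?h (coset_rep C') \<noteq> 0" by (auto simp: B.supp_def)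
    note r = B.coset_rep_rcoset[OF r]
    have "coset_rep C' \<in> \<Delta>'" using nz H(3) r by fastforce
    then obtain a g where a: "a \<in> G\<^sub>0" "g \<in> \<Gamma>'" "coset_rep C' = g \<otimes>\<^bsub>G'\<^esub> f a" using dense by blast
    let ?C = "\<Gamma> #> a"
    have C: "?C \<in> rcosets \<Gamma>" using a A.rcosetsI A.Gamma_le by auto
    obtain t where t: "t \<in> \<Gamma>" "coset_rep ?C = t \<otimes> a" using A.coset_rep_r_coset[of a] a by auto
    have "?k ?C = \<Gamma>' #>\<^bsub>G'\<^esub> f a" using t a Gamma_G0 by (simp add: f_mult f_closed)
    also have "\<dots> = C'" using a r f_closed B.rcos_mult_left by metis
    finally have k: "C' = ?k ?C" ..
    have "?g (coset_rep ?C) = ?g a" using A.left_invariant_coset_rep[OF lg, of a] a by simp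
    also have "\<dots> = ?h (f a)" using gh a by simp
    also have "\<dots> = ?h (coset_rep C')"
      using lh a f_closed unfolding B.left_invariant_def by (metis (no_types, lifting))
    finally have "?g (coset_rep ?C) \<noteq> 0" using nz by metis
    then have "?C \<in> A.supp ?g" using C unfolding A.supp_def by blast
    then show "\<exists>C\<in>A.supp ?g. C' = ?k C" using k by blast
  qed
  then have "B.coset_sum ?h = (\<Sum>C\<in>A.supp ?g. ?h (coset_rep (?k C)))"
    unfolding B.coset_sum_def by (rule sum.reindex_bij_betw[symmetric])
  also have "\<dots> = A.coset_sum ?g"
    unfolding A.coset_sum_def by (rule sum.cong[OF refl val])
  finally have "A.coset_sum ?g = B.coset_sum ?h" ..
  then show ?thesis using True by (simp add: A.conv_def B.conv_def pullback_def)
qed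

lemma ring_hom_of_pullback:
  assumes T: "\<And>x. x \<in> carrier B.R \<Longrightarrow> T x \<in> carrier A.R"
    and hT: "\<And>x \<xi>. \<lbrakk>x \<in> carrier B.R; \<xi> \<in> carrier G\<rbrakk> \<Longrightarrow> A.hfun (T x) \<xi> = pullback (B.hfun x) \<xi>"
  shows "ring_hom_ring B.R A.R T" "inj_on T (carrier B.R)"
proof -
  show "ring_hom_ring B.R A.R T"
  proof (rule ring_hom_ringI2)
    show "T \<in> ring_hom B.R A.R"
    proof (rule ring_hom_memI)
      fix x y assume xy: "x \<in> carrier B.R" "y \<in> carrier B.R"
      show "T (x \<otimes>\<^bsub>B.R\<^esub> y) = T x \<otimes>\<^bsub>A.R\<^esub> T y"
      proof (rule A.hfun_eqI)
        fix \<xi> assume "\<xi> \<in> \<Delta>"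
        then have \<xi>: "\<xi> \<in> carrier G" by simp
        have "A.hfun (T x \<otimes>\<^bsub>A.R\<^esub> T y) \<xi> = A.conv (A.hfun (T x)) (A.hfun (T y)) \<xi>"
          using T xy \<xi> by (simp add: A.hfun_mult)
        also have "\<dots> = A.conv (pullback (B.hfun x)) (pullback (B.hfun y)) \<xi>"
          unfolding A.conv_def using xy \<xi> by (intro A.coset_sum_cong) (simp add: hT)
        also have "\<dots> = pullback (B.conv (B.hfun x) (B.hfun y)) \<xi>"
          by (intro conv_pullback B.hfun_inv B.hfun_outside xy \<xi>)
        also have "\<dots> = pullback (B.hfun (x \<otimes>\<^bsub>B.R\<^esub> y)) \<xi>"
          using xy by (simp add: pullback_def B.hfun_mult f_closed)
        finally show "A.hfun (T (x \<otimes>\<^bsub>B.R\<^esub> y)) \<xi> = A.hfun (T x \<otimes>\<^bsub>A.R\<^esub> T y) \<xi>"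
          using hT xy \<xi> B.R_mult_closed by simp
      qed (use T xy A.R_mult_closed B.R_mult_closed in auto)
      show "T (x \<oplus>\<^bsub>B.R\<^esub> y) = T x \<oplus>\<^bsub>A.R\<^esub> T y"
        by (rule A.hfun_eqI)
          (use T xy A.R_add_closed B.R_add_closed in \<open>auto simp: A.R_add B.R_add A.hfun_add hT pullback_def B.hfun_add\<close>)
    next
      show "T \<one>\<^bsub>B.R\<^esub> = \<one>\<^bsub>A.R\<^esub>"
      proof (rule A.hfun_eqI)
        fix \<xi> assume "\<xi> \<in> \<Delta>"
        then show "A.hfun (T \<one>\<^bsub>B.R\<^esub>) \<xi> = A.hfun \<one>\<^bsub>A.R\<^esub> \<xi>"
          using B.R_one_closed mem_Gamma_iff
          by (simp add: hT A.hfun_one B.hfun_one f_closed pullback_def)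
      qed (use T A.R_one_closed B.R_one_closed in auto)
    qed (rule T)
  qed (rule B.hecke.ring_axioms A.hecke.ring_axioms)+
  show "inj_on T (carrier B.R)"
  proof (rule inj_onI)
    fix x y assume xy: "x \<in> carrier B.R" "y \<in> carrier B.R" "T x = T y"
    show "x = y"
    proof (rule B.hfun_eqI)
      \<comment> \<open>Density recovers x from \<open>T x\<close>: if \<delta> = g (f a) with g in
        \<Gamma>', the value of x at \<delta> is the value of \<open>T x\<close> at a.\<close>
      fix \<delta> assume "\<delta> \<in> \<Delta>'"
      then obtain a g where a: "a \<in> G\<^sub>0" "g \<in> \<Gamma>'" "\<delta> = g \<otimes>\<^bsub>G'\<^esub> f a" using dense by blast
      have h: "B.hfun z \<delta> = A.hfun (T z) a" if "z \<in> carrier B.R" for z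
        using a hT[OF that, of a] by (simp add: pullback_def B.hfun_def f_closed)
      show "B.hfun x \<delta> = B.hfun y \<delta>" using h[OF xy(1)] h[OF xy(2)] xy(3) by simp
    qed (use xy in auto)
  qed
qed

end

section \<open>The Heisenberg automorphism group over a commutative ring\<close>

context cring
begin

lemma heis_det_closed:
  assumes "heis_entries x \<subseteq> carrier R"
  shows "heis_det R x \<in> carrier R"
  using assms by (cases x rule: heis_entries.cases) auto

lemma heis_mult_entries:
  assumes "heis_entries x \<subseteq> carrier R" "heis_entries y \<subseteq> carrier R"
  shows "heis_entries (heis_mult R x y) \<subseteq> carrier R"
  using assms by (cases x rule: heis_entries.cases; cases y rule: heis_entries.cases) (auto simp: Let_def)

lemma heis_det_mult:
  assumes "heis_entries x \<subseteq> carrier R" "heis_entries y \<subseteq> carrier R"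
  shows "heis_det R (heis_mult R x y) = heis_det R x \<otimes> heis_det R y"
proof -
  obtain a b c d u v where x: "x = ((a,b,c,d),(u,v))" by (cases x rule: heis_entries.cases)
  obtain a' b' c' d' u' v' where y: "y = ((a',b',c',d'),(u',v'))" by (cases y rule: heis_entries.cases)
  have "a \<in> carrier R" "b \<in> carrier R" "c \<in> carrier R" "d \<in> carrier R"
    "a' \<in> carrier R" "b' \<in> carrier R" "c' \<in> carrier R" "d' \<in> carrier R" using assms x y by auto
  then show ?thesis unfolding x y by (simp add: Let_def) algebra
qed

text \<open>One entry of (AB)C = A(BC), or one coordinate of (AB)c = A(Bc).\<close>

lemma mat_assoc:
  assumes "a \<in> carrier R" "b \<in> carrier R" "a' \<in> carrier R" "b' \<in> carrier R" "c' \<in> carrier R" "d' \<in> carrier R"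
    "x \<in> carrier R" "y \<in> carrier R"
  shows "(a \<otimes> a' \<oplus> b \<otimes> c') \<otimes> x \<oplus> (a \<otimes> b' \<oplus> b \<otimes> d') \<otimes> y
    = a \<otimes> (a' \<otimes> x \<oplus> b' \<otimes> y) \<oplus> b \<otimes> (c' \<otimes> x \<oplus> d' \<otimes> y)"
  using assms by algebra

text \<open>One coordinate of A(Bc) + e(Ab + da) = A(Bc + eb) + (de)a, the vector part of
  associativity. The determinants d and e stay opaque scalars, so the polynomial identity remains
  small.\<close>

lemma vec_assoc:
  assumes "a \<in> carrier R" "b \<in> carrier R" "p \<in> carrier R" "q \<in> carrier R" "u \<in> carrier R" "v \<in> carrier R"
    "d \<in> carrier R" "e \<in> carrier R" "w \<in> carrier R"
  shows "(a \<otimes> p \<oplus> b \<otimes> q) \<oplus> e \<otimes> (a \<otimes> u \<oplus> b \<otimes> v \<oplus> d \<otimes> w)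
    = a \<otimes> (p \<oplus> e \<otimes> u) \<oplus> b \<otimes> (q \<oplus> e \<otimes> v) \<oplus> (d \<otimes> e) \<otimes> w"
  using assms by algebra

lemma heis_mult_assoc:
  assumes "heis_entries x \<subseteq> carrier R" "heis_entries y \<subseteq> carrier R" "heis_entries z \<subseteq> carrier R"
  shows "heis_mult R (heis_mult R x y) z = heis_mult R x (heis_mult R y z)"
proof -
  have m: "heis_mult R ((a,b,c,d),(u,v)) y = (case y of ((a',b',c',d'),(u',v')) \<Rightarrow>
     ((a \<otimes> a' \<oplus> b \<otimes> c', a \<otimes> b' \<oplus> b \<otimes> d', c \<otimes> a' \<oplus> d \<otimes> c', c \<otimes> b' \<oplus> d \<otimes> d'),
       ((a \<otimes> u' \<oplus> b \<otimes> v') \<oplus> heis_det R y \<otimes> u, (c \<otimes> u' \<oplus> d \<otimes> v') \<oplus> heis_det R y \<otimes> v)))"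
    for a b c d u v y by (cases y rule: heis_entries.cases) (simp add: Let_def)
  obtain a b c d u v where x: "x = ((a,b,c,d),(u,v))" by (cases x rule: heis_entries.cases)
  obtain a' b' c' d' u' v' where y: "y = ((a',b',c',d'),(u',v'))" by (cases y rule: heis_entries.cases)
  obtain a'' b'' c'' d'' u'' v'' where z: "z = ((a'',b'',c'',d''),(u'',v''))"
    by (cases z rule: heis_entries.cases)
  define D where "D = heis_det R y"
  define E where "E = heis_det R z"
  have DE: "heis_det R (heis_mult R y z) = D \<otimes> E" "D \<in> carrier R" "E \<in> carrier R"
    using assms by (auto simp: D_def E_def heis_det_mult heis_det_closed)
  have c: "a \<in> carrier R" "b \<in> carrier R" "c \<in> carrier R" "d \<in> carrier R" "u \<in> carrier R" "v \<in> carrier R"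
    "a' \<in> carrier R" "b' \<in> carrier R" "c' \<in> carrier R" "d' \<in> carrier R" "u' \<in> carrier R" "v' \<in> carrier R"
    "a'' \<in> carrier R" "b'' \<in> carrier R" "c'' \<in> carrier R" "d'' \<in> carrier R" "u'' \<in> carrier R" "v'' \<in> carrier R"
    using assms x y z by auto
  have xy: "heis_mult R x y =
     ((a \<otimes> a' \<oplus> b \<otimes> c', a \<otimes> b' \<oplus> b \<otimes> d', c \<otimes> a' \<oplus> d \<otimes> c', c \<otimes> b' \<oplus> d \<otimes> d'),
       ((a \<otimes> u' \<oplus> b \<otimes> v') \<oplus> D \<otimes> u, (c \<otimes> u' \<oplus> d \<otimes> v') \<oplus> D \<otimes> v))"
    unfolding x m D_def by (simp add: y)
  have yz: "heis_mult R y z =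
     ((a' \<otimes> a'' \<oplus> b' \<otimes> c'', a' \<otimes> b'' \<oplus> b' \<otimes> d'', c' \<otimes> a'' \<oplus> d' \<otimes> c'', c' \<otimes> b'' \<oplus> d' \<otimes> d''),
       ((a' \<otimes> u'' \<oplus> b' \<otimes> v'') \<oplus> E \<otimes> u', (c' \<otimes> u'' \<oplus> d' \<otimes> v'') \<oplus> E \<otimes> v'))"
    unfolding y m E_def by (simp add: z)
  show ?thesis
    unfolding xy m unfolding x m DE(1) E_def[symmetric] unfolding yz unfolding z
    using c DE(2,3) by (simp add: mat_assoc vec_assoc)
qed

lemma heis_group_is_group: "group (heis_group R)"
proof (rule groupI)
  fix x y assume "x \<in> carrier (heis_group R)" "y \<in> carrier (heis_group R)"
  then show "x \<otimes>\<^bsub>heis_group R\<^esub> y \<in> carrier (heis_group R)"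
    using heis_mult_entries[of x y] by (auto simp: heis_group_def heis_det_mult)
next
  show "\<one>\<^bsub>heis_group R\<^esub> \<in> carrier (heis_group R)"
    by (simp add: heis_group_def minus_eq)
next
  fix x y z assume "x \<in> carrier (heis_group R)" "y \<in> carrier (heis_group R)" "z \<in> carrier (heis_group R)"
  then show "x \<otimes>\<^bsub>heis_group R\<^esub> y \<otimes>\<^bsub>heis_group R\<^esub> z = x \<otimes>\<^bsub>heis_group R\<^esub> (y \<otimes>\<^bsub>heis_group R\<^esub> z)"
    by (simp add: heis_group_def heis_mult_assoc)
next
  fix x assume x: "x \<in> carrier (heis_group R)"
  obtain a b c d u v where x': "x = ((a,b,c,d),(u,v))" by (cases x rule: heis_entries.cases)
  have c: "a \<in> carrier R" "b \<in> carrier R" "c \<in> carrier R" "d \<in> carrier R" "u \<in> carrier R" "v \<in> carrier R"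
    using x x' by (auto simp: heis_group_def)
  show "\<one>\<^bsub>heis_group R\<^esub> \<otimes>\<^bsub>heis_group R\<^esub> x = x"
    using c unfolding x' by (simp add: heis_group_def Let_def)
  define D where "D = a \<otimes> d \<ominus> b \<otimes> c"
  have D: "D \<in> Units R" using x x' by (simp add: heis_group_def D_def)
  define e where "e = inv D"
  have e: "e \<in> carrier R" "e \<in> Units R" "D \<in> carrier R" and De: "D \<otimes> e = \<one>"
    using D by (auto simp: e_def)
  \<comment> \<open>The inverse of (A, a) is (A^-1, -det(A)^-1 A^-1 a). Here e is the inverse
    determinant, A^-1 is e times the adjugate, and u', v' are the coordinates of A^-1 a.\<close>
  define u' where "u' = e \<otimes> d \<otimes> u \<oplus> \<ominus> (e \<otimes> b) \<otimes> v"
  define v' where "v' = \<ominus> (e \<otimes> c) \<otimes> u \<oplus> e \<otimes> a \<otimes> v"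
  let ?y = "((e \<otimes> d, \<ominus> (e \<otimes> b), \<ominus> (e \<otimes> c), e \<otimes> a), (\<ominus> (e \<otimes> u'), \<ominus> (e \<otimes> v')))"
  have uv: "u' \<in> carrier R" "v' \<in> carrier R" using c e by (auto simp: u'_def v'_def)
  have "e \<otimes> d \<otimes> (e \<otimes> a) \<ominus> \<ominus> (e \<otimes> b) \<otimes> \<ominus> (e \<otimes> c) = e \<otimes> e \<otimes> (a \<otimes> d \<ominus> b \<otimes> c)"
    using c e by algebra
  also have "\<dots> = e" using e De D_def m_comm m_assoc by (metis r_one)
  finally have dety: "heis_det R ?y = e" by simp
  have y: "?y \<in> carrier (heis_group R)"
    using c e uv dety by (simp add: heis_group_def)
  have 1: "e \<otimes> d \<otimes> a \<oplus> \<ominus> (e \<otimes> b) \<otimes> c = (a \<otimes> d \<ominus> b \<otimes> c) \<otimes> e" using c e(1) by algebra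
  have 2: "e \<otimes> d \<otimes> b \<oplus> \<ominus> (e \<otimes> b) \<otimes> d = \<zero>" using c e(1) by algebra
  have 3: "\<ominus> (e \<otimes> c) \<otimes> a \<oplus> e \<otimes> a \<otimes> c = \<zero>" using c e(1) by algebra
  have 4: "\<ominus> (e \<otimes> c) \<otimes> b \<oplus> e \<otimes> a \<otimes> d = (a \<otimes> d \<ominus> b \<otimes> c) \<otimes> e" using c e(1) by algebra
  have 5: "w \<oplus> D \<otimes> \<ominus> (e \<otimes> w) = \<zero>" if "w \<in> carrier R" for w
  proof -
    have "w \<oplus> D \<otimes> \<ominus> (e \<otimes> w) = w \<ominus> (D \<otimes> e) \<otimes> w" using that e by algebra
    then show ?thesis unfolding De using that by (simp add: minus_eq r_neg)
  qed
  have "heis_mult R ?y x = ((\<one>, \<zero>, \<zero>, \<one>), (\<zero>, \<zero>))"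
    unfolding x' heis_mult.simps heis_det.simps Let_def 1 2 3 4
    unfolding D_def[symmetric] u'_def[symmetric] v'_def[symmetric] De 5[OF uv(1)] 5[OF uv(2)]
    by (rule refl)
  then have "?y \<otimes>\<^bsub>heis_group R\<^esub> x = \<one>\<^bsub>heis_group R\<^esub>" unfolding heis_group_def by (simp del: heis_mult.simps)
  then show "\<exists>y\<in>carrier (heis_group R). y \<otimes>\<^bsub>heis_group R\<^esub> x = \<one>\<^bsub>heis_group R\<^esub>"
    using y by (rule bexI)
qed

text \<open>Subtraction is the delicate operation: with carrier S the negative is taken inside S.
  Inverses in a subgroup agree with those of the whole additive group, so the determinant is
  unchanged.\<close>

lemma heis_det_subring:
  assumes "subring S R" "heis_entries x \<subseteq> S"
  shows "heis_det (R\<lparr>carrier := S\<rparr>) x = heis_det R x" "heis_det R x \<in> S"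
proof -
  obtain a b c d u v where x': "x = ((a,b,c,d),(u,v))" by (cases x rule: heis_entries.cases)
  have c: "a \<in> S" "b \<in> S" "c \<in> S" "d \<in> S" using assms x' by auto
  have bc: "b \<otimes> c \<in> S" using c subringE(6)[OF assms(1)] by blast
  have "a_inv (R\<lparr>carrier := S\<rparr>) (b \<otimes> c) = \<ominus> (b \<otimes> c)"
    using group.m_inv_consistent[OF add.is_group subring.axioms(1)[OF assms(1)], of "b \<otimes> c"] bc
    by (simp add: a_inv_def)
  then show "heis_det (R\<lparr>carrier := S\<rparr>) x = heis_det R x" unfolding x' by (simp add: a_minus_def)
  show "heis_det R x \<in> S"
    using c subringE(5,6,7)[OF assms(1)] unfolding x' by (auto simp: a_minus_def)
qed

text \<open>Invertibility in the ring with carrier S becomes a condition in the operations of R;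
  commutativity supplies the other side of the inverse.\<close>

lemma heis_Gamma_iff:
  assumes "subring S R"
  shows "x \<in> heis_Gamma R S \<longleftrightarrow> heis_entries x \<subseteq> S \<and> (\<exists>y\<in>S. heis_det R x \<otimes> y = \<one>)"
proof -
  have "heis_det R x \<otimes> y = \<one> \<longleftrightarrow> y \<otimes> heis_det R x = \<one> \<and> heis_det R x \<otimes> y = \<one>"
    if "heis_entries x \<subseteq> S" "y \<in> S" for y
    using m_comm heis_det_subring(2)[OF assms that(1)] that(2) subringE(1)[OF assms] by (metis subsetD)
  then show ?thesis
    using heis_det_subring[OF assms, of x]
    by (auto simp: heis_Gamma_def heis_group_def Units_def)
qed

lemma heis_mult_subring:
  assumes "subring S R" "heis_entries x \<subseteq> S" "heis_entries y \<subseteq> S"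
  shows "heis_mult (R\<lparr>carrier := S\<rparr>) x y = heis_mult R x y" "heis_entries (heis_mult R x y) \<subseteq> S"
proof -
  obtain a b c d u v where x': "x = ((a,b,c,d),(u,v))" by (cases x rule: heis_entries.cases)
  obtain a' b' c' d' u' v' where y': "y = ((a',b',c',d'),(u',v'))" by (cases y rule: heis_entries.cases)
  show "heis_mult (R\<lparr>carrier := S\<rparr>) x y = heis_mult R x y"
    unfolding x' y' using heis_det_subring(1)[OF assms(1,3)] by (simp add: y' Let_def)
  show "heis_entries (heis_mult R x y) \<subseteq> S"
    unfolding x' y' using heis_det_subring(2)[OF assms(1,3)] assms(2,3) subringE(6,7)[OF assms(1)]
    by (simp add: y' x' Let_def)
qed

lemma heis_Gamma_sub_Delta:
  assumes "subring S R" shows "heis_Gamma R S \<subseteq> heis_Delta R S"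
proof
  fix x assume "x \<in> heis_Gamma R S"
  then obtain y where x: "heis_entries x \<subseteq> S" "y \<in> S" "heis_det R x \<otimes> y = \<one>"
    by (auto simp: heis_Gamma_iff[OF assms])
  have "heis_det R x \<in> carrier R" "y \<in> carrier R"
    using x heis_det_subring(2)[OF assms, of x] subringE(1)[OF assms] by auto
  then have "heis_det R x \<in> Units R" using x m_comm by (auto simp: Units_def)
  then show "x \<in> heis_Delta R S"
    using x subringE(1)[OF assms] by (auto simp: heis_Delta_def heis_group_def)
qed

lemma heis_Delta_sub: "heis_Delta R S \<subseteq> carrier (heis_group R)"
  by (auto simp: heis_Delta_def)

lemma heis_Delta_mult:
  assumes "subring S R" "x \<in> heis_Delta R S" "y \<in> heis_Delta R S"
  shows "x \<otimes>\<^bsub>heis_group R\<^esub> y \<in> heis_Delta R S"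
proof -
  interpret H: group "heis_group R" by (rule heis_group_is_group)
  have "x \<otimes>\<^bsub>heis_group R\<^esub> y \<in> carrier (heis_group R)"
    using assms heis_Delta_sub by blast
  then show ?thesis
    using heis_mult_subring(2)[OF assms(1)] assms(2,3) by (auto simp: heis_Delta_def heis_group_def)
qed

lemma heis_Gamma_subgroup:
  assumes "subring S R" shows "subgroup (heis_Gamma R S) (heis_group R)"
proof -
  interpret H: group "heis_group R" by (rule heis_group_is_group)
  interpret S: cring "R\<lparr>carrier := S\<rparr>"
    using subcring_iff[OF subringE(1)[OF assms]] subcringI'[OF assms] by simp
  interpret HS: group "heis_group (R\<lparr>carrier := S\<rparr>)" by (rule S.heis_group_is_group)
  have car: "heis_Gamma R S = carrier (heis_group (R\<lparr>carrier := S\<rparr>))" by (simp add: heis_Gamma_def)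
  have ent: "heis_entries x \<subseteq> S" if "x \<in> heis_Gamma R S" for x
    using that by (simp add: heis_Gamma_iff[OF assms])
  have mult: "x \<otimes>\<^bsub>heis_group (R\<lparr>carrier := S\<rparr>)\<^esub> y = x \<otimes>\<^bsub>heis_group R\<^esub> y"
    if "x \<in> heis_Gamma R S" "y \<in> heis_Gamma R S" for x y
    using heis_mult_subring(1)[OF assms ent ent, OF that] by (simp add: heis_group_def)
  have one: "\<one>\<^bsub>heis_group (R\<lparr>carrier := S\<rparr>)\<^esub> = \<one>\<^bsub>heis_group R\<^esub>" by (simp add: heis_group_def)
  have sub: "heis_Gamma R S \<subseteq> carrier (heis_group R)"
    using heis_Gamma_sub_Delta[OF assms] heis_Delta_sub by blast
  show ?thesis
  proof (rule H.subgroupI[OF sub])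
    show "heis_Gamma R S \<noteq> {}" using HS.one_closed car by blast
    fix x assume x: "x \<in> heis_Gamma R S"
    let ?y = "inv\<^bsub>heis_group (R\<lparr>carrier := S\<rparr>)\<^esub> x"
    have y: "?y \<in> heis_Gamma R S" using x HS.inv_closed car by simp
    have "?y \<otimes>\<^bsub>heis_group R\<^esub> x = \<one>\<^bsub>heis_group R\<^esub>"
      using mult[OF y x] one HS.l_inv x car by simp
    then have "inv\<^bsub>heis_group R\<^esub> x = ?y" using x y sub by (intro H.inv_equality) auto
    then show "inv\<^bsub>heis_group R\<^esub> x \<in> heis_Gamma R S" using y by simp
    fix z assume "z \<in> heis_Gamma R S"
    then show "x \<otimes>\<^bsub>heis_group R\<^esub> z \<in> heis_Gamma R S"
      using mult[OF x] HS.m_closed x car by metis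
  qed
qed

text \<open>Determinants multiply, and an element of S that divides a unit of S within S is itself a
  unit of S.\<close>

lemma heis_Gamma_right_factor:
  assumes "subring S R" "heis_entries x \<subseteq> S" "heis_entries y \<subseteq> S" "heis_mult R x y \<in> heis_Gamma R S"
  shows "y \<in> heis_Gamma R S"
proof -
  have sub: "S \<subseteq> carrier R" using subringE(1)[OF assms(1)] .
  obtain z where z: "z \<in> S" "heis_det R (heis_mult R x y) \<otimes> z = \<one>"
    using assms by (auto simp: heis_Gamma_iff[OF assms(1)])
  have d: "heis_det R x \<in> S" "heis_det R y \<in> S" using heis_det_subring(2) assms by auto
  have "heis_det R (heis_mult R x y) = heis_det R x \<otimes> heis_det R y"
    using assms sub by (intro heis_det_mult) auto
  then have "heis_det R y \<otimes> (heis_det R x \<otimes> z) = \<one>"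
    using z d sub m_ac by (metis (no_types, lifting) m_closed subsetD)
  moreover have "heis_det R x \<otimes> z \<in> S" using d z subringE(6)[OF assms(1)] by blast
  ultimately show ?thesis using assms by (auto simp: heis_Gamma_iff[OF assms(1)])
qed

end

context ring_hom_cring
begin

lemma heis_map_entries: "heis_entries (heis_map h x) = h ` heis_entries x"
  by (cases x rule: heis_entries.cases) auto

lemma heis_map_det:
  assumes "heis_entries x \<subseteq> carrier R"
  shows "heis_det S (heis_map h x) = h (heis_det R x)"
  using assms by (cases x rule: heis_entries.cases) (simp add: a_minus_def)

lemma heis_map_mult:
  assumes "heis_entries x \<subseteq> carrier R" "heis_entries y \<subseteq> carrier R"
  shows "heis_map h (heis_mult R x y) = heis_mult S (heis_map h x) (heis_map h y)"
proof -
  obtain a b c d u v where x: "x = ((a,b,c,d),(u,v))" by (cases x rule: heis_entries.cases)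
  obtain a' b' c' d' u' v' where y: "y = ((a',b',c',d'),(u',v'))" by (cases y rule: heis_entries.cases)
  show ?thesis using heis_map_det[OF assms(2)] assms
    unfolding x y by (simp add: Let_def a_minus_def)
qed

lemma heis_map_closed:
  assumes "x \<in> carrier (heis_group R)" shows "heis_map h x \<in> carrier (heis_group S)"
proof -
  have x: "heis_entries x \<subseteq> carrier R" "heis_det R x \<in> Units R" using assms by (auto simp: heis_group_def)
  then obtain y where y: "y \<in> carrier R" "y \<otimes>\<^bsub>R\<^esub> heis_det R x = \<one>\<^bsub>R\<^esub>" by (auto simp: Units_def)
  have d: "heis_det R x \<in> carrier R" using x by auto
  then have "h y \<otimes>\<^bsub>S\<^esub> h (heis_det R x) = \<one>\<^bsub>S\<^esub>" using y by (metis hom_mult hom_one)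
  then have "h (heis_det R x) \<in> Units S"
    using y(1) d S.m_comm hom_closed unfolding Units_def by fastforce
  then show ?thesis using x by (auto simp: heis_group_def heis_map_det heis_map_entries)
qed

end

section \<open>The p-adic numbers\<close>

locale padic =
  fixes p :: nat
  assumes prime_p: "prime p"
begin

section \<open>The p-adic absolute value on the rationals\<close>

abbreviation av :: "rat \<Rightarrow> real" where "av \<equiv> padic_abs p"

lemma p_gt_1: "real p > 1"
  using prime_p prime_gt_1_nat by auto

lemma prime_elem_p: "prime_elem (int p)"
  using prime_p by auto

lemma not_unit_p: "\<not> is_unit (int p)"
  using prime_elem_p by auto

text \<open>The definition reads the exponent off lowest terms n/d. From a d = n b and additivity of
  multiplicities the same formula holds for every fraction.\<close>

lemma padic_abs_frac:
  assumes "a \<noteq> 0" "b \<noteq> 0"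
  shows "av (of_int a / of_int b) = real p powi (int (multiplicity (int p) b) - int (multiplicity (int p) a))"
proof -
  let ?x = "of_int a / of_int b :: rat"
  obtain n d where nd: "quotient_of ?x = (n, d)" by (cases "quotient_of ?x")
  have d: "d > 0" using quotient_of_denom_pos[OF nd] .
  have "?x = of_int n / of_int d" using quotient_of_div[OF nd] .
  then have "of_int a * of_int d = (of_int n * of_int b :: rat)"
    using assms d by (simp add: field_simps)
  then have eq: "a * d = n * b" by (metis of_int_eq_iff of_int_mult)
  then have n: "n \<noteq> 0" using assms d by auto
  have "multiplicity (int p) a + multiplicity (int p) d = multiplicity (int p) n + multiplicity (int p) b"
    using eq prime_elem_multiplicity_mult_distrib[OF prime_elem_p] assms d n by (metis less_irrefl)
  then have "int (multiplicity (int p) d) - int (multiplicity (int p) n)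
      = int (multiplicity (int p) b) - int (multiplicity (int p) a)" by linarith
  then show ?thesis using assms nd by (simp add: padic_abs_def)
qed

lemma rat_frac: fixes x :: rat obtains a b :: int where "b \<noteq> 0" "x = of_int a / of_int b"
proof -
  obtain a b where ab: "quotient_of x = (a, b)" by (cases "quotient_of x")
  show thesis
    using that[of b a] quotient_of_div[OF ab] quotient_of_denom_pos[OF ab] by simp
qed

lemma av_0 [simp]: "av 0 = 0"
  by (simp add: padic_abs_def)

lemma av_pos: "x \<noteq> 0 \<Longrightarrow> av x > 0"
  using p_gt_1 by (simp add: padic_abs_def)

lemma av_eq_0_iff [simp]: "av x = 0 \<longleftrightarrow> x = 0"
  using av_pos[of x] by (cases "x = 0") auto

lemma av_nonneg [simp]: "av x \<ge> 0"
  using av_pos[of x] by (cases "x = 0") auto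

lemma av_mult: "av (x * y) = av x * av y"
proof (cases "x = 0 \<or> y = 0")
  case False
  obtain a b where x: "b \<noteq> 0" "x = of_int a / of_int b" by (rule rat_frac)
  obtain c d where y: "d \<noteq> 0" "y = of_int c / of_int d" by (rule rat_frac)
  have nz: "a \<noteq> 0" "c \<noteq> 0" using False x y by auto
  have "x * y = of_int (a * c) / of_int (b * d)" using x y by simp
  then have "av (x * y) = real p powi ((int (multiplicity (int p) b) - int (multiplicity (int p) a))
      + (int (multiplicity (int p) d) - int (multiplicity (int p) c)))"
    using nz x y padic_abs_frac[of "a * c" "b * d"]
    by (simp add: prime_elem_multiplicity_mult_distrib[OF prime_elem_p] algebra_simps)
  then show ?thesis using x y nz p_gt_1 by (simp add: padic_abs_frac power_int_add)
qed auto

lemma av_1 [simp]: "av 1 = 1"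
  using padic_abs_frac[of 1 1] by simp

lemma av_minus [simp]: "av (- x) = av x"
proof -
  have "av (-1) * av (-1) = 1" using av_mult[of "-1" "-1"] by simp
  then have "av (-1) = 1" using av_nonneg[of "-1"] by (auto simp: square_eq_1_iff)
  then show ?thesis using av_mult[of "-1" x] by simp
qed

lemma av_minus_commute: "av (x - y) = av (y - x)"
  using av_minus[of "x - y"] by simp

lemma av_inverse: "av (inverse x) = inverse (av x)"
proof (cases "x = 0")
  case False
  then have "av (inverse x) * av x = 1" using av_mult[of "inverse x" x] by simp
  then show ?thesis by (metis inverse_unique mult.commute)
qed simp

lemma av_divide: "av (x / y) = av x / av y"
  by (simp add: divide_inverse av_mult av_inverse)

lemma av_power: "av (x ^ k) = av x ^ k"
  by (induction k) (simp_all add: av_mult)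

text \<open>Over a common denominator this says that p^k divides a sum of integers when it divides
  both summands.\<close>

lemma av_add: "av (x + y) \<le> max (av x) (av y)"
proof (cases "x = 0 \<or> y = 0 \<or> x + y = 0")
  case True then show ?thesis using av_nonneg[of x] av_nonneg[of y] by (auto simp: max_def)
next
  case False
  obtain a b where x: "b \<noteq> 0" "x = of_int a / of_int b" by (rule rat_frac)
  obtain c d where y: "d \<noteq> 0" "y = of_int c / of_int d" by (rule rat_frac)
  let ?m = "multiplicity (int p)"
  have x': "x = of_int (a * d) / of_int (b * d)" using x y by simp
  have y': "y = of_int (c * b) / of_int (b * d)" using x y by simp
  have xy: "x + y = of_int (a * d + c * b) / of_int (b * d)"
    using x y unfolding x' y' by (simp add: add_divide_distrib)
  have nz: "a * d \<noteq> 0" "c * b \<noteq> 0" "a * d + c * b \<noteq> 0" "b * d \<noteq> 0"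
    using False x y x' y' xy by (metis div_0 of_int_0 mult_eq_0_iff)+
  have "int p ^ min (?m (a * d)) (?m (c * b)) dvd a * d + c * b"
    by (intro dvd_add multiplicity_dvd') auto
  then have "min (?m (a * d)) (?m (c * b)) \<le> ?m (a * d + c * b)"
    using nz not_unit_p by (intro multiplicity_geI) auto
  then have "?m (a * d) \<le> ?m (a * d + c * b) \<or> ?m (c * b) \<le> ?m (a * d + c * b)" by linarith
  moreover have "av (of_int u / of_int (b * d)) \<le> av (of_int w / of_int (b * d))"
    if "?m w \<le> ?m u" "u \<noteq> 0" "w \<noteq> 0" for u w
    using that nz p_gt_1 unfolding padic_abs_frac[OF that(2) nz(4)] padic_abs_frac[OF that(3) nz(4)]
    by (intro power_int_increasing) auto
  ultimately have "av (x + y) \<le> av x \<or> av (x + y) \<le> av y"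
    unfolding xy using nz by (metis x' y')
  then show ?thesis by linarith
qed

lemma av_diff: "av (x - y) \<le> max (av x) (av y)"
  using av_add[of x "- y"] by simp

text \<open>The isosceles triangle principle; it makes the absolute value eventually constant along
  a Cauchy sequence that is not null.\<close>

lemma av_eq_of_close: assumes "av (x - y) < av y" shows "av x = av y"
  using assms av_add[of "x - y" y] av_diff[of x "x - y"] by auto

lemma av_of_int_le: assumes "int p ^ k dvd n" shows "av (of_int n) \<le> 1 / real p ^ k"
proof (cases "n = 0")
  case True then show ?thesis using p_gt_1 by simp
next
  case False
  then have "k \<le> multiplicity (int p) n" using assms not_unit_p by (intro multiplicity_geI) auto
  moreover have "av (of_int n) = real p powi (- int (multiplicity (int p) n))"
    using padic_abs_frac[OF False, of 1] by simp
  ultimately have "av (of_int n) \<le> real p powi (- int k)"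
    using p_gt_1 by (simp only:) (intro power_int_increasing; simp)
  then show ?thesis using p_gt_1 by (simp add: power_int_minus field_simps)
qed

lemma av_of_int_le_1 [simp]: "av (of_int n) \<le> 1"
  using av_of_int_le[of 0 n] by simp

lemma av_of_int_eq_1: assumes "\<not> int p dvd n" shows "av (of_int n) = 1"
proof -
  have "n \<noteq> 0" "multiplicity (int p) n = 0" using assms by (auto simp: not_dvd_imp_multiplicity_0)
  then show ?thesis using padic_abs_frac[of n 1] by simp
qed

lemma av_p [simp]: "av (of_nat p) = 1 / real p"
proof -
  have "multiplicity (int p) (int p) = 1" using prime_elem_p by simp
  then show ?thesis using padic_abs_frac[of "int p" 1] p_gt_1 prime_p
    by (simp add: power_int_minus field_simps)
qed

lemma av_values: assumes "x \<noteq> 0" "av x \<le> 1" obtains k :: nat where "av x = 1 / real p ^ k"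
proof -
  obtain z :: int where z: "av x = real p powi z" using assms by (auto simp: padic_abs_def)
  have "z \<le> 0"
  proof (rule ccontr)
    assume "\<not> z \<le> 0"
    then have "real p powi z > 1" using p_gt_1 one_less_power_int by (metis not_le)
    then show False using z assms by simp
  qed
  then have "z = - int (nat (- z))" by simp
  then have "av x = 1 / real p ^ nat (- z)" using z
    by (metis inverse_eq_divide power_int_minus power_int_of_nat)
  then show ?thesis using that by blast
qed

lemma quotient_denom_not_dvd:
  assumes "av x \<le> 1" shows "\<not> int p dvd snd (quotient_of x)"
proof
  assume d: "int p dvd snd (quotient_of x)"
  obtain n d' where nd: "quotient_of x = (n, d')" by (cases "quotient_of x")
  have "coprime n d'" "d' > 0" using nd quotient_of_coprime quotient_of_denom_pos by auto
  then have nn: "\<not> int p dvd n" using d nd not_unit_p by (metis coprime_common_divisor snd_conv)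
  then have n0: "n \<noteq> 0" by auto
  then have x0: "x \<noteq> 0" using nd by auto
  have "multiplicity (int p) n = 0" using nn by (rule not_dvd_imp_multiplicity_0)
  moreover have "multiplicity (int p) d' > 0"
    using d nd \<open>d' > 0\<close> not_unit_p by (simp add: multiplicity_gt_zero_iff)
  ultimately have "av x = real p ^ multiplicity (int p) d'" "multiplicity (int p) d' > 0"
    using x0 nd by (auto simp: padic_abs_def)
  then have "av x > 1" using p_gt_1 by (simp add: one_less_power)
  then show False using assms by simp
qed

text \<open>For x = a/b in lowest terms p does not divide b. If u inverts b modulo p^k, then a u
  reduced modulo p^k approximates x.\<close>

lemma approx_int:
  assumes "av x \<le> 1"
  obtains n :: int where "0 \<le> n" "n < int p ^ k" "av (x - of_int n) \<le> 1 / real p ^ k"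
proof -
  obtain a b where ab: "quotient_of x = (a, b)" by (cases "quotient_of x")
  have b: "\<not> int p dvd b" "b > 0" using quotient_denom_not_dvd[OF assms] ab quotient_of_denom_pos by auto
  have "coprime b (int p ^ k)"
    using b prime_elem_p prime_elem_imp_coprime[of "int p" b] by (simp add: coprime_commute)
  then obtain u v where uv: "u * b + v * int p ^ k = 1" using bezout_int[of b "int p ^ k"] by auto
  let ?n = "(a * u) mod (int p ^ k)"
  have "a - ?n * b = (a * u - ?n) * b + a * v * int p ^ k"
    using arg_cong[OF uv, of "\<lambda>t. a * t"] by (simp add: algebra_simps)
  moreover have "int p ^ k dvd a * u - ?n" by (rule dvd_minus_mod)
  ultimately have "int p ^ k dvd a - ?n * b" by simp
  then have "av (of_int (a - ?n * b)) \<le> 1 / real p ^ k" by (rule av_of_int_le)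
  moreover have "x - of_int ?n = of_int (a - ?n * b) / of_int b"
    using quotient_of_div[OF ab] b by (simp add: field_simps)
  ultimately have "av (x - of_int ?n) \<le> 1 / real p ^ k"
    using av_of_int_eq_1[OF b(1)] by (simp add: av_divide)
  moreover have "0 \<le> ?n" "?n < int p ^ k" using p_gt_1 by auto
  ultimately show ?thesis using that by blast
qed

end

text \<open>A prime factor of the reduced denominator would give x an absolute value above 1 at that
  prime.\<close>

lemma int_if_all_padic_int:
  assumes "\<And>p. prime p \<Longrightarrow> padic_abs p x \<le> 1"
  shows "x \<in> \<int>"
proof -
  obtain a b where ab: "quotient_of x = (a, b)" by (cases "quotient_of x")
  have b: "b > 0" using ab quotient_of_denom_pos by auto
  have "b = 1"
  proof (rule ccontr)
    assume "b \<noteq> 1"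
    then have "nat b \<noteq> 1" using b by auto
    then obtain p where p: "prime p" "p dvd nat b" using prime_factor_nat by blast
    interpret padic p using p by unfold_locales
    have "int p dvd b" using p b by (metis int_dvd_int_iff int_nat_eq less_imp_le)
    then show False using quotient_denom_not_dvd[OF assms[OF p(1)]] ab by simp
  qed
  then show ?thesis using quotient_of_div[OF ab] by simp
qed

context padic
begin

section \<open>Cauchy sequences modulo null sequences\<close>

abbreviation CR where "CR \<equiv> padic_cauchy_ring p"

lemma cauchy_bound:
  assumes "padic_cauchy p x" obtains B where "B > 0" "\<And>n. av (x n) \<le> B"
proof -
  obtain N where N: "\<And>m n. m \<ge> N \<Longrightarrow> n \<ge> N \<Longrightarrow> av (x m - x n) < 1"
    using assms unfolding padic_cauchy_def by (metis zero_less_one)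
  let ?B = "Max ((\<lambda>n. av (x n)) ` {..N}) + 1"
  have le: "av (x n) \<le> ?B - 1" if "n \<le> N" for n
    using that by (auto intro!: Max_ge)
  have "av (x n) \<le> ?B" for n
  proof (cases "n \<le> N")
    case True
    then show ?thesis using le[of n] by linarith
  next
    case False
    then have "av (x n) \<le> max (av (x n - x N)) (av (x N))" using av_add[of "x n - x N" "x N"] by simp
    moreover have "av (x n - x N) < 1" using N False by simp
    ultimately show ?thesis using le[of N] av_nonneg[of "x N"] by linarith
  qed
  moreover have "?B > 0" using le[of 0] av_nonneg[of "x 0"] by linarith
  ultimately show ?thesis using that by blast
qed

lemma cauchyI:
  assumes "\<And>e. e > 0 \<Longrightarrow> \<exists>N. \<forall>m\<ge>N. \<forall>n\<ge>N. av (x m - x n) < e" shows "padic_cauchy p x"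
  using assms by (simp add: padic_cauchy_def)

lemma cauchy_const [simp]: "padic_cauchy p (\<lambda>n. r)"
  by (rule cauchyI) simp

lemma cauchy_add:
  assumes "padic_cauchy p x" "padic_cauchy p y" shows "padic_cauchy p (\<lambda>n. x n + y n)"
proof (rule cauchyI)
  fix e :: real assume "e > 0"
  then obtain M N where MN: "\<forall>m\<ge>M. \<forall>n\<ge>M. av (x m - x n) < e" "\<forall>m\<ge>N. \<forall>n\<ge>N. av (y m - y n) < e"
    using assms unfolding padic_cauchy_def by metis
  have "av (x m + y m - (x n + y n)) < e" if "m \<ge> max M N" "n \<ge> max M N" for m n
    using MN that av_add[of "x m - x n" "y m - y n"] by (simp add: algebra_simps) (smt (verit, best))
  then show "\<exists>N. \<forall>m\<ge>N. \<forall>n\<ge>N. av (x m + y m - (x n + y n)) < e" by blast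
qed

lemma cauchy_mult:
  assumes "padic_cauchy p x" "padic_cauchy p y" shows "padic_cauchy p (\<lambda>n. x n * y n)"
proof (rule cauchyI)
  fix e :: real assume e: "e > 0"
  obtain B where B: "B > 0" "\<And>n. av (x n) \<le> B" using cauchy_bound[OF assms(1)] by blast
  obtain C where C: "C > 0" "\<And>n. av (y n) \<le> C" using cauchy_bound[OF assms(2)] by blast
  obtain M N where MN: "\<forall>m\<ge>M. \<forall>n\<ge>M. av (x m - x n) < e / C" "\<forall>m\<ge>N. \<forall>n\<ge>N. av (y m - y n) < e / B"
    using assms e B C unfolding padic_cauchy_def by (metis divide_pos_pos)
  have "av (x m * y m - x n * y n) < e" if mn: "m \<ge> max M N" "n \<ge> max M N" for m n
  proof -
    have "x m * y m - x n * y n = x m * (y m - y n) + (x m - x n) * y n" by (simp add: algebra_simps)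
    then have "av (x m * y m - x n * y n) \<le> max (av (x m) * av (y m - y n)) (av (x m - x n) * av (y n))"
      using av_add[of "x m * (y m - y n)" "(x m - x n) * y n"] by (simp add: av_mult)
    moreover have "av (x m) * av (y m - y n) \<le> B * av (y m - y n)" using B by (intro mult_right_mono) auto
    moreover have "B * av (y m - y n) < e" using MN mn B by (simp add: field_simps)
    moreover have "av (x m - x n) * av (y n) \<le> av (x m - x n) * C" using C by (intro mult_left_mono) auto
    moreover have "av (x m - x n) * C < e" using MN mn C by (simp add: field_simps)
    ultimately show ?thesis by linarith
  qed
  then show "\<exists>N. \<forall>m\<ge>N. \<forall>n\<ge>N. av (x m * y m - x n * y n) < e" by blast
qed

lemma cauchy_uminus: "padic_cauchy p x \<Longrightarrow> padic_cauchy p (\<lambda>n. - x n)"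
  using cauchy_mult[of "\<lambda>n. -1" x] by simp

lemma CR_cring: "cring CR"
proof (rule cringI)
  show "abelian_group CR"
  proof (rule abelian_groupI)
    fix x assume "x \<in> carrier CR"
    then show "\<exists>y\<in>carrier CR. y \<oplus>\<^bsub>CR\<^esub> x = \<zero>\<^bsub>CR\<^esub>"
      by (intro bexI[of _ "\<lambda>n. - x n"]) (auto simp: padic_cauchy_ring_def cauchy_uminus)
  qed (auto simp: padic_cauchy_ring_def cauchy_add algebra_simps)
  show "comm_monoid CR"
    by (rule comm_monoidI) (auto simp: padic_cauchy_ring_def cauchy_mult algebra_simps)
qed (auto simp: padic_cauchy_ring_def algebra_simps)

lemma null_iff: "x \<in> padic_null p \<longleftrightarrow> (\<forall>e>0. \<exists>N. \<forall>n\<ge>N. av (x n) < e)"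
  by (simp add: padic_null_def LIMSEQ_iff)

lemma null_cauchy: assumes "x \<in> padic_null p" shows "padic_cauchy p x"
proof (rule cauchyI)
  fix e :: real assume "e > 0"
  then obtain N where N: "\<forall>n\<ge>N. av (x n) < e" using assms null_iff by blast
  have "av (x m - x n) < e" if "m \<ge> N" "n \<ge> N" for m n
    using N that av_diff[of "x m" "x n"] by (smt (verit, best))
  then show "\<exists>N. \<forall>m\<ge>N. \<forall>n\<ge>N. av (x m - x n) < e" by blast
qed

lemma null_add:
  assumes "x \<in> padic_null p" "y \<in> padic_null p" shows "(\<lambda>n. x n + y n) \<in> padic_null p"
  unfolding null_iff
proof (intro allI impI)
  fix e :: real assume "e > 0"
  then obtain M N where MN: "\<forall>n\<ge>M. av (x n) < e" "\<forall>n\<ge>N. av (y n) < e"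
    using assms null_iff by blast
  have "av (x n + y n) < e" if "n \<ge> max M N" for n
    using MN that av_add[of "x n" "y n"] by (smt (verit, best) max.bounded_iff)
  then show "\<exists>N. \<forall>n\<ge>N. av (x n + y n) < e" by blast
qed

lemma null_mult:
  assumes "padic_cauchy p x" "y \<in> padic_null p" shows "(\<lambda>n. x n * y n) \<in> padic_null p"
  unfolding null_iff
proof (intro allI impI)
  fix e :: real assume e: "e > 0"
  obtain B where B: "B > 0" "\<And>n. av (x n) \<le> B" using cauchy_bound[OF assms(1)] by blast
  obtain N where N: "\<forall>n\<ge>N. av (y n) < e / B" using assms e B null_iff divide_pos_pos by blast
  have "av (x n * y n) < e" if "n \<ge> N" for n
  proof -
    have "av (x n) * av (y n) \<le> B * av (y n)" using B by (intro mult_right_mono) auto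
    also have "\<dots> < e" using N that B by (simp add: field_simps)
    finally show ?thesis by (simp add: av_mult)
  qed
  then show "\<exists>N. \<forall>n\<ge>N. av (x n * y n) < e" by blast
qed

lemma null_uminus: "x \<in> padic_null p \<Longrightarrow> (\<lambda>n. - x n) \<in> padic_null p"
  by (simp add: null_iff)

lemma CR_simps:
  "x \<in> carrier CR \<longleftrightarrow> padic_cauchy p x"
  "x \<otimes>\<^bsub>CR\<^esub> y = (\<lambda>n. x n * y n)" "x \<oplus>\<^bsub>CR\<^esub> y = (\<lambda>n. x n + y n)"
  "\<one>\<^bsub>CR\<^esub> = (\<lambda>n. 1)" "\<zero>\<^bsub>CR\<^esub> = (\<lambda>n. 0)"
  by (simp_all add: padic_cauchy_ring_def)

interpretation CR: cring CR by (rule CR_cring)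

lemma CR_a_inv: "padic_cauchy p x \<Longrightarrow> \<ominus>\<^bsub>CR\<^esub> x = (\<lambda>n. - x n)"
  by (rule CR.minus_equality) (auto simp: CR_simps cauchy_uminus)

lemma null_ideal: "ideal (padic_null p) CR"
proof (rule idealI)
  show "subgroup (padic_null p) (add_monoid CR)"
  proof (rule CR.add.subgroupI)
    show "padic_null p \<subseteq> carrier CR" using null_cauchy by (auto simp: CR_simps)
    have "(\<lambda>n. 0) \<in> padic_null p" by (simp add: null_iff)
    then show "padic_null p \<noteq> {}" by blast
    fix x assume "x \<in> padic_null p"
    then show "\<ominus>\<^bsub>CR\<^esub> x \<in> padic_null p" using CR_a_inv null_cauchy null_uminus by simp
  qed (simp add: CR_simps null_add)
  fix x y assume xy: "x \<in> padic_null p" "y \<in> carrier CR"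
  then show "y \<otimes>\<^bsub>CR\<^esub> x \<in> padic_null p" by (simp add: CR_simps null_mult)
  then show "x \<otimes>\<^bsub>CR\<^esub> y \<in> padic_null p" by (simp add: CR_simps mult.commute)
qed (rule CR.ring_axioms)

interpretation null: ideal "padic_null p" CR by (rule null_ideal)

abbreviation K where "K \<equiv> Qp p"
abbreviation cls where "cls \<equiv> padic_of_seq p"

sublocale K: cring K
  unfolding Qp_def by (rule null.quotient_is_cring[OF CR_cring])

lemma cls_hom: "ring_hom_cring CR K cls"
proof -
  have "padic_of_seq p = (+>\<^bsub>CR\<^esub>) (padic_null p)" by (rule ext) (simp add: padic_of_seq_def)
  then have "cls \<in> ring_hom CR K" unfolding Qp_def using null.rcos_ring_hom by simp
  then show ?thesis
    by (intro ring_hom_cringI CR_cring K.cring_axioms ring_hom_cring_axioms.intro ring_hom_cring.intro)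
qed

interpretation cls: ring_hom_cring CR K cls by (rule cls_hom)

lemma cls_closed: "padic_cauchy p x \<Longrightarrow> cls x \<in> carrier K"
  using cls.hom_closed[of x] by (simp add: CR_simps)

lemma cls_uminus: "padic_cauchy p x \<Longrightarrow> \<ominus>\<^bsub>K\<^esub> cls x = cls (\<lambda>n. - x n)"
  using cls.hom_a_inv[of x] by (simp add: CR_simps CR_a_inv)

lemma cls_simps:
  assumes "padic_cauchy p x" "padic_cauchy p y"
  shows "cls x \<otimes>\<^bsub>K\<^esub> cls y = cls (\<lambda>n. x n * y n)" "cls x \<oplus>\<^bsub>K\<^esub> cls y = cls (\<lambda>n. x n + y n)"
  using assms cls.hom_mult[of x y] cls.hom_add[of x y]
  by (auto simp: CR_simps)

lemma cls_one: "\<one>\<^bsub>K\<^esub> = cls (\<lambda>n. 1)" and cls_zero: "\<zero>\<^bsub>K\<^esub> = cls (\<lambda>n. 0)"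
  using cls.hom_one cls.hom_zero by (auto simp: CR_simps)

lemma cls_eq_iff:
  assumes "padic_cauchy p x" "padic_cauchy p y"
  shows "cls x = cls y \<longleftrightarrow> (\<lambda>n. x n - y n) \<in> padic_null p"
proof -
  have "cls x = cls y \<longleftrightarrow> x \<ominus>\<^bsub>CR\<^esub> y \<in> padic_null p"
    unfolding padic_of_seq_def
    using CR.quotient_eq_iff_same_a_r_cos[OF null_ideal, of x y] assms by (simp add: CR_simps)
  then show ?thesis using assms by (simp add: a_minus_def CR_a_inv CR_simps)
qed

lemma Zp_iff: "\<alpha> \<in> Zp p \<longleftrightarrow> (\<exists>x. padic_cauchy p x \<and> (\<forall>n. av (x n) \<le> 1) \<and> \<alpha> = cls x)"
  by (auto simp: Zp_def)

lemma ZpI: "\<lbrakk>padic_cauchy p x; \<And>n. av (x n) \<le> 1\<rbrakk> \<Longrightarrow> cls x \<in> Zp p"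
  by (auto simp: Zp_def)

lemma Zp_subring: "subring (Zp p) K"
proof (rule K.subringI)
  show "Zp p \<subseteq> carrier K" by (auto simp: Zp_iff cls_closed)
  show "\<one>\<^bsub>K\<^esub> \<in> Zp p" unfolding cls_one by (rule ZpI) auto
  fix \<alpha> assume "\<alpha> \<in> Zp p"
  then obtain x where x: "padic_cauchy p x" "\<And>n. av (x n) \<le> 1" "\<alpha> = cls x" by (auto simp: Zp_iff)
  then show "\<ominus>\<^bsub>K\<^esub> \<alpha> \<in> Zp p" by (auto simp: cls_uminus cauchy_uminus intro!: ZpI)
  fix \<beta> assume "\<beta> \<in> Zp p"
  then obtain y where y: "padic_cauchy p y" "\<And>n. av (y n) \<le> 1" "\<beta> = cls y" by (auto simp: Zp_iff)
  show "\<alpha> \<otimes>\<^bsub>K\<^esub> \<beta> \<in> Zp p" using x y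
    by (auto simp: cls_simps cauchy_mult av_mult mult_le_one intro!: ZpI)
  have "av (x n + y n) \<le> 1" for n using x(2)[of n] y(2)[of n] av_add[of "x n" "y n"] by linarith
  then show "\<alpha> \<oplus>\<^bsub>K\<^esub> \<beta> \<in> Zp p" using x y by (auto simp: cls_simps cauchy_add intro!: ZpI)
qed

abbreviation j where "j \<equiv> padic_of_rat p"

lemma j_hom: "ring_hom_cring (ring_of_type_algebra :: rat ring) K j"
proof -
  have "j \<in> ring_hom (ring_of_type_algebra :: rat ring) K"
    by (rule ring_hom_memI)
      (auto simp: padic_of_rat_def ring_of_type_algebra_def cls_simps cls_closed cls_one)
  then show ?thesis
    by (intro ring_hom_cringI cring_from_type_algebra K.cring_axioms ring_hom_cring_axioms.intro ring_hom_cring.intro)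
qed

sublocale j: ring_hom_cring "ring_of_type_algebra :: rat ring" K j by (rule j_hom)

text \<open>Membership in \<open>Zp p\<close> only provides some sequence in the unit ball with
  class \<open>j r\<close>. A late term is at distance less than 1 from r, and the ultrametric
  inequality transfers its bound to r.\<close>

lemma j_mem_Zp_iff: "j r \<in> Zp p \<longleftrightarrow> av r \<le> 1"
proof
  assume "j r \<in> Zp p"
  then obtain x where x: "padic_cauchy p x" "\<And>n. av (x n) \<le> 1" "j r = cls x" by (auto simp: Zp_iff)
  then have "(\<lambda>n. r - x n) \<in> padic_null p"
    using cls_eq_iff[of "\<lambda>_. r" x] by (simp add: padic_of_rat_def)
  then obtain N where "av (r - x N) < 1" unfolding null_iff by (metis order_refl zero_less_one)
  then show "av r \<le> 1" using av_add[of "r - x N" "x N"] x(2)[of N] by simp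
next
  assume "av r \<le> 1"
  then show "j r \<in> Zp p" unfolding padic_of_rat_def by (intro ZpI) auto
qed

lemma j_eq_iff: "j r = j s \<longleftrightarrow> r = s"
proof
  assume "j r = j s"
  then have "(\<lambda>n. r - s) \<in> padic_null p" unfolding padic_of_rat_def by (simp add: cls_eq_iff)
  then show "r = s" unfolding null_iff by (metis av_pos eq_iff_diff_eq_0 less_irrefl order_refl)
qed simp

text \<open>Dropping an initial segment lets bounds that hold from some index on be assumed for all
  terms, as \<open>ZpI\<close> requires.\<close>

lemma cls_shift:
  assumes "padic_cauchy p x" shows "padic_cauchy p (\<lambda>n. x (n + N))" "cls (\<lambda>n. x (n + N)) = cls x"
proof -
  show c: "padic_cauchy p (\<lambda>n. x (n + N))"
    using assms unfolding padic_cauchy_def by (meson le_add1 le_trans)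
  have "(\<lambda>n. x (n + N) - x n) \<in> padic_null p" unfolding null_iff
    using assms unfolding padic_cauchy_def by (meson le_add1 le_trans)
  then show "cls (\<lambda>n. x (n + N)) = cls x" using c assms by (simp add: cls_eq_iff)
qed

text \<open>From some index on the sequence moves by less than p^-k, so one integer n approximates
  the whole tail, and the difference divided by p^k stays in the unit ball. The residues n become
  the integer entries of Hermite forms.\<close>

lemma Zp_approx:
  assumes "\<alpha> \<in> Zp p"
  shows "\<exists>n\<in>{0..<int p ^ k}. \<exists>\<beta>\<in>Zp p. \<alpha> = j (of_int n) \<oplus>\<^bsub>K\<^esub> j (of_nat p ^ k) \<otimes>\<^bsub>K\<^esub> \<beta>"
proof -
  obtain x where x: "padic_cauchy p x" "\<And>n. av (x n) \<le> 1" "\<alpha> = cls x" using assms by (auto simp: Zp_iff)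
  have "1 / real p ^ k > 0" using p_gt_1 by simp
  then obtain N where N: "\<forall>m\<ge>N. \<forall>n\<ge>N. av (x m - x n) < 1 / real p ^ k"
    using x(1) unfolding padic_cauchy_def by blast
  obtain n where n: "0 \<le> n" "n < int p ^ k" "av (x N - of_int n) \<le> 1 / real p ^ k"
    using approx_int[OF x(2)[of N]] by blast
  let ?x = "\<lambda>m. x (m + N)"
  have x': "padic_cauchy p ?x" "cls ?x = \<alpha>" using cls_shift[OF x(1)] x(3) by auto
  let ?y = "\<lambda>m. inverse (of_nat p ^ k) * (?x m + - of_int n)"
  have y: "padic_cauchy p ?y" using x' by (intro cauchy_mult cauchy_add cauchy_const)
  have "av (?y m) \<le> 1" for m
  proof -
    have "av (x (m + N) - x N) < 1 / real p ^ k" using N by simp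
    then have "av (?x m - of_int n) \<le> 1 / real p ^ k"
      using av_add[of "x (m + N) - x N" "x N - of_int n"] n(3) by simp
    then show ?thesis using p_gt_1 by (simp add: av_mult av_inverse av_divide av_power power_divide field_simps)
  qed
  then have \<beta>: "cls ?y \<in> Zp p" by (rule ZpI[OF y])
  have "j (of_int n) \<oplus>\<^bsub>K\<^esub> j (of_nat p ^ k) \<otimes>\<^bsub>K\<^esub> cls ?y = cls (\<lambda>m. of_int n + of_nat p ^ k * ?y m)"
    using y by (simp add: padic_of_rat_def cls_simps cauchy_mult)
  also have "(\<lambda>m. of_int n + of_nat p ^ k * ?y m) = ?x"
    using p_gt_1 by (auto simp: field_simps)
  finally have "\<alpha> = j (of_int n) \<oplus>\<^bsub>K\<^esub> j (of_nat p ^ k) \<otimes>\<^bsub>K\<^esub> cls ?y" using x' by simp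
  then show ?thesis using n \<beta> by (intro bexI[of _ n] bexI[of _ "cls ?y"]) auto
qed

text \<open>A representing sequence of a nonzero element is not null, so its absolute value is
  eventually a constant p^-k. Dividing the tail by p^k leaves terms of absolute value 1, whose
  termwise inverses represent V.\<close>

lemma Zp_unit_power:
  assumes "\<alpha> \<in> Zp p" "\<alpha> \<noteq> \<zero>\<^bsub>K\<^esub>"
  shows "\<exists>k. \<exists>U\<in>Zp p. \<exists>V\<in>Zp p. U \<otimes>\<^bsub>K\<^esub> V = \<one>\<^bsub>K\<^esub> \<and> \<alpha> = j (of_nat p ^ k) \<otimes>\<^bsub>K\<^esub> U"
proof -
  obtain x where x: "padic_cauchy p x" "\<And>n. av (x n) \<le> 1" "\<alpha> = cls x" using assms(1) by (auto simp: Zp_iff)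
  have "x \<notin> padic_null p" using assms(2) x cls_eq_iff[of x "\<lambda>_. 0"] cls_zero by auto
  then obtain e where e: "e > 0" "\<And>N. \<exists>n\<ge>N. av (x n) \<ge> e" unfolding null_iff by (meson not_le)
  obtain N where N: "\<forall>m\<ge>N. \<forall>n\<ge>N. av (x m - x n) < e" using x(1) e(1) unfolding padic_cauchy_def by blast
  obtain n0 where n0: "n0 \<ge> N" "av (x n0) \<ge> e" using e(2) by blast
  have "x n0 \<noteq> 0" using n0 e(1) by auto
  then obtain k where k: "av (x n0) = 1 / real p ^ k" using av_values x(2) by metis
  have av: "av (x (m + N)) = 1 / real p ^ k" for m
    using av_eq_of_close[of "x (m + N)" "x n0"] N n0 k by (smt (verit, best) le_add2)
  let ?x = "\<lambda>m. x (m + N)"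
  have x': "padic_cauchy p ?x" "cls ?x = \<alpha>" using cls_shift[OF x(1)] x(3) by auto
  have nz: "?x m \<noteq> 0" for m using av[of m] p_gt_1 by auto
  let ?u = "\<lambda>m. inverse (of_nat p ^ k) * ?x m"
  have u: "padic_cauchy p ?u" using x' by (intro cauchy_mult cauchy_const)
  have avu: "av (?u m) = 1" for m
    using av[of m] p_gt_1 by (simp add: av_mult av_inverse av_divide av_power power_divide field_simps)
  let ?v = "\<lambda>m. inverse (?u m)"
  have v: "padic_cauchy p ?v"
  proof (rule cauchyI)
    fix e :: real assume "e > 0"
    then obtain M where M: "\<forall>m\<ge>M. \<forall>n\<ge>M. av (?u m - ?u n) < e" using u unfolding padic_cauchy_def by blast
    \<comment> \<open>The difference of the inverses is the difference of the terms, up to sign,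
      divided by a product of absolute value 1. So the inverse sequence is Cauchy with the same
      indices.\<close>
    have "av (?v m - ?v n) = av (?u m - ?u n)" for m n
    proof -
      have "?u m \<noteq> 0" "?u n \<noteq> 0" using nz p_gt_1 by auto
      then have "?v m - ?v n = (?u n - ?u m) * ?v m * ?v n" by (simp add: field_simps)
      then show ?thesis using avu[of m] avu[of n] av_minus_commute[of "?u m" "?u n"]
        by (simp only: av_mult[of "(?u n - ?u m) * ?v m"] av_mult[of "?u n - ?u m"] av_inverse[of "?u m"] av_inverse[of "?u n"])
          simp
    qed
    then show "\<exists>M. \<forall>m\<ge>M. \<forall>n\<ge>M. av (?v m - ?v n) < e" using M by auto
  qed
  have avv: "av (?v m) = 1" for m using avu[of m] av_inverse[of "?u m"] by simp
  have "cls ?u \<otimes>\<^bsub>K\<^esub> cls ?v = \<one>\<^bsub>K\<^esub>"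
  proof -
    have "?u m \<noteq> 0" for m using avu[of m] by (metis av_0 zero_neq_one)
    then have "(\<lambda>m. ?u m * ?v m) = (\<lambda>m. 1)" by (intro ext right_inverse)
    then show ?thesis unfolding cls_simps(1)[OF u v] cls_one by (rule arg_cong)
  qed
  moreover have "\<alpha> = j (of_nat p ^ k) \<otimes>\<^bsub>K\<^esub> cls ?u"
  proof -
    have "(\<lambda>m. of_nat p ^ k * ?u m) = ?x" using p_gt_1 by auto
    then show ?thesis unfolding padic_of_rat_def using x' by (simp add: cls_simps u)
  qed
  moreover have "cls ?u \<in> Zp p" "cls ?v \<in> Zp p" using u v avu avv by (auto intro!: ZpI simp del: inverse_mult_distrib)
  ultimately show ?thesis by blast
qed

end

section \<open>Hermite normal forms and the local Hecke ring\<close>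

lemma rat_ring_simps:
  fixes x y :: rat
  shows "x \<otimes>\<^bsub>ring_of_type_algebra\<^esub> y = x * y" "x \<oplus>\<^bsub>ring_of_type_algebra\<^esub> y = x + y"
    "\<one>\<^bsub>ring_of_type_algebra\<^esub> = (1 :: rat)" "\<zero>\<^bsub>ring_of_type_algebra\<^esub> = (0 :: rat)"
    "carrier ring_of_type_algebra = (UNIV :: rat set)"
    "x \<ominus>\<^bsub>ring_of_type_algebra\<^esub> y = x - y" "\<ominus>\<^bsub>ring_of_type_algebra\<^esub> y = - y"
proof -
  interpret Q: cring "ring_of_type_algebra :: rat ring" by (rule cring_from_type_algebra)
  show "\<ominus>\<^bsub>ring_of_type_algebra\<^esub> y = - y"
    by (rule Q.minus_equality) (simp_all add: ring_of_type_algebra_def)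
  then show "x \<ominus>\<^bsub>ring_of_type_algebra\<^esub> y = x - y"
    by (simp add: a_minus_def) (simp add: ring_of_type_algebra_def)
qed (simp_all add: ring_of_type_algebra_def)

context padic
begin

abbreviation \<GG> where "\<GG> \<equiv> G_Hp p"

lemma j_simps:
  "j (x * y) = j x \<otimes>\<^bsub>K\<^esub> j y" "j (x + y) = j x \<oplus>\<^bsub>K\<^esub> j y" "j 0 = \<zero>\<^bsub>K\<^esub>" "j 1 = \<one>\<^bsub>K\<^esub>"
  using j.hom_mult[of x y] j.hom_add[of x y] j.hom_zero j.hom_one
  by (simp_all add: ring_of_type_algebra_def)

lemma j_closed [simp]: "j x \<in> carrier K"
  using j.hom_closed by (simp add: ring_of_type_algebra_def)

lemma Zp_closed [simp]: "x \<in> Zp p \<Longrightarrow> x \<in> carrier K"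
  using subringE(1)[OF Zp_subring] by blast

lemmas Zp_ops [simp] = subringE(2,3,5,6,7)[OF Zp_subring]

lemma j_int_Zp [simp]: "j (of_int n) \<in> Zp p" "j (of_nat m ^ k) \<in> Zp p"
  using av_of_int_le_1[of "int m ^ k"] by (simp_all add: j_mem_Zp_iff)

sublocale \<GG>: group \<GG>
  unfolding G_Hp_def by (rule K.heis_group_is_group)

lemma Gamma_Hp_iff:
  "x \<in> Gamma_Hp p \<longleftrightarrow> heis_entries x \<subseteq> Zp p \<and> (\<exists>y\<in>Zp p. heis_det K x \<otimes>\<^bsub>K\<^esub> y = \<one>\<^bsub>K\<^esub>)"
  unfolding Gamma_Hp_def by (rule K.heis_Gamma_iff[OF Zp_subring])

lemma Gamma_Hp_subgroup: "subgroup (Gamma_Hp p) \<GG>"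
  unfolding Gamma_Hp_def G_Hp_def by (rule K.heis_Gamma_subgroup[OF Zp_subring])

lemma Gamma_Hp_sub_Delta_Hp: "Gamma_Hp p \<subseteq> Delta_Hp p"
  unfolding Gamma_Hp_def Delta_Hp_def by (rule K.heis_Gamma_sub_Delta[OF Zp_subring])

lemma Delta_Hp_sub: "Delta_Hp p \<subseteq> carrier \<GG>"
  unfolding Delta_Hp_def G_Hp_def by (rule K.heis_Delta_sub)

lemma Delta_Hp_mult: "\<lbrakk>x \<in> Delta_Hp p; y \<in> Delta_Hp p\<rbrakk> \<Longrightarrow> x \<otimes>\<^bsub>\<GG>\<^esub> y \<in> Delta_Hp p"
  unfolding Delta_Hp_def G_Hp_def by (rule K.heis_Delta_mult[OF Zp_subring])

lemma Delta_Hp_iff: "x \<in> Delta_Hp p \<longleftrightarrow> heis_entries x \<subseteq> Zp p \<and> heis_det K x \<in> Units K"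
  using subringE(1)[OF Zp_subring] by (auto simp: Delta_Hp_def heis_Delta_def heis_group_def)

lemma GG_mult: "x \<otimes>\<^bsub>\<GG>\<^esub> y = heis_mult K x y"
  by (simp add: G_Hp_def heis_group_def)

lemma Gamma_Hp_mult_Delta_Hp: "\<lbrakk>g \<in> Gamma_Hp p; x \<in> Delta_Hp p\<rbrakk> \<Longrightarrow> heis_mult K g x \<in> Delta_Hp p"
  using Delta_Hp_mult[of g x] Gamma_Hp_sub_Delta_Hp by (auto simp: GG_mult)

text \<open>Up to units, elements are powers of p and divisibility compares exponents. In row
  reduction this replaces the Euclidean algorithm: one elimination clears a column entry.\<close>

lemma Zp_total_dvd:
  assumes "a \<in> Zp p" "c \<in> Zp p"
  shows "(\<exists>t\<in>Zp p. c = t \<otimes>\<^bsub>K\<^esub> a) \<or> (\<exists>t\<in>Zp p. a = t \<otimes>\<^bsub>K\<^esub> c)"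
proof (cases "a = \<zero>\<^bsub>K\<^esub> \<or> c = \<zero>\<^bsub>K\<^esub>")
  case True
  then show ?thesis using assms by (metis K.l_null Zp_closed Zp_ops(1))
next
  case False
  have main: "\<exists>t\<in>Zp p. y = t \<otimes>\<^bsub>K\<^esub> x"
    if x: "U \<in> Zp p" "V \<in> Zp p" "U \<otimes>\<^bsub>K\<^esub> V = \<one>\<^bsub>K\<^esub>" "x = j (of_nat p ^ k) \<otimes>\<^bsub>K\<^esub> U"
      and y: "U' \<in> Zp p" "y = j (of_nat p ^ k') \<otimes>\<^bsub>K\<^esub> U'" and le: "k \<le> k'" for x y U V k U' k'
  proof (intro bexI)
    have "j (of_nat p ^ k') = j (of_nat p ^ (k' - k)) \<otimes>\<^bsub>K\<^esub> j (of_nat p ^ k)"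
      using le by (simp flip: j_simps(1) power_add)
    then have "y = j (of_nat p ^ (k' - k)) \<otimes>\<^bsub>K\<^esub> j (of_nat p ^ k) \<otimes>\<^bsub>K\<^esub> U' \<otimes>\<^bsub>K\<^esub> (U \<otimes>\<^bsub>K\<^esub> V)"
      using x y by simp
    also have "\<dots> = (j (of_nat p ^ (k' - k)) \<otimes>\<^bsub>K\<^esub> U' \<otimes>\<^bsub>K\<^esub> V) \<otimes>\<^bsub>K\<^esub> x"
      using x(1,2) y(1) unfolding x(4) by (simp add: K.m_ac)
    finally show "y = (j (of_nat p ^ (k' - k)) \<otimes>\<^bsub>K\<^esub> U' \<otimes>\<^bsub>K\<^esub> V) \<otimes>\<^bsub>K\<^esub> x" .
    show "j (of_nat p ^ (k' - k)) \<otimes>\<^bsub>K\<^esub> U' \<otimes>\<^bsub>K\<^esub> V \<in> Zp p" using x y by simp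
  qed
  obtain k U V where a: "U \<in> Zp p" "V \<in> Zp p" "U \<otimes>\<^bsub>K\<^esub> V = \<one>\<^bsub>K\<^esub>" "a = j (of_nat p ^ k) \<otimes>\<^bsub>K\<^esub> U"
    using Zp_unit_power[OF assms(1)] False by blast
  obtain k' U' V' where c: "U' \<in> Zp p" "V' \<in> Zp p" "U' \<otimes>\<^bsub>K\<^esub> V' = \<one>\<^bsub>K\<^esub>" "c = j (of_nat p ^ k') \<otimes>\<^bsub>K\<^esub> U'"
    using Zp_unit_power[OF assms(2)] False by blast
  show ?thesis
  proof (cases "k \<le> k'")
    case True then show ?thesis using main[OF a c(1,4)] by blast
  next
    case False then show ?thesis using main[OF c a(1,4)] by simp
  qed
qed

lemma reduce_lower_left:
  assumes "x \<in> Delta_Hp p"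
  shows "\<exists>g\<in>Gamma_Hp p. \<exists>a b d u v. heis_mult K g x = ((a, b, \<zero>\<^bsub>K\<^esub>, d), (u, v))"
proof -
  obtain a b c d u v where x: "x = ((a,b,c,d),(u,v))" by (cases x rule: heis_entries.cases)
  have mem: "a \<in> Zp p" "b \<in> Zp p" "c \<in> Zp p" "d \<in> Zp p" "u \<in> Zp p" "v \<in> Zp p"
    using assms x by (auto simp: Delta_Hp_iff)
  note mem' [simp] = mem[THEN Zp_closed]
  from Zp_total_dvd[OF mem(1) mem(3)] show ?thesis
  proof (elim disjE bexE)
    fix t assume t: "t \<in> Zp p" "c = t \<otimes>\<^bsub>K\<^esub> a"
    let ?g = "((\<one>\<^bsub>K\<^esub>, \<zero>\<^bsub>K\<^esub>, \<ominus>\<^bsub>K\<^esub> t, \<one>\<^bsub>K\<^esub>), (\<zero>\<^bsub>K\<^esub>, \<zero>\<^bsub>K\<^esub>))"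
    have "?g \<in> Gamma_Hp p"
      using t by (auto simp: Gamma_Hp_iff a_minus_def intro!: bexI[of _ "\<one>\<^bsub>K\<^esub>"])
    moreover have "\<ominus>\<^bsub>K\<^esub> t \<otimes>\<^bsub>K\<^esub> a \<oplus>\<^bsub>K\<^esub> c = \<zero>\<^bsub>K\<^esub>"
      using t by (simp add: K.l_minus K.l_neg)
    ultimately show ?thesis using t unfolding x
      by (intro bexI[of _ ?g]) (auto simp: Let_def)
  next
    fix t assume t: "t \<in> Zp p" "a = t \<otimes>\<^bsub>K\<^esub> c"
    \<comment> \<open>A row swap combined with an elimination; its determinant is -1, which is its
      own inverse.\<close>
    let ?g = "((\<zero>\<^bsub>K\<^esub>, \<one>\<^bsub>K\<^esub>, \<one>\<^bsub>K\<^esub>, \<ominus>\<^bsub>K\<^esub> t), (\<zero>\<^bsub>K\<^esub>, \<zero>\<^bsub>K\<^esub>))"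
    have "?g \<in> Gamma_Hp p"
      using t by (auto simp: Gamma_Hp_iff a_minus_def K.l_minus intro!: bexI[of _ "\<ominus>\<^bsub>K\<^esub> \<one>\<^bsub>K\<^esub>"])
    moreover have "a \<oplus>\<^bsub>K\<^esub> \<ominus>\<^bsub>K\<^esub> t \<otimes>\<^bsub>K\<^esub> c = \<zero>\<^bsub>K\<^esub>"
      using t by (simp add: K.l_minus K.r_neg)
    ultimately show ?thesis using t unfolding x
      by (intro bexI[of _ ?g]) (auto simp: Let_def)
  qed
qed

text \<open>Injectivity of \<open>j\<close> gives 1 distinct from 0 in \<open>Qp p\<close>, which
  being a commutative ring does not include.\<close>

lemma zero_not_unit: "\<zero>\<^bsub>K\<^esub> \<notin> Units K"
proof -
  have "\<one>\<^bsub>K\<^esub> \<noteq> \<zero>\<^bsub>K\<^esub>" using j_eq_iff[of 1 0] j_simps(3,4) by simp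
  then show ?thesis by (auto simp: Units_def)
qed

lemma reduce_diagonal:
  assumes "x \<in> Delta_Hp p" "x = ((a, b, \<zero>\<^bsub>K\<^esub>, d), (u, v))"
  shows "\<exists>g\<in>Gamma_Hp p. \<exists>i l b u v. heis_mult K g x = ((j (of_nat p ^ i), b, \<zero>\<^bsub>K\<^esub>, j (of_nat p ^ l)), (u, v))"
proof -
  have mem: "a \<in> Zp p" "b \<in> Zp p" "d \<in> Zp p" "u \<in> Zp p" "v \<in> Zp p"
    and u: "heis_det K x \<in> Units K" using assms by (auto simp: Delta_Hp_iff)
  note mem' [simp] = mem[THEN Zp_closed]
  have "a \<otimes>\<^bsub>K\<^esub> d \<in> Units K" using u assms by (simp add: a_minus_def)
  then have "a \<noteq> \<zero>\<^bsub>K\<^esub>" "d \<noteq> \<zero>\<^bsub>K\<^esub>" using zero_not_unit by auto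
  then obtain i U V l U' V' where
    a: "U \<in> Zp p" "V \<in> Zp p" "U \<otimes>\<^bsub>K\<^esub> V = \<one>\<^bsub>K\<^esub>" "a = j (of_nat p ^ i) \<otimes>\<^bsub>K\<^esub> U" and
    d: "U' \<in> Zp p" "V' \<in> Zp p" "U' \<otimes>\<^bsub>K\<^esub> V' = \<one>\<^bsub>K\<^esub>" "d = j (of_nat p ^ l) \<otimes>\<^bsub>K\<^esub> U'"
    using Zp_unit_power[OF mem(1)] Zp_unit_power[OF mem(3)] by metis
  let ?g = "((V, \<zero>\<^bsub>K\<^esub>, \<zero>\<^bsub>K\<^esub>, V'), (\<zero>\<^bsub>K\<^esub>, \<zero>\<^bsub>K\<^esub>))"
  have "V \<otimes>\<^bsub>K\<^esub> V' \<otimes>\<^bsub>K\<^esub> (U \<otimes>\<^bsub>K\<^esub> U') = (U \<otimes>\<^bsub>K\<^esub> V) \<otimes>\<^bsub>K\<^esub> (U' \<otimes>\<^bsub>K\<^esub> V')"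
    using a(1,2) d(1,2) by (simp add: K.m_ac)
  then have "V \<otimes>\<^bsub>K\<^esub> V' \<otimes>\<^bsub>K\<^esub> (U \<otimes>\<^bsub>K\<^esub> U') = \<one>\<^bsub>K\<^esub>" using a d by simp
  then have "?g \<in> Gamma_Hp p"
    using a(1,2) d(1,2) by (auto simp: Gamma_Hp_iff a_minus_def intro!: bexI[of _ "U \<otimes>\<^bsub>K\<^esub> U'"])
  moreover have "V \<otimes>\<^bsub>K\<^esub> a = j (of_nat p ^ i)"
  proof -
    have "V \<otimes>\<^bsub>K\<^esub> a = j (of_nat p ^ i) \<otimes>\<^bsub>K\<^esub> (U \<otimes>\<^bsub>K\<^esub> V)" using a(1,2) unfolding a(4) by (simp add: K.m_ac)
    then show ?thesis using a(3) by simp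
  qed
  moreover have "V' \<otimes>\<^bsub>K\<^esub> d = j (of_nat p ^ l)"
  proof -
    have "V' \<otimes>\<^bsub>K\<^esub> d = j (of_nat p ^ l) \<otimes>\<^bsub>K\<^esub> (U' \<otimes>\<^bsub>K\<^esub> V')" using d(1,2) unfolding d(4) by (simp add: K.m_ac)
    then show ?thesis using d(3) by simp
  qed
  ultimately show ?thesis using a(2) d(2) unfolding assms(2)
    by (intro bexI[of _ ?g]) (auto simp: Let_def)
qed

text \<open>The ranges are what left multiplication can achieve: a unipotent upper triangular matrix
  changes the upper right entry by multiples of p^l, and (1, w) changes the vector by the
  determinant p^(i + l) times w. All entries are integers, so a form is also an element of the
  rational group.\<close>

definition hnf :: "nat \<Rightarrow> nat \<Rightarrow> rat heis set" where
  "hnf i l = (\<lambda>(n, u, v). ((of_nat p ^ i, of_int n, 0, of_nat p ^ l), (of_int u, of_int v))) `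
     ({0..<int p ^ l} \<times> {0..<int p ^ (i + l)} \<times> {0..<int p ^ (i + l)})"

lemma finite_hnf: "finite (hnf i l)"
  unfolding hnf_def by (intro finite_imageI finite_cartesian_product) auto

lemma reduce_hnf:
  assumes "x \<in> Delta_Hp p" "x = ((j (of_nat p ^ i), b, \<zero>\<^bsub>K\<^esub>, j (of_nat p ^ l)), (u, v))"
  shows "\<exists>g\<in>Gamma_Hp p. \<exists>h\<in>hnf i l. heis_mult K g x = heis_map j h"
proof -
  let ?\<pi> = "j (of_nat p ^ l)" and ?D = "j (of_nat p ^ (i + l))"
  have mem: "b \<in> Zp p" "u \<in> Zp p" "v \<in> Zp p" using assms by (auto simp: Delta_Hp_iff)
  note mem' [simp] = mem[THEN Zp_closed]
  obtain n y where n: "n \<in> {0..<int p ^ l}" "y \<in> Zp p" "b = j (of_int n) \<oplus>\<^bsub>K\<^esub> ?\<pi> \<otimes>\<^bsub>K\<^esub> y"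
    using Zp_approx[OF mem(1)] by blast
  \<comment> \<open>The unipotent matrix that reduces b also replaces u by u - y v, so this
    combination is the one to reduce modulo the determinant.\<close>
  have yu: "u \<oplus>\<^bsub>K\<^esub> \<ominus>\<^bsub>K\<^esub> y \<otimes>\<^bsub>K\<^esub> v \<in> Zp p" using n mem by simp
  obtain u' y1 where u': "u' \<in> {0..<int p ^ (i + l)}" "y1 \<in> Zp p"
      "u \<oplus>\<^bsub>K\<^esub> \<ominus>\<^bsub>K\<^esub> y \<otimes>\<^bsub>K\<^esub> v = j (of_int u') \<oplus>\<^bsub>K\<^esub> ?D \<otimes>\<^bsub>K\<^esub> y1"
    using Zp_approx[OF yu] by blast
  obtain v' y2 where v': "v' \<in> {0..<int p ^ (i + l)}" "y2 \<in> Zp p" "v = j (of_int v') \<oplus>\<^bsub>K\<^esub> ?D \<otimes>\<^bsub>K\<^esub> y2"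
    using Zp_approx[OF mem(3)] by blast
  let ?g = "((\<one>\<^bsub>K\<^esub>, \<ominus>\<^bsub>K\<^esub> y, \<zero>\<^bsub>K\<^esub>, \<one>\<^bsub>K\<^esub>), (\<ominus>\<^bsub>K\<^esub> y1, \<ominus>\<^bsub>K\<^esub> y2))"
  have c: "y \<in> carrier K" "y1 \<in> carrier K" "y2 \<in> carrier K" using n u' v' by auto
  have g: "?g \<in> Gamma_Hp p"
    using n u' v' by (auto simp: Gamma_Hp_iff a_minus_def intro!: bexI[of _ "\<one>\<^bsub>K\<^esub>"])
  have D: "heis_det K x = ?D" unfolding assms(2) by (simp add: a_minus_def power_add j_simps)
  have canc: "(r \<oplus>\<^bsub>K\<^esub> s \<otimes>\<^bsub>K\<^esub> t) \<oplus>\<^bsub>K\<^esub> s \<otimes>\<^bsub>K\<^esub> \<ominus>\<^bsub>K\<^esub> t = r"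
    if "r \<in> carrier K" "s \<in> carrier K" "t \<in> carrier K" for r s t
    using that by (simp add: K.r_minus K.a_assoc K.r_neg)
  have 1: "b \<oplus>\<^bsub>K\<^esub> \<ominus>\<^bsub>K\<^esub> y \<otimes>\<^bsub>K\<^esub> ?\<pi> = j (of_int n)"
    using canc[of "j (of_int n)" ?\<pi> y] c n(3) K.m_comm[of "\<ominus>\<^bsub>K\<^esub> y" ?\<pi>] by simp
  have 2: "(u \<oplus>\<^bsub>K\<^esub> \<ominus>\<^bsub>K\<^esub> y \<otimes>\<^bsub>K\<^esub> v) \<oplus>\<^bsub>K\<^esub> ?D \<otimes>\<^bsub>K\<^esub> \<ominus>\<^bsub>K\<^esub> y1 = j (of_int u')"
    unfolding u'(3) by (rule canc) (use c in auto)
  have 3: "v \<oplus>\<^bsub>K\<^esub> ?D \<otimes>\<^bsub>K\<^esub> \<ominus>\<^bsub>K\<^esub> y2 = j (of_int v')"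
    unfolding v'(3) by (rule canc) (use c in auto)
  have "heis_mult K ?g x = ((j (of_nat p ^ i), b \<oplus>\<^bsub>K\<^esub> \<ominus>\<^bsub>K\<^esub> y \<otimes>\<^bsub>K\<^esub> ?\<pi>, \<zero>\<^bsub>K\<^esub>, ?\<pi>),
      ((u \<oplus>\<^bsub>K\<^esub> \<ominus>\<^bsub>K\<^esub> y \<otimes>\<^bsub>K\<^esub> v) \<oplus>\<^bsub>K\<^esub> ?D \<otimes>\<^bsub>K\<^esub> \<ominus>\<^bsub>K\<^esub> y1, v \<oplus>\<^bsub>K\<^esub> ?D \<otimes>\<^bsub>K\<^esub> \<ominus>\<^bsub>K\<^esub> y2))"
    using D c unfolding assms(2) heis_mult.simps Let_def by (simp only:) simp
  also have "\<dots> = heis_map j ((of_nat p ^ i, of_int n, 0, of_nat p ^ l), (of_int u', of_int v'))"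
    unfolding 1 2 3 by (simp add: j_simps)
  finally show ?thesis using g n(1) u'(1) v'(1)
    by (intro bexI[of _ ?g] bexI[of _ "((of_nat p ^ i, of_int n, 0, of_nat p ^ l), (of_int u', of_int v'))"])
      (auto simp: hnf_def intro!: image_eqI[of _ _ "(n, u', v')"])
qed

lemma hnf_exists:
  assumes "x \<in> Delta_Hp p"
  shows "\<exists>g\<in>Gamma_Hp p. \<exists>i l. \<exists>h\<in>hnf i l. x = g \<otimes>\<^bsub>\<GG>\<^esub> heis_map j h"
proof -
  interpret \<Gamma>: subgroup "Gamma_Hp p" \<GG> by (rule Gamma_Hp_subgroup)
  obtain g1 a b d u v where 1: "g1 \<in> Gamma_Hp p" "heis_mult K g1 x = ((a, b, \<zero>\<^bsub>K\<^esub>, d), (u, v))"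
    using reduce_lower_left[OF assms] by metis
  let ?x1 = "heis_mult K g1 x"
  have x1: "?x1 \<in> Delta_Hp p" using 1 assms Gamma_Hp_mult_Delta_Hp by blast
  obtain g2 i l b u v where 2: "g2 \<in> Gamma_Hp p"
    "heis_mult K g2 ?x1 = ((j (of_nat p ^ i), b, \<zero>\<^bsub>K\<^esub>, j (of_nat p ^ l)), (u, v))"
    using reduce_diagonal[OF x1 1(2)] by metis
  let ?x2 = "heis_mult K g2 ?x1"
  have x2: "?x2 \<in> Delta_Hp p" using 2 x1 Gamma_Hp_mult_Delta_Hp by blast
  obtain g3 h where 3: "g3 \<in> Gamma_Hp p" "h \<in> hnf i l" "heis_mult K g3 ?x2 = heis_map j h"
    using reduce_hnf[OF x2 2(2)] by metis
  have c: "g1 \<in> carrier \<GG>" "g2 \<in> carrier \<GG>" "g3 \<in> carrier \<GG>" "x \<in> carrier \<GG>"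
    using 1 2 3 assms Delta_Hp_sub by auto
  have "heis_map j h = (g3 \<otimes>\<^bsub>\<GG>\<^esub> g2 \<otimes>\<^bsub>\<GG>\<^esub> g1) \<otimes>\<^bsub>\<GG>\<^esub> x"
    using 3(3) c by (simp add: GG_mult[symmetric] \<GG>.m_assoc)
  then have "x = inv\<^bsub>\<GG>\<^esub> (g3 \<otimes>\<^bsub>\<GG>\<^esub> g2 \<otimes>\<^bsub>\<GG>\<^esub> g1) \<otimes>\<^bsub>\<GG>\<^esub> heis_map j h"
    using c by (metis \<GG>.inv_solve_left \<GG>.m_closed)
  moreover have "inv\<^bsub>\<GG>\<^esub> (g3 \<otimes>\<^bsub>\<GG>\<^esub> g2 \<otimes>\<^bsub>\<GG>\<^esub> g1) \<in> Gamma_Hp p" using 1 2 3 by simp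
  ultimately show ?thesis using 3(2) by blast
qed

lemma hnf_det: assumes "h \<in> hnf i l" shows "heis_det ring_of_type_algebra h = of_nat p ^ (i + l)"
  "heis_entries h \<subseteq> \<int>"
proof -
  obtain n u v :: int where h: "h = ((of_nat p ^ i, of_int n, 0, of_nat p ^ l), (of_int u, of_int v))"
    using assms by (auto simp: hnf_def)
  show "heis_det ring_of_type_algebra h = of_nat p ^ (i + l)"
    unfolding h by (simp add: power_add rat_ring_simps)
  show "heis_entries h \<subseteq> \<int>" unfolding h by auto
qed

text \<open>Taking determinants, those of g1 and g2 are integral, so p^(i' + l') divides p^(i + l)
  in \<open>Zp p\<close>.\<close>

lemma hnf_det_bound:
  assumes h: "h \<in> hnf i l" "h' \<in> hnf i' l'" and g: "g1 \<in> Gamma_Hp p" "g2 \<in> Gamma_Hp p"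
    and eq: "heis_map j h = g1 \<otimes>\<^bsub>\<GG>\<^esub> heis_map j h' \<otimes>\<^bsub>\<GG>\<^esub> g2"
  shows "i' + l' \<le> i + l"
proof -
  have car: "heis_entries (heis_map j h') \<subseteq> carrier K" "heis_entries g1 \<subseteq> carrier K" "heis_entries g2 \<subseteq> carrier K"
    using g by (auto simp: j.heis_map_entries Gamma_Hp_iff subset_iff)
  have det: "heis_det K (heis_map j k) = j (heis_det ring_of_type_algebra k)" for k
    by (rule j.heis_map_det) (simp add: ring_of_type_algebra_def)
  have dg: "heis_det K g1 \<in> Zp p" "heis_det K g2 \<in> Zp p"
    using g K.heis_det_subring(2)[OF Zp_subring] by (auto simp: Gamma_Hp_iff)
  let ?D = "j (of_nat p ^ (i + l))" and ?D' = "j (of_nat p ^ (i' + l'))"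
  have "?D = heis_det K g1 \<otimes>\<^bsub>K\<^esub> ?D' \<otimes>\<^bsub>K\<^esub> heis_det K g2"
    using arg_cong[OF eq, of "heis_det K"] car
    by (simp add: GG_mult K.heis_det_mult K.heis_mult_entries det hnf_det(1)[OF h(1)] hnf_det(1)[OF h(2)])
  then have D: "?D = ?D' \<otimes>\<^bsub>K\<^esub> (heis_det K g1 \<otimes>\<^bsub>K\<^esub> heis_det K g2)"
    using dg by (simp add: K.m_ac)
  have p0: "(of_nat p :: rat) \<noteq> 0" using p_gt_1 by auto
  have "j (of_nat p ^ (i + l) / of_nat p ^ (i' + l')) = j (inverse (of_nat p ^ (i' + l'))) \<otimes>\<^bsub>K\<^esub> ?D"
    by (simp add: j_simps(1)[symmetric] divide_inverse mult.commute)
  also have "\<dots> = (j (inverse (of_nat p ^ (i' + l'))) \<otimes>\<^bsub>K\<^esub> ?D') \<otimes>\<^bsub>K\<^esub> (heis_det K g1 \<otimes>\<^bsub>K\<^esub> heis_det K g2)"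
    unfolding D using dg by (simp add: K.m_assoc)
  also have "j (inverse (of_nat p ^ (i' + l'))) \<otimes>\<^bsub>K\<^esub> ?D' = \<one>\<^bsub>K\<^esub>"
    using p0 by (simp flip: j_simps)
  finally have "j (of_nat p ^ (i + l) / of_nat p ^ (i' + l')) \<in> Zp p" using dg by simp
  then have "av (of_nat p ^ (i + l) / of_nat p ^ (i' + l')) \<le> 1" by (simp add: j_mem_Zp_iff)
  then have "real p ^ (i' + l') \<le> real p ^ (i + l)"
    using p_gt_1 by (simp add: av_divide av_power power_divide field_simps)
  then show ?thesis using p_gt_1 by (simp add: power_le_imp_le_exp)
qed

text \<open>Each right coset inside the double coset of x contains a Hermite form. By
  \<open>hnf_det_bound\<close> its two exponents sum to at most i + l, those of a form for x itself,
  and only finitely many forms satisfy this.\<close>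

sublocale L: hecke_pair \<GG> "Gamma_Hp p" "Delta_Hp p"
proof (intro hecke_pair.intro hecke_pair_axioms.intro)
  show "group \<GG>" by (rule \<GG>.group_axioms)
  interpret \<Gamma>: subgroup "Gamma_Hp p" \<GG> by (rule Gamma_Hp_subgroup)
  show "subgroup (Gamma_Hp p) \<GG>" by (rule Gamma_Hp_subgroup)
  show "Gamma_Hp p \<subseteq> Delta_Hp p" by (rule Gamma_Hp_sub_Delta_Hp)
  show "Delta_Hp p \<subseteq> carrier \<GG>" by (rule Delta_Hp_sub)
  show "x \<otimes>\<^bsub>\<GG>\<^esub> y \<in> Delta_Hp p" if "x \<in> Delta_Hp p" "y \<in> Delta_Hp p" for x y
    using that by (rule Delta_Hp_mult)
  fix x assume x: "x \<in> Delta_Hp p"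
  obtain g i l h where h: "g \<in> Gamma_Hp p" "h \<in> hnf i l" "x = g \<otimes>\<^bsub>\<GG>\<^esub> heis_map j h"
    using hnf_exists[OF x] by blast
  let ?F = "\<Union>i'\<le>i + l. \<Union>l'\<le>i + l. hnf i' l'"
  have "(#>\<^bsub>\<GG>\<^esub>) (Gamma_Hp p) ` double_coset \<GG> (Gamma_Hp p) x \<subseteq> (\<lambda>h. Gamma_Hp p #>\<^bsub>\<GG>\<^esub> heis_map j h) ` ?F"
  proof
    fix C assume "C \<in> (#>\<^bsub>\<GG>\<^esub>) (Gamma_Hp p) ` double_coset \<GG> (Gamma_Hp p) x"
    then obtain g1 g2 where C: "C = Gamma_Hp p #>\<^bsub>\<GG>\<^esub> (g1 \<otimes>\<^bsub>\<GG>\<^esub> x \<otimes>\<^bsub>\<GG>\<^esub> g2)" and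
      g12: "g1 \<in> Gamma_Hp p" "g2 \<in> Gamma_Hp p"
      by (auto simp only: mem_double_coset_iff image_iff)
    let ?y = "g1 \<otimes>\<^bsub>\<GG>\<^esub> x \<otimes>\<^bsub>\<GG>\<^esub> g2"
    have y: "?y \<in> Delta_Hp p" using g12 x Gamma_Hp_sub_Delta_Hp by (auto intro!: Delta_Hp_mult)
    obtain g' i' l' h' where h': "g' \<in> Gamma_Hp p" "h' \<in> hnf i' l'" "?y = g' \<otimes>\<^bsub>\<GG>\<^esub> heis_map j h'"
      using hnf_exists[OF y] by blast
    have xc: "x \<in> carrier \<GG>" using x Delta_Hp_sub by blast
    have solve: "b = inv\<^bsub>\<GG>\<^esub> a \<otimes>\<^bsub>\<GG>\<^esub> c \<and> b \<in> carrier \<GG>" if "c = a \<otimes>\<^bsub>\<GG>\<^esub> b" "a \<in> carrier \<GG>" "b \<in> carrier \<GG>" for a b c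
      using that by (simp add: \<GG>.m_assoc[symmetric])
    have hc: "heis_map j k \<in> carrier \<GG>" if "k \<in> hnf a b" for a b k
    proof -
      have "(of_nat p :: rat) \<noteq> 0" using p_gt_1 by auto
      then have "of_nat p ^ (a + b) \<in> Units (ring_of_type_algebra :: rat ring)"
        unfolding Units_def
        by (auto simp: ring_of_type_algebra_def intro!: exI[of _ "inverse (of_nat p ^ (a + b))"])
      then have "k \<in> carrier (heis_group ring_of_type_algebra)"
        using hnf_det(1)[OF that] by (simp add: heis_group_def) (simp add: ring_of_type_algebra_def)
      then show ?thesis unfolding G_Hp_def by (rule j.heis_map_closed)
    qed
    have "heis_map j h = inv\<^bsub>\<GG>\<^esub> g \<otimes>\<^bsub>\<GG>\<^esub> x"
      using solve[OF h(3)] hc[OF h(2)] h(1) by simp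
    also have "x = inv\<^bsub>\<GG>\<^esub> g1 \<otimes>\<^bsub>\<GG>\<^esub> ?y \<otimes>\<^bsub>\<GG>\<^esub> inv\<^bsub>\<GG>\<^esub> g2"
      using xc g12 by (simp add: \<GG>.m_assoc) (simp add: \<GG>.m_assoc[symmetric])
    \<comment> \<open>The forms h and h' come from two elements of one double coset; eliminating x
      and y exhibits them as equivalent, which is the input of the determinant bound.\<close>
    finally have "heis_map j h = (inv\<^bsub>\<GG>\<^esub> g \<otimes>\<^bsub>\<GG>\<^esub> inv\<^bsub>\<GG>\<^esub> g1 \<otimes>\<^bsub>\<GG>\<^esub> g') \<otimes>\<^bsub>\<GG>\<^esub> heis_map j h' \<otimes>\<^bsub>\<GG>\<^esub> inv\<^bsub>\<GG>\<^esub> g2"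
      unfolding h'(3) using g12 h' h hc[OF h'(2)] by (simp add: \<GG>.m_assoc)
    then have "i' + l' \<le> i + l"
      using h h' g12 by (intro hnf_det_bound[OF h(2) h'(2)]) auto
    then have "h' \<in> ?F" using h'(2) by (intro UN_I[of i'] UN_I[of l']) auto
    moreover have "C = Gamma_Hp p #>\<^bsub>\<GG>\<^esub> heis_map j h'"
      unfolding C h'(3)
      using \<GG>.coset_mult_assoc[OF \<Gamma>.subset _ hc[OF h'(2)], of g'] \<GG>.coset_join2[OF _ Gamma_Hp_subgroup, of g'] h'(1)
      by simp
    ultimately show "C \<in> (\<lambda>h. Gamma_Hp p #>\<^bsub>\<GG>\<^esub> heis_map j h) ` ?F" by blast
  qed
  then show "finite ((#>\<^bsub>\<GG>\<^esub>) (Gamma_Hp p) ` double_coset \<GG> (Gamma_Hp p) x)"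
    by (rule finite_subset) (auto intro!: finite_hnf)
qed

end

section \<open>Localisation\<close>

abbreviation rat_ring :: "rat ring" where "rat_ring \<equiv> ring_of_type_algebra"

interpretation Q: cring rat_ring by (rule cring_from_type_algebra)

lemma Ints_subring: "subring \<int> rat_ring"
  by (rule Q.subringI) (auto simp: rat_ring_simps)

interpretation G_H: group G_H
  unfolding G_H_def by (rule Q.heis_group_is_group)

abbreviation loc :: "nat \<Rightarrow> rat heis \<Rightarrow> padic heis" where
  "loc q \<equiv> heis_map (padic_of_rat q)"

lemma G_H_mult: "x \<otimes>\<^bsub>G_H\<^esub> y = heis_mult rat_ring x y"
  by (simp add: G_H_def heis_group_def)

lemma G_H_iff: "x \<in> carrier G_H \<longleftrightarrow> heis_det rat_ring x \<noteq> 0"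
proof -
  have "r \<in> Units rat_ring \<longleftrightarrow> r \<noteq> 0" for r
    by (auto simp: Units_def rat_ring_simps intro!: exI[of _ "inverse r"])
  then show ?thesis by (simp add: G_H_def heis_group_def rat_ring_simps)
qed

lemma Gamma_H_iff:
  "x \<in> Gamma_H \<longleftrightarrow> heis_entries x \<subseteq> \<int> \<and> (\<exists>y\<in>\<int>. heis_det rat_ring x * y = 1)"
  unfolding Gamma_H_def by (simp add: Q.heis_Gamma_iff[OF Ints_subring] rat_ring_simps)

lemma Delta_H_iff: "x \<in> Delta_H \<longleftrightarrow> x \<in> carrier G_H \<and> heis_entries x \<subseteq> \<int>"
  by (auto simp: Delta_H_def heis_Delta_def G_H_def)

context
  fixes q :: nat assumes q: "prime q"
begin

interpretation padic q by unfold_locales (rule q)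

lemma loc_closed: "x \<in> carrier G_H \<Longrightarrow> loc q x \<in> carrier (G_Hp q)"
  unfolding G_H_def G_Hp_def by (rule j.heis_map_closed)

lemma loc_mult: "loc q (x \<otimes>\<^bsub>G_H\<^esub> y) = loc q x \<otimes>\<^bsub>G_Hp q\<^esub> loc q y"
  unfolding G_H_mult GG_mult by (rule j.heis_map_mult) (auto simp: rat_ring_simps)

lemma loc_Delta_iff:
  assumes "x \<in> carrier G_H"
  shows "loc q x \<in> Delta_Hp q \<longleftrightarrow> (\<forall>e\<in>heis_entries x. padic_abs q e \<le> 1)"
  using loc_closed[OF assms]
  by (auto simp: Delta_Hp_def heis_Delta_def G_Hp_def j.heis_map_entries j_mem_Zp_iff)

text \<open>An inverse of the determinant in \<open>Zp q\<close> must be the image of the rational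
  inverse, so invertibility can be tested by an absolute value on the rationals.\<close>

lemma loc_Gamma_iff:
  assumes "x \<in> carrier G_H"
  shows "loc q x \<in> Gamma_Hp q \<longleftrightarrow>
    (\<forall>e\<in>heis_entries x. padic_abs q e \<le> 1) \<and> padic_abs q (inverse (heis_det rat_ring x)) \<le> 1"
proof -
  let ?d = "heis_det rat_ring x"
  have d: "?d \<noteq> 0" using assms G_H_iff by simp
  have det: "heis_det K (loc q x) = j ?d" by (rule j.heis_map_det) (simp add: rat_ring_simps)
  have one: "j ?d \<otimes>\<^bsub>K\<^esub> j (inverse ?d) = \<one>\<^bsub>K\<^esub>" using d by (simp flip: j_simps)
  have "(\<exists>y\<in>Zp q. j ?d \<otimes>\<^bsub>K\<^esub> y = \<one>\<^bsub>K\<^esub>) \<longleftrightarrow> j (inverse ?d) \<in> Zp q"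
  proof
    assume "\<exists>y\<in>Zp q. j ?d \<otimes>\<^bsub>K\<^esub> y = \<one>\<^bsub>K\<^esub>"
    then obtain y where y: "y \<in> Zp q" "j ?d \<otimes>\<^bsub>K\<^esub> y = \<one>\<^bsub>K\<^esub>" by blast
    then have "y = j (inverse ?d)"
      using one K.inv_unique[of y "j ?d" "j (inverse ?d)"] K.m_comm[of y "j ?d"] by simp
    then show "j (inverse ?d) \<in> Zp q" using y by simp
  qed (use one in blast)
  then show ?thesis by (auto simp: Gamma_Hp_iff det j.heis_map_entries j_mem_Zp_iff)
qed

lemma loc_one: "loc q \<one>\<^bsub>G_H\<^esub> = \<one>\<^bsub>G_Hp q\<^esub>"
  by (simp add: G_H_def G_Hp_def heis_group_def rat_ring_simps j_simps)

lemma loc_inv: assumes "x \<in> carrier G_H" shows "loc q (inv\<^bsub>G_H\<^esub> x) = inv\<^bsub>G_Hp q\<^esub> loc q x"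
proof -
  have "loc q (inv\<^bsub>G_H\<^esub> x) \<otimes>\<^bsub>G_Hp q\<^esub> loc q x = \<one>\<^bsub>G_Hp q\<^esub>"
    using assms by (simp add: loc_mult[symmetric] loc_one)
  then show ?thesis using assms loc_closed \<GG>.inv_equality by simp
qed

end

section \<open>Integrality as a condition at all primes\<close>

lemma Ints_iff_padic: "(x::rat) \<in> \<int> \<longleftrightarrow> (\<forall>q. prime q \<longrightarrow> padic_abs q x \<le> 1)"
proof
  assume "x \<in> \<int>"
  then obtain n where n: "x = of_int n" by (rule Ints_cases)
  show "\<forall>q. prime q \<longrightarrow> padic_abs q x \<le> 1"
    unfolding n by (intro allI impI padic.av_of_int_le_1 padic.intro)
qed (use int_if_all_padic_int in blast)

lemma Delta_H_iff_loc:
  assumes "x \<in> carrier G_H"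
  shows "x \<in> Delta_H \<longleftrightarrow> (\<forall>q. prime q \<longrightarrow> loc q x \<in> Delta_Hp q)"
  using assms by (auto simp: Delta_H_iff loc_Delta_iff Ints_iff_padic subset_iff)

lemma Gamma_H_iff_loc:
  assumes "x \<in> carrier G_H"
  shows "x \<in> Gamma_H \<longleftrightarrow> (\<forall>q. prime q \<longrightarrow> loc q x \<in> Gamma_Hp q)"
proof -
  let ?d = "heis_det rat_ring x"
  have d: "?d \<noteq> 0" using assms G_H_iff by simp
  have "?d * y = 1 \<longleftrightarrow> y = inverse ?d" for y using d by (auto simp: field_simps)
  then have "x \<in> Gamma_H \<longleftrightarrow> heis_entries x \<subseteq> \<int> \<and> inverse ?d \<in> \<int>" by (auto simp: Gamma_H_iff)
  then show ?thesis using assms by (auto simp: loc_Gamma_iff Ints_iff_padic subset_iff)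
qed

lemma Gamma_H_carrier: "x \<in> Gamma_H \<Longrightarrow> x \<in> carrier G_H"
  by (auto simp: Gamma_H_iff G_H_iff)

lemma loc_Gamma: "\<lbrakk>x \<in> Gamma_H; prime q\<rbrakk> \<Longrightarrow> loc q x \<in> Gamma_Hp q"
  using Gamma_H_iff_loc[OF Gamma_H_carrier] by blast

lemma Gamma_H_subgroup: "subgroup Gamma_H G_H"
  unfolding Gamma_H_def G_H_def by (rule Q.heis_Gamma_subgroup[OF Ints_subring])

text \<open>Outside the divisors of the nonzero integer determinant, the determinant is a unit at
  q.\<close>

lemma finite_bad_primes:
  assumes "x \<in> Delta_H" shows "finite {q. prime q \<and> loc q x \<notin> Gamma_Hp q}"
proof -
  have x: "x \<in> carrier G_H" "heis_entries x \<subseteq> \<int>" using assms by (auto simp: Delta_H_iff)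
  have "heis_det rat_ring x \<in> \<int>" using Q.heis_det_subring(2)[OF Ints_subring x(2)] .
  then obtain n where n: "heis_det rat_ring x = of_int n" by (rule Ints_cases)
  have n0: "n \<noteq> 0" using x(1) n by (simp add: G_H_iff)
  have "{q. prime q \<and> loc q x \<notin> Gamma_Hp q} \<subseteq> {q. q dvd nat \<bar>n\<bar>}"
  proof
    fix q assume "q \<in> {q. prime q \<and> loc q x \<notin> Gamma_Hp q}"
    then have q: "prime q" "loc q x \<notin> Gamma_Hp q" by auto
    interpret padic q using q by unfold_locales
    have "int q dvd n"
    proof (rule ccontr)
      assume "\<not> int q dvd n"
      then have "padic_abs q (inverse (heis_det rat_ring x)) = 1"
        using n by (simp add: av_inverse av_of_int_eq_1)
      then show False using q x by (auto simp: loc_Gamma_iff Ints_iff_padic subset_iff)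
    qed
    then show "q \<in> {q. q dvd nat \<bar>n\<bar>}" by (simp add: nat_abs_dvd_iff int_dvd_int_iff[symmetric])
  qed
  moreover have "finite {q. q dvd nat \<bar>n\<bar>}" using n0 by (intro finite_divisors_nat) auto
  ultimately show ?thesis by (rule finite_subset)
qed

text \<open>The right cosets in the double coset of x inject into a finite product of finite sets. A
  coset is determined by its localisations at all primes, and away from the bad primes of x every
  element of the double coset localises into \<open>Gamma_Hp q\<close>, so only the bad primes
  distinguish cosets.\<close>

interpretation H: hecke_pair G_H Gamma_H Delta_H
proof (intro hecke_pair.intro hecke_pair_axioms.intro)
  show "group G_H" by (rule G_H.group_axioms)
  show "subgroup Gamma_H G_H" by (rule Gamma_H_subgroup)
  show "Gamma_H \<subseteq> Delta_H"
    unfolding Gamma_H_def Delta_H_def by (rule Q.heis_Gamma_sub_Delta[OF Ints_subring])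
  show "Delta_H \<subseteq> carrier G_H" by (auto simp: Delta_H_iff)
  show "x \<otimes>\<^bsub>G_H\<^esub> y \<in> Delta_H" if "x \<in> Delta_H" "y \<in> Delta_H" for x y
    using that unfolding Delta_H_def G_H_def by (rule Q.heis_Delta_mult[OF Ints_subring])
  fix x assume x: "x \<in> Delta_H"
  then have xc: "x \<in> carrier G_H" by (simp add: Delta_H_iff)
  let ?P = "{q. prime q \<and> loc q x \<notin> Gamma_Hp q}"
  let ?S = "double_coset G_H Gamma_H x"
  let ?F = "\<lambda>y. \<lambda>q\<in>?P. Gamma_Hp q #>\<^bsub>G_Hp q\<^esub> loc q y"
  have S: "\<exists>g\<in>Gamma_H. \<exists>h\<in>Gamma_H. y = g \<otimes>\<^bsub>G_H\<^esub> x \<otimes>\<^bsub>G_H\<^esub> h" if "y \<in> ?S" for y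
    using that by (simp only: mem_double_coset_iff)
  have Sc: "y \<in> carrier G_H" if "y \<in> ?S" for y using S[OF that] xc Gamma_H_carrier by auto
  have locS: "loc q y \<in> double_coset (G_Hp q) (Gamma_Hp q) (loc q x)" if y: "y \<in> ?S" and q: "prime q" for q y
  proof -
    interpret padic q using q by unfold_locales
    obtain g h where "g \<in> Gamma_H" "h \<in> Gamma_H" "y = g \<otimes>\<^bsub>G_H\<^esub> x \<otimes>\<^bsub>G_H\<^esub> h" using S[OF y] by blast
    then show ?thesis
      using loc_Gamma[OF _ q] unfolding L.mem_dc_iff by (metis loc_mult[OF q])
  qed
  show "finite ((#>\<^bsub>G_H\<^esub>) Gamma_H ` ?S)"
  proof (rule finite_image_factor)
    have "?F ` ?S \<subseteq> (\<Pi>\<^sub>E q\<in>?P. (#>\<^bsub>G_Hp q\<^esub>) (Gamma_Hp q) ` double_coset (G_Hp q) (Gamma_Hp q) (loc q x))"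
      using locS by (intro image_subsetI PiE_I) (simp_all only: restrict_apply mem_Collect_eq if_True if_False image_eqI[OF refl] simp_thms)
    moreover have "finite \<dots>"
    proof (rule finite_PiE[OF finite_bad_primes[OF x]])
      fix q assume "q \<in> ?P"
      then interpret padic q by unfold_locales simp
      have "loc q x \<in> Delta_Hp q" using x xc Delta_H_iff_loc prime_p by blast
      then show "finite ((#>\<^bsub>G_Hp q\<^esub>) (Gamma_Hp q) ` double_coset (G_Hp q) (Gamma_Hp q) (loc q x))"
        by (rule L.finite_cosets)
    qed
    ultimately show "finite (?F ` ?S)" by (rule finite_subset)
    fix y z assume yz: "y \<in> ?S" "z \<in> ?S" "?F y = ?F z"
    let ?w = "y \<otimes>\<^bsub>G_H\<^esub> inv\<^bsub>G_H\<^esub> z"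
    have w: "?w \<in> carrier G_H" using Sc yz by simp
    have "loc q ?w \<in> Gamma_Hp q" if q: "prime q" for q
    proof -
      interpret padic q using q by unfold_locales
      have c: "loc q y \<in> carrier (G_Hp q)" "loc q z \<in> carrier (G_Hp q)"
        using Sc yz loc_closed[OF q] by auto
      have eq: "loc q ?w = loc q y \<otimes>\<^bsub>G_Hp q\<^esub> inv\<^bsub>G_Hp q\<^esub> loc q z"
        using Sc yz q by (simp add: loc_mult loc_inv)
      show ?thesis
      proof (cases "q \<in> ?P")
        case True
        then have "Gamma_Hp q #>\<^bsub>G_Hp q\<^esub> loc q y = Gamma_Hp q #>\<^bsub>G_Hp q\<^esub> loc q z"
          using fun_cong[OF yz(3), of q] by simp
        then show ?thesis using eq c by (simp add: L.rcos_eq_iff)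
      next
        case False
        then have "loc q x \<in> Gamma_Hp q" using q by simp
        then have "loc q y \<in> Gamma_Hp q" "loc q z \<in> Gamma_Hp q"
          using locS[OF yz(1) q] locS[OF yz(2) q] by (auto simp: L.mem_dc_iff)
        then show ?thesis using eq by simp
      qed
    qed
    then have "?w \<in> Gamma_H" using Gamma_H_iff_loc[OF w] by blast
    then have "?w \<otimes>\<^bsub>G_H\<^esub> z \<in> Gamma_H #>\<^bsub>G_H\<^esub> z" by (auto simp: r_coset_def)
    then have "y \<in> Gamma_H #>\<^bsub>G_H\<^esub> z" using Sc yz by (simp add: G_H.m_assoc)
    then show "Gamma_H #>\<^bsub>G_H\<^esub> y = Gamma_H #>\<^bsub>G_H\<^esub> z"
      by (rule G_H.repr_independence[OF _ Sc[OF yz(2)] Gamma_H_subgroup, symmetric])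
  qed
qed

section \<open>Rational automorphisms concentrated at one prime\<close>

definition G0 :: "nat \<Rightarrow> rat heis set" where
  "G0 p = {x \<in> carrier G_H. \<forall>q. prime q \<longrightarrow> q \<noteq> p \<longrightarrow> loc q x \<in> Gamma_Hp q}"

lemma G0_subgroup: "subgroup (G0 p) G_H"
proof (rule G_H.subgroupI)
  have "\<one>\<^bsub>G_H\<^esub> \<in> Gamma_H" by simp
  then have "\<one>\<^bsub>G_H\<^esub> \<in> G0 p" using Gamma_H_iff_loc[of "\<one>\<^bsub>G_H\<^esub>"] by (simp add: G0_def)
  then show "G0 p \<noteq> {}" by blast
qed (auto simp: G0_def loc_mult loc_inv padic.intro
      subgroup.m_inv_closed[OF padic.Gamma_Hp_subgroup] subgroup.m_closed[OF padic.Gamma_Hp_subgroup])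

text \<open>The entries are integers and the determinant is a power of p, hence a unit at every
  other prime. With \<open>hnf_exists\<close> this yields the density condition of
  \<open>hecke_transfer\<close>.\<close>

lemma hnf_G0:
  assumes "prime p" "h \<in> padic.hnf p i l"
  shows "h \<in> G0 p"
proof -
  interpret P: padic p using assms by unfold_locales
  have d: "heis_det rat_ring h = of_nat p ^ (i + l)" and e: "heis_entries h \<subseteq> \<int>"
    using P.hnf_det[OF assms(2)] by auto
  have h: "h \<in> carrier G_H" using assms(1) by (auto simp: G_H_iff d)
  have "loc q h \<in> Gamma_Hp q" if q: "prime q" "q \<noteq> p" for q
  proof -
    interpret padic q using q by unfold_locales
    have "\<not> int q dvd int p" using q assms(1) primes_dvd_imp_eq by auto
    then have "padic_abs q (of_nat p) = 1" using av_of_int_eq_1[of "int p"] by simp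
    then have "padic_abs q (inverse (heis_det rat_ring h)) = 1" by (simp add: d av_inverse av_power)
    then show ?thesis using e q by (auto simp: loc_Gamma_iff[OF q(1) h] Ints_iff_padic subset_iff)
  qed
  then show ?thesis using h by (simp add: G0_def)
qed

lemma hecke_transfer_loc: assumes "prime p"
  shows "hecke_transfer G_H Gamma_H Delta_H (G_Hp p) (Gamma_Hp p) (Delta_Hp p) (G0 p) (loc p)"
proof -
  interpret padic p using assms by unfold_locales
  show ?thesis
  proof (intro hecke_transfer.intro hecke_transfer_axioms.intro)
    show "hecke_pair G_H Gamma_H Delta_H" by (rule H.hecke_pair_axioms)
    show "hecke_pair (G_Hp p) (Gamma_Hp p) (Delta_Hp p)" by (rule L.hecke_pair_axioms)
    show "subgroup (G0 p) G_H" by (rule G0_subgroup)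
    show "loc p x \<in> carrier (G_Hp p)" if "x \<in> G0 p" for x
      using that loc_closed[OF assms] by (simp add: G0_def)
    show "loc p (x \<otimes>\<^bsub>G_H\<^esub> y) = loc p x \<otimes>\<^bsub>G_Hp p\<^esub> loc p y" for x y by (rule loc_mult[OF assms])
    show "Gamma_H = {a \<in> G0 p. loc p a \<in> Gamma_Hp p}"
      using Gamma_H_iff_loc Gamma_H_carrier assms unfolding G0_def by blast
    show "x \<in> Delta_H" if "x \<in> G0 p" "loc p x \<in> Delta_Hp p" for x
    proof -
      have "x \<in> carrier G_H" using that by (simp add: G0_def)
      moreover have "loc q x \<in> Delta_Hp q" if q: "prime q" for q
        using \<open>x \<in> G0 p\<close> \<open>loc p x \<in> Delta_Hp p\<close> q padic.Gamma_Hp_sub_Delta_Hp[OF padic.intro[OF q]]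
        by (cases "q = p") (auto simp: G0_def)
      ultimately show ?thesis using Delta_H_iff_loc by blast
    qed
    show "\<exists>a\<in>G0 p. \<exists>g\<in>Gamma_Hp p. x = g \<otimes>\<^bsub>G_Hp p\<^esub> loc p a" if x: "x \<in> Delta_Hp p" for x
      using hnf_exists[OF x] hnf_G0[OF assms] by blast
  qed
qed

text \<open>Multiplication is componentwise and \<open>Gamma_hat\<close> is the full product, so the
  adelic condition decouples into one condition per prime. Away from p the component of
  \<open>local_embed\<close> is the identity, whose double coset is
  \<open>Gamma_Hp q\<close>.\<close>

lemma eta_mem_double_coset_iff:
  assumes p: "prime p" and x: "x \<in> carrier G_H" and \<alpha>: "\<alpha> \<in> Delta_Hp p"
  shows "eta x \<in> double_coset G_hat Gamma_hat (local_embed p \<alpha>) \<longleftrightarrow>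
    x \<in> G0 p \<and> loc p x \<in> double_coset (G_Hp p) (Gamma_Hp p) \<alpha>"
proof -
  note dc = mem_double_coset_iff
  let ?m = "\<lambda>g h q. g q \<otimes>\<^bsub>G_Hp q\<^esub> local_embed p \<alpha> q \<otimes>\<^bsub>G_Hp q\<^esub> h q"
  have "eta x \<in> double_coset G_hat Gamma_hat (local_embed p \<alpha>) \<longleftrightarrow>
     (\<exists>g\<in>Gamma_hat. \<exists>h\<in>Gamma_hat. eta x = (\<lambda>q\<in>primes. ?m g h q))"
    unfolding dc by (simp add: G_hat_def product_group_def restrict_def cong: if_cong)
  also have "\<dots> \<longleftrightarrow> (\<forall>q. prime q \<longrightarrow> loc q x \<in> double_coset (G_Hp q) (Gamma_Hp q) (local_embed p \<alpha> q))"
  proof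
    assume "\<exists>g\<in>Gamma_hat. \<exists>h\<in>Gamma_hat. eta x = (\<lambda>q\<in>primes. ?m g h q)"
    then obtain g h where gh: "g \<in> Gamma_hat" "h \<in> Gamma_hat" "eta x = (\<lambda>q\<in>primes. ?m g h q)" by blast
    show "\<forall>q. prime q \<longrightarrow> loc q x \<in> double_coset (G_Hp q) (Gamma_Hp q) (local_embed p \<alpha> q)"
    proof (intro allI impI)
      fix q :: nat assume q: "prime q"
      have "loc q x = ?m g h q" using fun_cong[OF gh(3), of q] q by (simp add: eta_def)
      moreover have "g q \<in> Gamma_Hp q" "h q \<in> Gamma_Hp q" using gh q by (auto simp: Gamma_hat_def)
      ultimately show "loc q x \<in> double_coset (G_Hp q) (Gamma_Hp q) (local_embed p \<alpha> q)"
        unfolding dc by blast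
    qed
  next
    assume "\<forall>q. prime q \<longrightarrow> loc q x \<in> double_coset (G_Hp q) (Gamma_Hp q) (local_embed p \<alpha> q)"
    then have "\<forall>q. \<exists>g h. prime q \<longrightarrow> g \<in> Gamma_Hp q \<and> h \<in> Gamma_Hp q \<and>
        loc q x = g \<otimes>\<^bsub>G_Hp q\<^esub> local_embed p \<alpha> q \<otimes>\<^bsub>G_Hp q\<^esub> h"
      unfolding dc by blast
    then obtain g h where gh: "\<And>q. prime q \<Longrightarrow> g q \<in> Gamma_Hp q \<and> h q \<in> Gamma_Hp q \<and> loc q x = ?m g h q"
      by metis
    \<comment> \<open>The choice functions g and h are arbitrary off the primes; restriction makes
      them extensional, as membership in the product set demands.\<close>
    have "restrict g primes \<in> Gamma_hat" "restrict h primes \<in> Gamma_hat"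
      using gh by (auto simp: Gamma_hat_def)
    moreover have "eta x = (\<lambda>q\<in>primes. ?m (restrict g primes) (restrict h primes) q)"
      using gh by (auto simp: eta_def intro!: restrict_ext)
    ultimately show "\<exists>g\<in>Gamma_hat. \<exists>h\<in>Gamma_hat. eta x = (\<lambda>q\<in>primes. ?m g h q)" by blast
  qed
  also have "\<dots> \<longleftrightarrow> x \<in> G0 p \<and> loc p x \<in> double_coset (G_Hp p) (Gamma_Hp p) \<alpha>"
  proof -
    have "double_coset (G_Hp q) (Gamma_Hp q) (local_embed p \<alpha> q)
        = (if q = p then double_coset (G_Hp p) (Gamma_Hp p) \<alpha> else Gamma_Hp q)" if q: "prime q" for q
      using hecke_pair.dc_one[OF hecke_transfer.axioms(2)[OF hecke_transfer_loc[OF q]]] q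
      by (simp add: local_embed_def)
    then show ?thesis using x p by (auto simp: G0_def)
  qed
  finally show ?thesis .
qed

section \<open>The composite of \<open>iota\<close> and \<open>eta_star\<close> as a
  pullback\<close>

context
  fixes p :: nat assumes p: "prime p"
begin

interpretation padic p by unfold_locales (rule p)

interpretation T: hecke_transfer G_H Gamma_H Delta_H "G_Hp p" "Gamma_Hp p" "Delta_Hp p" "G0 p" "loc p"
  by (rule hecke_transfer_loc[OF p])

lemma double_coset_sub_Delta_Hp:
  assumes "D \<in> double_cosets (G_Hp p) (Gamma_Hp p) (Delta_Hp p)" shows "D \<subseteq> Delta_Hp p"
  using assms L.dc_sub_Delta unfolding double_cosets_def by blast

text \<open>An element of \<open>G0 p\<close> with localisation in D is integral at p, and elsewhere
  by definition of \<open>G0 p\<close>, hence lies in \<open>Delta_H\<close>. So the index set can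
  be described at p alone.\<close>

lemma eta_star_iota_frag_of:
  assumes D: "D \<in> double_cosets (G_Hp p) (Gamma_Hp p) (Delta_Hp p)"
  shows "(eta_star \<circ> iota p) (frag_of D) = (\<Sum>E\<in>H.dc ` {b \<in> G0 p. loc p b \<in> D}. frag_of E)"
proof -
  note r = L.coset_rep_double_coset[OF D]
  have "{b \<in> Delta_H. eta b \<in> double_coset G_hat Gamma_hat (local_embed p (coset_rep D))}
      = {b \<in> G0 p. loc p b \<in> D}" (is "?A = ?B")
  proof (intro equalityI subsetI)
    fix b assume "b \<in> ?A"
    then show "b \<in> ?B" using eta_mem_double_coset_iff[OF p _ r(2), of b] r(3) H.Delta_closed[of b] by auto
  next
    fix b assume b: "b \<in> ?B"
    then have "b \<in> Delta_H" using T.Delta_vimage[of b] D double_coset_sub_Delta_Hp by blast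
    then show "b \<in> ?A" using b eta_mem_double_coset_iff[OF p _ r(2), of b] r(3) H.Delta_closed[of b] by auto
  qed
  then show ?thesis by (simp add: iota_def eta_star_def double_cosets_def)
qed

text \<open>The preimage of D is a union of global double cosets, each occurring once in the sum. So
  the coefficient at \<xi> is 1 or 0 according to whether \<xi> itself lies in the preimage.\<close>

lemma hfun_eta_star_iota_frag_of:
  assumes D: "D \<in> double_cosets (G_Hp p) (Gamma_Hp p) (Delta_Hp p)" and \<xi>: "\<xi> \<in> carrier G_H"
  shows "H.hfun ((eta_star \<circ> iota p) (frag_of D)) \<xi> = T.pullback (L.hfun (frag_of D)) \<xi>"
proof -
  let ?S = "H.dc ` {b \<in> G0 p. loc p b \<in> D}"
  obtain \<alpha> where \<alpha>: "\<alpha> \<in> Delta_Hp p" "D = L.dc \<alpha>" using D by (auto simp: double_cosets_def)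
  have mem: "loc p b \<in> D \<longleftrightarrow> L.dc (loc p b) = D" if "b \<in> G0 p" for b
    using \<alpha> T.f_closed[OF that] L.dc_eq_iff by auto
  have "H.dc \<xi> \<in> ?S \<longleftrightarrow> \<xi> \<in> G0 p \<and> loc p \<xi> \<in> D"
  proof
    assume "H.dc \<xi> \<in> ?S"
    then obtain b where b: "b \<in> G0 p" "loc p b \<in> D" "H.dc \<xi> = H.dc b" by auto
    then have "\<xi> \<in> H.dc b" using \<xi> H.dc_self by blast
    then show "\<xi> \<in> G0 p \<and> loc p \<xi> \<in> D" using T.f_dc[OF b(1)] b mem by metis
  qed auto
  moreover have "H.hfun ((eta_star \<circ> iota p) (frag_of D)) \<xi> = (if H.dc \<xi> \<in> ?S then 1 else 0)"
  proof -
    have "H.hfun ((eta_star \<circ> iota p) (frag_of D)) \<xi> = (\<Sum>E\<in>?S. if E = H.dc \<xi> then 1 else 0)"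
      unfolding eta_star_iota_frag_of[OF D] H.hfun_def lookup_sum
      by (intro sum.cong refl) (simp add: lookup_single when_def)
    then show ?thesis using T.finite_vimage_double_coset[OF D] by simp
  qed
  ultimately show ?thesis using mem[of \<xi>] by (auto simp: T.pullback_def L.hfun_def)
qed

lemma eta_star_iota_closed:
  assumes "x \<in> carrier (R_Hp p)" shows "(eta_star \<circ> iota p) x \<in> carrier R_H"
    and "\<xi> \<in> carrier G_H \<Longrightarrow> H.hfun ((eta_star \<circ> iota p) x) \<xi> = T.pullback (L.hfun x) \<xi>"
proof -
  have x: "Poly_Mapping.keys x \<subseteq> double_cosets (G_Hp p) (Gamma_Hp p) (Delta_Hp p)"
    using assms by (simp add: R_Hp_def L.carrier_R)
  have expand: "(eta_star \<circ> iota p) x = frag_extend (\<lambda>D. (eta_star \<circ> iota p) (frag_of D)) x"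
    by (simp add: eta_star_def iota_def frag_extend_compose[unfolded comp_def])
  have "Poly_Mapping.keys ((eta_star \<circ> iota p) (frag_of D)) \<subseteq> double_cosets G_H Gamma_H Delta_H"
    if D: "D \<in> Poly_Mapping.keys x" for D
  proof -
    have D': "D \<in> double_cosets (G_Hp p) (Gamma_Hp p) (Delta_Hp p)" using D x by blast
    have "b \<in> Delta_H" if "b \<in> G0 p" "loc p b \<in> D" for b
      using T.Delta_vimage[of b] that D' double_coset_sub_Delta_Hp by blast
    then show ?thesis unfolding eta_star_iota_frag_of[OF D']
      by (intro order.trans[OF keys_sum]) (auto simp: double_cosets_def)
  qed
  then show "(eta_star \<circ> iota p) x \<in> carrier R_H"
    unfolding R_H_def H.carrier_R expand
    by (intro order.trans[OF keys_frag_extend] UN_least)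
  assume \<xi>: "\<xi> \<in> carrier G_H"
  have "H.hfun ((eta_star \<circ> iota p) x) \<xi>
      = (\<Sum>D\<in>Poly_Mapping.keys x. poly_mapping.lookup x D * T.pullback (L.hfun (frag_of D)) \<xi>)"
    unfolding expand H.hfun_frag_extend using x \<xi>
    by (intro sum.cong refl) (auto simp: hfun_eta_star_iota_frag_of simp del: comp_apply)
  also have "\<dots> = T.pullback (L.hfun x) \<xi>"
    unfolding L.hfun_expand[of x] T.pullback_def by auto
  finally show "H.hfun ((eta_star \<circ> iota p) x) \<xi> = T.pullback (L.hfun x) \<xi>" .
qed

lemma eta_star_iota_hom:
  "ring_hom_ring (R_Hp p) R_H (eta_star \<circ> iota p)" "inj_on (eta_star \<circ> iota p) (carrier (R_Hp p))"
  using T.ring_hom_of_pullback[of "eta_star \<circ> iota p"] eta_star_iota_closed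
  by (simp_all add: R_Hp_def R_H_def del: comp_apply)

lemma hfun_eta_star_iota:
  assumes "x \<in> carrier (R_Hp p)" "\<xi> \<in> carrier G_H"
  shows "H.hfun ((eta_star \<circ> iota p) x) \<xi>
    = (if \<xi> \<in> G0 p then hecke_pair.hfun (G_Hp p) (Gamma_Hp p) x (loc p \<xi>) else 0)"
  using eta_star_iota_closed(2)[OF assms] by (simp only: T.pullback_def)

end

lemma G0_loc: "\<lbrakk>x \<in> G0 p; prime q; q \<noteq> p\<rbrakk> \<Longrightarrow> loc q x \<in> Gamma_Hp q"
  by (simp add: G0_def)

text \<open>A contributing \<gamma> lies in \<open>G0 q\<close> and \<xi> \<gamma>^-1 lies in
  \<open>G0 p\<close>. The quotient of two such \<gamma> lies in both groups, hence in
  \<open>Gamma_H\<close>, so a single coset contributes.\<close>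

lemma hfun_mult_coprime:
  assumes p: "prime p" and q: "prime q" and ne: "p \<noteq> q"
    and x: "x \<in> carrier (R_Hp p)" and y: "y \<in> carrier (R_Hp q)" and \<xi>: "\<xi> \<in> carrier G_H"
  shows "H.hfun ((eta_star \<circ> iota p) x \<otimes>\<^bsub>R_H\<^esub> (eta_star \<circ> iota q) y) \<xi> =
    (if \<forall>r. prime r \<longrightarrow> r \<noteq> p \<longrightarrow> r \<noteq> q \<longrightarrow> loc r \<xi> \<in> Gamma_Hp r
     then hecke_pair.hfun (G_Hp p) (Gamma_Hp p) x (loc p \<xi>) * hecke_pair.hfun (G_Hp q) (Gamma_Hp q) y (loc q \<xi>)
     else 0)"
proof -
  interpret P: padic p using p by unfold_locales
  interpret Q: padic q using q by unfold_locales
  interpret TP: hecke_transfer G_H Gamma_H Delta_H "G_Hp p" "Gamma_Hp p" "Delta_Hp p" "G0 p" "loc p"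
    by (rule hecke_transfer_loc[OF p])
  interpret TQ: hecke_transfer G_H Gamma_H Delta_H "G_Hp q" "Gamma_Hp q" "Delta_Hp q" "G0 q" "loc q"
    by (rule hecke_transfer_loc[OF q])
  let ?x = "H.hfun ((eta_star \<circ> iota p) x)" and ?y = "H.hfun ((eta_star \<circ> iota q) y)"
  let ?f = "\<lambda>\<gamma>. ?x (\<xi> \<otimes>\<^bsub>G_H\<^esub> inv\<^bsub>G_H\<^esub> \<gamma>) * ?y \<gamma>"
  let ?c = "P.L.hfun x (loc p \<xi>) * Q.L.hfun y (loc q \<xi>)"
  let ?cond = "\<forall>r. prime r \<longrightarrow> r \<noteq> p \<longrightarrow> r \<noteq> q \<longrightarrow> loc r \<xi> \<in> Gamma_Hp r"
  have split: "loc r \<xi> = loc r (\<xi> \<otimes>\<^bsub>G_H\<^esub> inv\<^bsub>G_H\<^esub> \<gamma>) \<otimes>\<^bsub>G_Hp r\<^esub> loc r \<gamma>"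
    if "prime r" "\<gamma> \<in> carrier G_H" for r \<gamma>
    using that \<xi> by (simp add: loc_mult[symmetric] G_H.m_assoc)
  \<comment> \<open>At p the factor \<gamma> lies in \<open>Gamma_Hp p\<close>, at q the factor
    \<xi> \<gamma>^-1 lies in \<open>Gamma_Hp q\<close>. By invariance each function may be
    evaluated at the localisation of \<xi>.\<close>
  have val: "?f \<gamma> = ?c" if \<gamma>: "\<gamma> \<in> G0 q" "\<xi> \<otimes>\<^bsub>G_H\<^esub> inv\<^bsub>G_H\<^esub> \<gamma> \<in> G0 p" for \<gamma>
  proof -
    have gc: "\<gamma> \<in> carrier G_H" by (rule TQ.G0_closed[OF \<gamma>(1)])
    have xg: "\<xi> \<otimes>\<^bsub>G_H\<^esub> inv\<^bsub>G_H\<^esub> \<gamma> \<in> carrier G_H" by (rule TP.G0_closed[OF \<gamma>(2)])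
    have "P.L.dc (loc p \<xi>) = P.L.dc (loc p (\<xi> \<otimes>\<^bsub>G_H\<^esub> inv\<^bsub>G_H\<^esub> \<gamma>))"
      unfolding split[OF p gc] by (rule P.L.dc_mult_right[OF loc_closed[OF p xg] G0_loc[OF \<gamma>(1) p ne]])
    then have "?x (\<xi> \<otimes>\<^bsub>G_H\<^esub> inv\<^bsub>G_H\<^esub> \<gamma>) = P.L.hfun x (loc p \<xi>)"
      unfolding hfun_eta_star_iota[OF p x xg] P.L.hfun_def using \<gamma>(2) by (simp only: if_True)
    moreover have "Q.L.dc (loc q \<xi>) = Q.L.dc (loc q \<gamma>)"
      unfolding split[OF q gc] by (rule Q.L.dc_mult_left[OF loc_closed[OF q gc] G0_loc[OF \<gamma>(2) q ne[symmetric]]])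
    then have "?y \<gamma> = Q.L.hfun y (loc q \<xi>)"
      unfolding hfun_eta_star_iota[OF q y gc] Q.L.hfun_def using \<gamma>(1) by (simp only: if_True)
    ultimately show ?thesis by (simp only:)
  qed
  have supp: "a \<in> G0 q \<and> \<xi> \<otimes>\<^bsub>G_H\<^esub> inv\<^bsub>G_H\<^esub> a \<in> G0 p" if "?f a \<noteq> 0" "a \<in> carrier G_H" for a
    using that(1) hfun_eta_star_iota[OF p x G_H.m_closed[OF \<xi> G_H.inv_closed[OF that(2)]]]
      hfun_eta_star_iota[OF q y that(2)]
    by (metis mult_eq_0_iff)
  have "H.hfun ((eta_star \<circ> iota p) x \<otimes>\<^bsub>R_H\<^esub> (eta_star \<circ> iota q) y) \<xi> = H.coset_sum ?f"
    using H.hfun_mult[OF _ _ \<xi>] eta_star_iota_closed(1)[OF p x] eta_star_iota_closed(1)[OF q y]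
    unfolding R_H_def H.conv_def by blast
  also have "\<dots> = (if ?cond then ?c else 0)"
  proof (cases "\<exists>\<gamma>\<in>carrier G_H. ?f \<gamma> \<noteq> 0")
    case True
    then obtain \<gamma> where \<gamma>: "\<gamma> \<in> carrier G_H" "?f \<gamma> \<noteq> 0" by blast
    have g: "\<gamma> \<in> G0 q" "\<xi> \<otimes>\<^bsub>G_H\<^esub> inv\<^bsub>G_H\<^esub> \<gamma> \<in> G0 p" using supp \<gamma> by auto
    have "H.coset_sum ?f = ?f \<gamma>"
    proof (rule H.coset_sum_single)
      show "H.left_invariant ?f" by (intro H.conv_integrand_left_invariant H.hfun_inv \<xi>)
      show "\<gamma> \<in> carrier G_H" by (rule \<gamma>)
      fix a assume a: "a \<in> carrier G_H" "?f a \<noteq> 0"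
      have a': "a \<in> G0 q" "\<xi> \<otimes>\<^bsub>G_H\<^esub> inv\<^bsub>G_H\<^esub> a \<in> G0 p" using supp a by auto
      have "a \<otimes>\<^bsub>G_H\<^esub> inv\<^bsub>G_H\<^esub> \<gamma> = inv\<^bsub>G_H\<^esub> (\<xi> \<otimes>\<^bsub>G_H\<^esub> inv\<^bsub>G_H\<^esub> a) \<otimes>\<^bsub>G_H\<^esub> (\<xi> \<otimes>\<^bsub>G_H\<^esub> inv\<^bsub>G_H\<^esub> \<gamma>)"
        using a \<gamma> \<xi> by (simp add: G_H.inv_mult_group G_H.m_assoc) (simp add: G_H.m_assoc[symmetric])
      then have "a \<otimes>\<^bsub>G_H\<^esub> inv\<^bsub>G_H\<^esub> \<gamma> \<in> G0 p" using a' g by simp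
      moreover have "a \<otimes>\<^bsub>G_H\<^esub> inv\<^bsub>G_H\<^esub> \<gamma> \<in> G0 q" using a' g by simp
      ultimately show "a \<otimes>\<^bsub>G_H\<^esub> inv\<^bsub>G_H\<^esub> \<gamma> \<in> Gamma_H"
        using TP.mem_Gamma_iff G0_loc[OF _ p ne] by blast
    qed
    moreover have ?cond
    proof (intro allI impI)
      fix r assume r: "prime r" "r \<noteq> p" "r \<noteq> q"
      interpret padic r using r by unfold_locales
      show "loc r \<xi> \<in> Gamma_Hp r"
        unfolding split[OF r(1) \<gamma>(1)] using G0_loc[OF g(2) r(1,2)] G0_loc[OF g(1) r(1,3)] by simp
    qed
    ultimately show ?thesis using val[OF g] by simp
  next
    case False
    have "\<not> (?cond \<and> ?c \<noteq> 0)"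
    proof
      assume c: "?cond \<and> ?c \<noteq> 0"
      \<comment> \<open>Existence of a contributing coset: a nonzero value of y puts \<xi> into the
        monoid at q, so density gives a in \<open>G0 q\<close> with the same right coset at q. Then
        \<xi> a^-1 lies in \<Gamma> at every prime other than p, and \<open>val\<close> makes its
        term nonzero.\<close>
      have "loc q \<xi> \<in> Delta_Hp q"
        using c Q.L.hfun_outside[of y "loc q \<xi>"] y loc_closed[OF q \<xi>] by (auto simp: R_Hp_def)
      then obtain a g where a: "a \<in> G0 q" "g \<in> Gamma_Hp q" "loc q \<xi> = g \<otimes>\<^bsub>G_Hp q\<^esub> loc q a"
        using TQ.dense by blast
      have ac: "a \<in> carrier G_H" by (rule TQ.G0_closed[OF a(1)])
      have "loc r (\<xi> \<otimes>\<^bsub>G_H\<^esub> inv\<^bsub>G_H\<^esub> a) \<in> Gamma_Hp r" if r: "prime r" "r \<noteq> p" for r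
      proof -
        interpret padic r using r by unfold_locales
        have eq: "loc r (\<xi> \<otimes>\<^bsub>G_H\<^esub> inv\<^bsub>G_H\<^esub> a) = loc r \<xi> \<otimes>\<^bsub>G_Hp r\<^esub> inv\<^bsub>G_Hp r\<^esub> loc r a"
          unfolding loc_mult[OF r(1)] loc_inv[OF r(1) ac] ..
        show ?thesis
        proof (cases "r = q")
          case True
          have "g \<otimes>\<^bsub>G_Hp q\<^esub> loc q a \<otimes>\<^bsub>G_Hp q\<^esub> inv\<^bsub>G_Hp q\<^esub> loc q a = g"
            using a(2) TQ.f_closed[OF a(1)] by (simp add: Q.\<GG>.m_assoc)
          then show ?thesis using a(2) unfolding True eq[unfolded True a(3)] by simp
        next
          case False
          then have "loc r \<xi> \<in> Gamma_Hp r" "loc r a \<in> Gamma_Hp r" using c r G0_loc[OF a(1) r(1)] by blast+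
          then show ?thesis unfolding eq by simp
        qed
      qed
      then have "\<xi> \<otimes>\<^bsub>G_H\<^esub> inv\<^bsub>G_H\<^esub> a \<in> G0 p"
        unfolding G0_def using G_H.m_closed[OF \<xi> G_H.inv_closed[OF ac]] by blast
      then have "?f a \<noteq> 0" using val[OF a(1)] c by metis
      then show False using False ac by blast
    qed
    moreover have "H.coset_sum ?f = H.coset_sum (\<lambda>_. 0)"
      using False by (intro H.coset_sum_cong) blast
    ultimately show ?thesis by (auto simp: H.coset_sum_def)
  qed
  finally show ?thesis .
qed

lemma eta_star_iota_commute:
  assumes p: "prime p" and q: "prime q" and ne: "p \<noteq> q"
    and x: "x \<in> carrier (R_Hp p)" and y: "y \<in> carrier (R_Hp q)"
  shows "(eta_star \<circ> iota p) x \<otimes>\<^bsub>R_H\<^esub> (eta_star \<circ> iota q) y = (eta_star \<circ> iota q) y \<otimes>\<^bsub>R_H\<^esub> (eta_star \<circ> iota p) x"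
proof (rule H.hfun_eqI)
  note c = eta_star_iota_closed(1)[OF p x, unfolded R_H_def] eta_star_iota_closed(1)[OF q y, unfolded R_H_def]
  show "(eta_star \<circ> iota p) x \<otimes>\<^bsub>R_H\<^esub> (eta_star \<circ> iota q) y \<in> carrier H.R"
    "(eta_star \<circ> iota q) y \<otimes>\<^bsub>R_H\<^esub> (eta_star \<circ> iota p) x \<in> carrier H.R"
    using H.R_mult_closed c by (auto simp: R_H_def simp del: comp_apply)
  fix \<xi> assume "\<xi> \<in> Delta_H"
  then have \<xi>: "\<xi> \<in> carrier G_H" by simp
  show "H.hfun ((eta_star \<circ> iota p) x \<otimes>\<^bsub>R_H\<^esub> (eta_star \<circ> iota q) y) \<xi>
      = H.hfun ((eta_star \<circ> iota q) y \<otimes>\<^bsub>R_H\<^esub> (eta_star \<circ> iota p) x) \<xi>"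
    unfolding hfun_mult_coprime[OF p q ne x y \<xi>] hfun_mult_coprime[OF q p ne[symmetric] y x \<xi>]
    by (auto simp: mult.commute)
qed

section \<open>A local double coset that splits globally\<close>

text \<open>At q distinct from p both factors are integral and their product is an automorphism, so
  \<gamma> is one by \<open>heis_Gamma_right_factor\<close>. Thus convolutions evaluated on
  \<open>G0 p\<close> see only values on \<open>G0 p\<close>, which makes restriction to
  \<open>G0 p\<close> multiplicative.\<close>

lemma G0_factor:
  assumes p: "prime p" and \<xi>: "\<xi> \<in> G0 p" and \<gamma>: "\<gamma> \<in> Delta_H" "\<xi> \<otimes>\<^bsub>G_H\<^esub> inv\<^bsub>G_H\<^esub> \<gamma> \<in> Delta_H"
  shows "\<gamma> \<in> G0 p"
proof -
  have c: "\<xi> \<in> carrier G_H" "\<gamma> \<in> carrier G_H" using \<xi> \<gamma>(1) by (simp_all add: G0_def)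
  let ?\<beta> = "\<xi> \<otimes>\<^bsub>G_H\<^esub> inv\<^bsub>G_H\<^esub> \<gamma>"
  have b: "?\<beta> \<in> carrier G_H" using c by simp
  have "loc q \<gamma> \<in> Gamma_Hp q" if q: "prime q" "q \<noteq> p" for q
  proof -
    interpret padic q using q by unfold_locales
    have d: "loc q \<gamma> \<in> Delta_Hp q" "loc q ?\<beta> \<in> Delta_Hp q"
      using Delta_H_iff_loc[OF c(2)] Delta_H_iff_loc[OF b] \<gamma> q(1) by blast+
    have "?\<beta> \<otimes>\<^bsub>G_H\<^esub> \<gamma> = \<xi>" using c by (simp add: G_H.m_assoc)
    then have "heis_mult K (loc q ?\<beta>) (loc q \<gamma>) = loc q \<xi>"
      using loc_mult[OF q(1), of ?\<beta> \<gamma>] unfolding GG_mult by (simp only:)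
    then have "heis_mult K (loc q ?\<beta>) (loc q \<gamma>) \<in> heis_Gamma K (Zp q)"
      using G0_loc[OF \<xi> q] unfolding Gamma_Hp_def by (simp only:)
    then show ?thesis
      using K.heis_Gamma_right_factor[OF Zp_subring] d unfolding Gamma_Hp_def Delta_Hp_iff by blast
  qed
  then show ?thesis using c(2) unfolding G0_def by blast
qed

text \<open>Induction over the generated ring. Sums and negatives are immediate; the cases with
  content are generators from another prime and products.\<close>

lemma generated_pullback:
  assumes p: "prime p"
    and z: "z \<in> generate_ring R_H (\<Union>q \<in> {q::nat. prime q}. (eta_star \<circ> iota q) ` carrier (R_Hp q))"
  shows "\<exists>x\<in>carrier (R_Hp p). \<forall>\<xi>\<in>G0 p. H.hfun z \<xi> = hecke_pair.hfun (G_Hp p) (Gamma_Hp p) x (loc p \<xi>)"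
proof -
  interpret P: padic p using p by unfold_locales
  interpret T: hecke_transfer G_H Gamma_H Delta_H "G_Hp p" "Gamma_Hp p" "Delta_Hp p" "G0 p" "loc p"
    by (rule hecke_transfer_loc[OF p])
  let ?A = "\<Union>q \<in> {q::nat. prime q}. (eta_star \<circ> iota q) ` carrier (R_Hp q)"
  have gen: "?A \<subseteq> carrier H.R" using eta_star_iota_closed(1) unfolding R_H_def by blast
  have car: "z \<in> carrier H.R" if "z \<in> generate_ring H.R ?A" for z
    using H.hecke.generate_ring_in_carrier[OF gen that] .
  have R_Hp: "R_Hp p = P.L.R" by (simp add: R_Hp_def)
  show ?thesis using z unfolding R_H_def R_Hp
  proof (induction rule: generate_ring.induct)
    case one
    have "H.hfun \<one>\<^bsub>H.R\<^esub> \<xi> = P.L.hfun \<one>\<^bsub>P.L.R\<^esub> (loc p \<xi>)" if "\<xi> \<in> G0 p" for \<xi>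
      unfolding H.hfun_one[OF T.G0_closed[OF that]] P.L.hfun_one[OF T.f_closed[OF that]]
      using that T.mem_Gamma_iff[of \<xi>] by (simp only: simp_thms)
    then show ?case using P.L.R_one_closed by blast
  next
    case (incl h)
    then obtain q x where q: "prime q" and x: "x \<in> carrier (R_Hp q)" and h: "h = (eta_star \<circ> iota q) x" by blast
    show ?case
    proof (cases "q = p")
      case True
      then have "H.hfun h \<xi> = P.L.hfun x (loc p \<xi>)" if "\<xi> \<in> G0 p" for \<xi>
        using hfun_eta_star_iota[OF q x T.G0_closed[OF that]] that unfolding h by (simp only: if_True)
      then show ?thesis using x True unfolding R_Hp_def by blast
    next
      case False
      interpret Q: padic q using q by unfold_locales
      \<comment> \<open>On \<open>G0 p\<close>, a function pulled back from q is supported on the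
        intersection with \<open>G0 q\<close>, which is \<open>Gamma_H\<close>, and is constant
        there with the value of x at the identity. It is therefore a multiple of the unit
        element.\<close>
      let ?c = "Q.L.hfun x \<one>\<^bsub>G_Hp q\<^esub>"
      let ?y = "frag_cmul ?c \<one>\<^bsub>P.L.R\<^esub>"
      have y: "?y \<in> carrier P.L.R" using P.L.R_one_closed unfolding P.L.carrier_R by auto
      have "H.hfun h \<xi> = P.L.hfun ?y (loc p \<xi>)" if \<xi>: "\<xi> \<in> G0 p" for \<xi>
      proof -
        have xc: "\<xi> \<in> carrier G_H" by (rule T.G0_closed[OF \<xi>])
        have "\<xi> \<in> G0 q \<longleftrightarrow> loc p \<xi> \<in> Gamma_Hp p"
          using \<xi> p False unfolding G0_def by blast
        moreover have "Q.L.hfun x (loc q \<xi>) = ?c"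
        proof -
          have g: "loc q \<xi> \<in> Gamma_Hp q" by (rule G0_loc[OF \<xi> q False])
          have "Q.L.dc (loc q \<xi>) = Q.L.dc \<one>\<^bsub>G_Hp q\<^esub>"
            using Q.L.dc_mult_left[OF Q.\<GG>.one_closed g] Q.\<GG>.r_one[OF loc_closed[OF q xc]] by (simp only:)
          then show ?thesis unfolding Q.L.hfun_def by (simp only:)
        qed
        moreover have "P.L.hfun ?y (loc p \<xi>) = (if loc p \<xi> \<in> Gamma_Hp p then ?c else 0)"
          using P.L.hfun_one[OF T.f_closed[OF \<xi>]] unfolding P.L.hfun_def lookup_frag_cmul by simp
        ultimately show ?thesis unfolding h hfun_eta_star_iota[OF q x xc] by (simp only:)
      qed
      then show ?thesis using y by blast
    qed
  next
    case (a_inv h)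
    then obtain x where x: "x \<in> carrier P.L.R" "\<And>\<xi>. \<xi> \<in> G0 p \<Longrightarrow> H.hfun h \<xi> = P.L.hfun x (loc p \<xi>)" by blast
    have "- x \<in> carrier P.L.R" using x(1) by (simp add: P.L.carrier_R)
    moreover have "H.hfun (\<ominus>\<^bsub>H.R\<^esub> h) \<xi> = P.L.hfun (- x) (loc p \<xi>)" if "\<xi> \<in> G0 p" for \<xi>
      unfolding H.R_a_inv[OF car[OF a_inv.hyps]] H.hfun_minus P.L.hfun_minus x(2)[OF that] ..
    ultimately show ?case by blast
  next
    case (eng_add h k)
    then obtain x y where x: "x \<in> carrier P.L.R" "\<And>\<xi>. \<xi> \<in> G0 p \<Longrightarrow> H.hfun h \<xi> = P.L.hfun x (loc p \<xi>)"
      and y: "y \<in> carrier P.L.R" "\<And>\<xi>. \<xi> \<in> G0 p \<Longrightarrow> H.hfun k \<xi> = P.L.hfun y (loc p \<xi>)" by blast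
    have "x + y \<in> carrier P.L.R" using x(1) y(1) by (rule P.L.R_add_closed)
    moreover have "H.hfun (h \<oplus>\<^bsub>H.R\<^esub> k) \<xi> = P.L.hfun (x + y) (loc p \<xi>)" if "\<xi> \<in> G0 p" for \<xi>
      unfolding H.R_add H.hfun_add P.L.hfun_add x(2)[OF that] y(2)[OF that] ..
    ultimately show ?case by blast
  next
    case (eng_mult h k)
    then obtain x y where x: "x \<in> carrier P.L.R" "\<And>\<xi>. \<xi> \<in> G0 p \<Longrightarrow> H.hfun h \<xi> = P.L.hfun x (loc p \<xi>)"
      and y: "y \<in> carrier P.L.R" "\<And>\<xi>. \<xi> \<in> G0 p \<Longrightarrow> H.hfun k \<xi> = P.L.hfun y (loc p \<xi>)" by blast
    note hk = car[OF eng_mult.hyps(1)] car[OF eng_mult.hyps(2)]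
    have "H.hfun (h \<otimes>\<^bsub>H.R\<^esub> k) \<xi> = P.L.hfun (x \<otimes>\<^bsub>P.L.R\<^esub> y) (loc p \<xi>)" if \<xi>: "\<xi> \<in> G0 p" for \<xi>
    proof -
      have xc: "\<xi> \<in> carrier G_H" by (rule T.G0_closed[OF \<xi>])
      have "H.hfun (h \<otimes>\<^bsub>H.R\<^esub> k) \<xi> = H.conv (H.hfun h) (H.hfun k) \<xi>" by (rule H.hfun_mult[OF hk xc])
      also have "\<dots> = H.conv (T.pullback (P.L.hfun x)) (T.pullback (P.L.hfun y)) \<xi>"
        unfolding H.conv_def
      proof (rule H.coset_sum_cong)
        fix \<gamma> assume \<gamma>: "\<gamma> \<in> carrier G_H"
        let ?\<beta> = "\<xi> \<otimes>\<^bsub>G_H\<^esub> inv\<^bsub>G_H\<^esub> \<gamma>"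
        show "H.hfun h ?\<beta> * H.hfun k \<gamma> = T.pullback (P.L.hfun x) ?\<beta> * T.pullback (P.L.hfun y) \<gamma>"
        proof (cases "\<gamma> \<in> G0 p")
          case True
          then have "?\<beta> \<in> G0 p" using \<xi> by (intro T.G0_mult T.G0_inv)
          then show ?thesis unfolding T.pullback_def using True x(2) y(2) by (simp only: if_True)
        next
          case False
          \<comment> \<open>Elements of the ring vanish off \<open>Delta_H\<close>, so a \<gamma>
            outside \<open>G0 p\<close> contributes 0 to both convolutions.\<close>
          then have "\<not> (\<gamma> \<in> Delta_H \<and> ?\<beta> \<in> Delta_H)" using G0_factor[OF p \<xi>] by blast
          then have "H.hfun h ?\<beta> * H.hfun k \<gamma> = 0"
            using H.hfun_outside[OF hk(1) G_H.m_closed[OF xc G_H.inv_closed[OF \<gamma>]]]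
              H.hfun_outside[OF hk(2) \<gamma>] by (metis mult_eq_0_iff)
          then show ?thesis unfolding T.pullback_def using False by (simp only: if_False mult_zero_right)
        qed
      qed
      also have "\<dots> = T.pullback (P.L.conv (P.L.hfun x) (P.L.hfun y)) \<xi>"
        by (intro T.conv_pullback P.L.hfun_inv P.L.hfun_outside[OF y(1)] xc)
      also have "\<dots> = P.L.hfun (x \<otimes>\<^bsub>P.L.R\<^esub> y) (loc p \<xi>)"
        unfolding T.pullback_def P.L.hfun_mult[OF x(1) y(1) T.f_closed[OF \<xi>]] using \<xi> by (simp only: if_True)
      finally show ?thesis .
    qed
    then show ?case using P.L.R_mult_closed[OF x(1) y(1)] by blast
  qed
qed

definition xi1 :: "rat heis" where "xi1 = ((5, 0, 0, 125), (1, 5))"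
text \<open>The map from a to det(B)^-1 B a with B = diag(1, 2) sends (1, 5) to (1/2, 5), and 3 is
  the integer representing 1/2 modulo 5.\<close>

definition xi2 :: "rat heis" where "xi2 = ((5, 0, 0, 125), (3, 5))"

lemma xi_mem:
  "xi1 \<in> carrier G_H" "xi2 \<in> carrier G_H" "xi1 \<in> Delta_H" "xi1 \<in> G0 5" "xi2 \<in> G0 5"
proof -
  have d: "heis_det rat_ring xi1 = 625" "heis_det rat_ring xi2 = 625"
    by (simp_all add: xi1_def xi2_def rat_ring_simps)
  have e: "heis_entries xi1 \<subseteq> \<int>" "heis_entries xi2 \<subseteq> \<int>" by (auto simp: xi1_def xi2_def)
  show c: "xi1 \<in> carrier G_H" "xi2 \<in> carrier G_H" using d by (auto simp: G_H_iff)
  show "xi1 \<in> Delta_H" using c e by (simp add: Delta_H_iff)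
  have "loc q x \<in> Gamma_Hp q" if q: "prime q" "q \<noteq> 5" and x: "x = xi1 \<or> x = xi2" for q x
  proof -
    interpret padic q using q by unfold_locales
    have "\<not> q dvd 5" using q primes_dvd_imp_eq[of q 5] by auto
    then have "\<not> int q dvd 5" using int_dvd_int_iff[of q 5] by simp
    then have "padic_abs q 5 = 1" using av_of_int_eq_1[of 5] by simp
    then have "padic_abs q (5 ^ 4) = 1" by (simp only: av_power power_one)
    then have "padic_abs q (inverse 625) = 1" using av_inverse[of 625] by simp
    then show ?thesis using x c e d q loc_Gamma_iff[OF q(1), of x]
      unfolding Ints_iff_padic subset_iff by auto
  qed
  then show "xi1 \<in> G0 5" "xi2 \<in> G0 5" using c unfolding G0_def by blast+
qed

lemma xi_locally_equivalent:
  "loc 5 xi2 \<in> double_coset (G_Hp 5) (Gamma_Hp 5) (loc 5 xi1)"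
proof -
  have p5: "prime (5::nat)" by simp
  interpret padic 5 using p5 by unfold_locales
  \<comment> \<open>The matrix of \<open>?h\<close> compensates diag(1, 2) so that the product is
    again diag(5, 125). Its determinant 1/2 scales the vector (1, 10) to (1/2, 5), and its vector
    entry 1/2 adds 5/2, giving 3. Both determinants are 5-adic units but not units of the
    integers.\<close>
  let ?g = "((1, 0, 0, 2), (0, 0)) :: rat heis" and ?h = "((1, 0, 0, 1/2), (1/2, 0)) :: rat heis"
  have "padic_abs 5 2 = 1" using av_of_int_eq_1[of 2] by simp
  then have av2: "padic_abs 5 2 = 1" "padic_abs 5 (1/2) = 1" by (simp_all add: av_divide)
  have dg: "heis_det rat_ring ?g = 2" "heis_det rat_ring ?h = 1/2" by (simp_all add: rat_ring_simps)
  then have c: "?g \<in> carrier G_H" "?h \<in> carrier G_H" unfolding G_H_iff by auto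
  have g: "loc 5 ?g \<in> Gamma_Hp 5" unfolding loc_Gamma_iff[OF p5 c(1)] dg using av2 by (auto simp: av_inverse)
  have h: "loc 5 ?h \<in> Gamma_Hp 5" unfolding loc_Gamma_iff[OF p5 c(2)] dg using av2 by (auto simp: av_inverse av_divide)
  have "xi2 = ?g \<otimes>\<^bsub>G_H\<^esub> xi1 \<otimes>\<^bsub>G_H\<^esub> ?h"
    by (simp add: G_H_mult xi1_def xi2_def rat_ring_simps Let_def)
  then have "loc 5 xi2 = loc 5 (?g \<otimes>\<^bsub>G_H\<^esub> xi1 \<otimes>\<^bsub>G_H\<^esub> ?h)" by (rule arg_cong)
  also have "\<dots> = loc 5 ?g \<otimes>\<^bsub>G_Hp 5\<^esub> loc 5 xi1 \<otimes>\<^bsub>G_Hp 5\<^esub> loc 5 ?h"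
    unfolding loc_mult[OF p5] by (rule refl)
  finally have "loc 5 xi2 = loc 5 ?g \<otimes>\<^bsub>G_Hp 5\<^esub> loc 5 xi1 \<otimes>\<^bsub>G_Hp 5\<^esub> loc 5 ?h" .
  then show ?thesis using g h unfolding mem_double_coset_iff by blast
qed

text \<open>With e the determinant of k, the equation forces the diagonal entries of g to be 3 e and
  e modulo 5, while its off-diagonal entries have a product divisible by 25. Hence e is congruent to
  3 e^2 = 3 modulo 5, impossible for e = 1 or e = -1.\<close>

lemma xi_not_equivalent: "xi2 \<notin> double_coset G_H Gamma_H xi1"
proof
  assume "xi2 \<in> double_coset G_H Gamma_H xi1"
  then obtain g h where g: "g \<in> Gamma_H" and h: "h \<in> Gamma_H" and eq: "xi2 = g \<otimes>\<^bsub>G_H\<^esub> xi1 \<otimes>\<^bsub>G_H\<^esub> h"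
    unfolding mem_double_coset_iff by blast
  \<comment> \<open>Moving h to the other side leaves a product of two factors on each side, whose
    entries can be compared directly.\<close>
  define k where "k = inv\<^bsub>G_H\<^esub> h"
  have k: "k \<in> Gamma_H" using h by (simp add: k_def)
  have "xi2 \<otimes>\<^bsub>G_H\<^esub> k = g \<otimes>\<^bsub>G_H\<^esub> xi1"
    unfolding eq k_def using g h xi_mem(1) by (simp add: G_H.m_assoc)
  then have eq': "heis_mult rat_ring xi2 k = heis_mult rat_ring g xi1" by (simp only: G_H_mult)
  obtain w x y z b1 b2 where g': "g = ((w, x, y, z), (b1, b2))" by (cases g rule: heis_entries.cases)
  obtain \<alpha> \<beta> \<gamma> \<delta> c1 c2 where k': "k = ((\<alpha>, \<beta>, \<gamma>, \<delta>), (c1, c2))" by (cases k rule: heis_entries.cases)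
  have "w \<in> \<int>" "x \<in> \<int>" "y \<in> \<int>" "z \<in> \<int>" "b1 \<in> \<int>" "b2 \<in> \<int>"
    using g unfolding g' by (auto simp: Gamma_H_iff)
  then obtain w' x' y' z' b1' b2' where gi: "w = of_int w'" "x = of_int x'" "y = of_int y'" "z = of_int z'"
    "b1 = of_int b1'" "b2 = of_int b2'" by (auto elim!: Ints_cases)
  have "\<alpha> \<in> \<int>" "\<beta> \<in> \<int>" "\<gamma> \<in> \<int>" "\<delta> \<in> \<int>" "c1 \<in> \<int>" "c2 \<in> \<int>" and kd: "\<exists>t\<in>\<int>. (\<alpha> * \<delta> - \<beta> * \<gamma>) * t = 1"
    using k unfolding k' by (auto simp: Gamma_H_iff rat_ring_simps)
  then obtain \<alpha>' \<beta>' \<gamma>' \<delta>' c1' c2' where ki: "\<alpha> = of_int \<alpha>'" "\<beta> = of_int \<beta>'" "\<gamma> = of_int \<gamma>'" "\<delta> = of_int \<delta>'"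
    "c1 = of_int c1'" "c2 = of_int c2'" by (auto elim!: Ints_cases)
  define e where "e = \<alpha>' * \<delta>' - \<beta>' * \<gamma>'"
  obtain t where "(\<alpha> * \<delta> - \<beta> * \<gamma>) * of_int t = 1" using kd by (auto elim!: Ints_cases)
  then have "of_int (e * t) = (1 :: rat)" unfolding ki e_def by simp
  then have "e * t = 1" by (simp only: of_int_eq_1_iff)
  then have e: "e = 1 \<or> e = -1" by (metis zmult_eq_1_iff)
  have "5 * \<alpha> = 5 * w" "5 * \<beta> = 125 * x" "125 * \<gamma> = 5 * y" "125 * \<delta> = 125 * z"
    and v: "5 * c1 + (\<alpha> * \<delta> - \<beta> * \<gamma>) * 3 = w + x * 5 + 625 * b1"
      "125 * c2 + (\<alpha> * \<delta> - \<beta> * \<gamma>) * 5 = y + z * 5 + 625 * b2"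
    using eq' unfolding xi1_def xi2_def g' k' by (auto simp: rat_ring_simps Let_def)
  then have "of_int \<alpha>' = (of_int w' :: rat)" "of_int \<beta>' = (of_int (25 * x') :: rat)"
    "of_int y' = (of_int (25 * \<gamma>') :: rat)" "of_int \<delta>' = (of_int z' :: rat)"
    unfolding gi ki by simp_all
  \<comment> \<open>Integrality of k gives the divisibility: its lower left entry is y'/25.\<close>
  then have i: "\<alpha>' = w'" "\<beta>' = 25 * x'" "y' = 25 * \<gamma>'" "\<delta>' = z'" by (simp_all only: of_int_eq_iff)
  have "of_int (5 * c1' + e * 3) = (of_int (w' + x' * 5 + 625 * b1') :: rat)"
    "of_int (125 * c2' + e * 5) = (of_int (y' + z' * 5 + 625 * b2') :: rat)"
    using v unfolding gi ki e_def by simp_all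
  then have v': "5 * c1' + e * 3 = w' + x' * 5 + 625 * b1'" "125 * c2' + e * 5 = y' + z' * 5 + 625 * b2'"
    by (simp_all only: of_int_eq_iff)
  define s where "s = c1' - x' - 125 * b1'"
  define r where "r = 5 * c2' - \<gamma>' - 25 * b2'"
  have w: "w' = 3 * e + 5 * s" using v'(1) by (simp add: s_def)
  have z: "z' = e + 5 * r" using v'(2) i(3) by (simp add: r_def)
  have "e = w' * z' - 25 * (x' * \<gamma>')" unfolding e_def i by simp
  also have "\<dots> = 3 * (e * e) + 5 * (3 * e * r + s * e + 5 * s * r - 5 * (x' * \<gamma>'))"
    unfolding w z by (simp add: algebra_simps)
  \<comment> \<open>Both possible values of e have square 1.\<close>
  finally have "e = 3 + 5 * (3 * e * r + s * e + 5 * s * r - 5 * (x' * \<gamma>'))" using e by auto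
  then obtain m where "e = 3 + 5 * m" by blast
  then show False using e by presburger
qed

theorem theorem4p9:
  shows "(\<forall>p::nat. prime p \<longrightarrow>
            ring_hom_ring (R_Hp p) R_H (eta_star \<circ> iota p) \<and>
            inj_on (eta_star \<circ> iota p) (carrier (R_Hp p)))
       \<and> (\<forall>(p::nat) (q::nat). prime p \<longrightarrow> prime q \<longrightarrow> p \<noteq> q \<longrightarrow>
            (\<forall>x \<in> (eta_star \<circ> iota p) ` carrier (R_Hp p).
             \<forall>y \<in> (eta_star \<circ> iota q) ` carrier (R_Hp q).
               x \<otimes>\<^bsub>R_H\<^esub> y = y \<otimes>\<^bsub>R_H\<^esub> x))
       \<and> generate_ring R_H (\<Union>p \<in> {p::nat. prime p}. (eta_star \<circ> iota p) ` carrier (R_Hp p))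
            \<noteq> carrier R_H"
proof (intro conjI allI impI)
  fix p :: nat assume p: "prime p"
  show "ring_hom_ring (R_Hp p) R_H (eta_star \<circ> iota p)" by (rule eta_star_iota_hom(1)[OF p])
  show "inj_on (eta_star \<circ> iota p) (carrier (R_Hp p))" by (rule eta_star_iota_hom(2)[OF p])
next
  fix p q :: nat assume "prime p" "prime q" "p \<noteq> q"
  then show "\<forall>x \<in> (eta_star \<circ> iota p) ` carrier (R_Hp p). \<forall>y \<in> (eta_star \<circ> iota q) ` carrier (R_Hp q).
      x \<otimes>\<^bsub>R_H\<^esub> y = y \<otimes>\<^bsub>R_H\<^esub> x"
    using eta_star_iota_commute by blast
next
  have p5: "prime (5::nat)" by simp
  interpret padic 5 using p5 by unfold_locales
  \<comment> \<open>The function of this basis element is 1 at \<open>xi1\<close> and 0 at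
    \<open>xi2\<close>, while an element of the generated ring takes equal values at both, since
    they have the same local double coset at 5.\<close>
  let ?z = "frag_of (H.dc xi1)"
  show "generate_ring R_H (\<Union>p \<in> {p::nat. prime p}. (eta_star \<circ> iota p) ` carrier (R_Hp p)) \<noteq> carrier R_H"
    (is "?gen \<noteq> _")
  proof
    assume "?gen = carrier R_H"
    moreover have "?z \<in> carrier R_H"
      using xi_mem(3) unfolding R_H_def H.carrier_R double_cosets_def by simp
    ultimately have "?z \<in> ?gen" by (simp only:)
    then obtain x where x: "\<And>\<xi>. \<xi> \<in> G0 5 \<Longrightarrow> H.hfun ?z \<xi> = L.hfun x (loc 5 \<xi>)"
      using generated_pullback[OF p5] by blast
    have "L.dc (loc 5 xi2) = L.dc (loc 5 xi1)"
      using xi_locally_equivalent xi_mem(1,2) loc_closed[OF p5] L.dc_eq_iff by blast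
    then have "H.hfun ?z xi1 = H.hfun ?z xi2"
      unfolding x[OF xi_mem(4)] x[OF xi_mem(5)] L.hfun_def by (simp only:)
    moreover have "H.dc xi2 \<noteq> H.dc xi1"
      using xi_not_equivalent H.dc_eq_iff[OF xi_mem(1,2)] by blast
    ultimately show False by (auto simp: H.hfun_def)
  qed
qed

end
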